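(* Let $\Sigma\subset T^*S^2$ be a fiberwise star-shaped hypersurface. Then $$\mathcal{A}_{min}(\Sigma,\lambda|_\Sigma)\leq 2\pi\,\mathcal{R}(\Sigma),\qquad\text{where}\quad \mathcal{R}(\Sigma)=\max_{\nu\in\Sigma}\sqrt{g_0^*(\nu,\nu)}.$$
   Context: $S^2\subset\mathbb{R}^3$ is the unit sphere, $g_0$ is the round metric induced from Euclidean space, and $g_0^*$ is the dual metric on $T^*S^2$. $\lambda=\sum_i p_i\,dq_i$ is the tautological one-form on $T^*S^2$. A fiberwise star-shaped hypersurface $\Sigma\subset T^*S^2$ is a smooth compact hypersurface such that for each $q\in S^2$, each positive ray emanating from the origin $0_q\in T_q^*S^2$ intersects $\Sigma_q=\Sigma\cap T_q^*S^2$ in exactly one point and transversely. Then $\lambda|_\Sigma$ is a contact form on $\Sigma$. For a contact form $\alpha$ on a closed three-manifold $Y$, the Reeb vector field $R_\alpha$ is determined by $d\alpha(R_\alpha,\cdot)=0$, $\alpha(R_\alpha)=1$; the action of a periodic Reeb orbit $\gamma$ is $\int_\gamma\alpha$ (its period), and $\mathcal{A}_{min}(Y,\alpha)$ is the minimum of the actions of all periodic Reeb orbits. *)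

theory Defs
  imports "HOL-Analysis.Analysis"
begin

text \<open>Smooth maps on an open subset \<open>S\<close> of a Euclidean space: all iterated directional derivatives
  exist and are continuous.\<close>

primrec Ck_on :: "nat \<Rightarrow> 'a::euclidean_space set \<Rightarrow> ('a \<Rightarrow> 'b::real_normed_vector) \<Rightarrow> bool" where
  "Ck_on 0 S f \<longleftrightarrow> continuous_on S f"
| "Ck_on (Suc k) S f \<longleftrightarrow>
     (\<forall>x\<in>S. f differentiable (at x)) \<and> (\<forall>v. Ck_on k S (\<lambda>x. frechet_derivative f (at x) v))"

definition smooth_on :: "'a::euclidean_space set \<Rightarrow> ('a \<Rightarrow> 'b::real_normed_vector) \<Rightarrow> bool" where
  "smooth_on S f \<longleftrightarrow> (\<forall>k. Ck_on k S f)"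

text \<open>Embedded \<open>k\<close>-dimensional smooth submanifolds of a Euclidean space, via slice charts.\<close>

definition smooth_submanifold :: "nat \<Rightarrow> 'a::euclidean_space set \<Rightarrow> bool" where
  "smooth_submanifold k M \<longleftrightarrow>
     (\<forall>x\<in>M. \<exists>U V \<phi> \<psi> L. open U \<and> x \<in> U \<and> open (V :: 'a set) \<and>
        homeomorphism U V \<phi> \<psi> \<and> smooth_on U \<phi> \<and> smooth_on V \<psi> \<and>
        subspace L \<and> dim L = k \<and> \<phi> ` (M \<inter> U) = V \<inter> L)"

definition tangent_space :: "'a::euclidean_space set \<Rightarrow> 'a \<Rightarrow> 'a set" where
  "tangent_space M x =
     {v. \<exists>c \<epsilon>. \<epsilon> > 0 \<and> smooth_on {-\<epsilon><..<\<epsilon>} c \<and> c ` {-\<epsilon><..<\<epsilon>} \<subseteq> M \<and> c (0::real) = x \<and>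
             (c has_vector_derivative v) (at 0)}"

definition transverse_at :: "'a::euclidean_space set \<Rightarrow> 'a set \<Rightarrow> 'a set \<Rightarrow> 'a \<Rightarrow> bool" where
  "transverse_at N A B x \<longleftrightarrow>
     {u + v | u v. u \<in> tangent_space A x \<and> v \<in> tangent_space B x} = tangent_space N x"

text \<open>One-forms on a Euclidean space are functions of a base point and a tangent vector. A form on
  a submanifold \<open>M\<close> is represented by an ambient form, evaluated only on vectors tangent to
  \<open>M\<close>; this is legitimate for the exterior derivative because it commutes with restriction.\<close>

definition ext_deriv :: "('a::euclidean_space \<Rightarrow> 'a \<Rightarrow> real) \<Rightarrow> 'a \<Rightarrow> 'a \<Rightarrow> 'a \<Rightarrow> real" where
  "ext_deriv \<alpha> x u v =
     frechet_derivative (\<lambda>y. \<alpha> y v) (at x) u - frechet_derivative (\<lambda>y. \<alpha> y u) (at x) v"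

text \<open>\<open>v\<close> is the value at \<open>x\<close> of the Reeb vector field of \<open>\<alpha>\<close> restricted to \<open>M\<close>. When
  that restriction is a contact form, there is exactly one such \<open>v\<close> for each \<open>x \<in> M\<close>.\<close>

definition reeb_vector_at ::
    "'a::euclidean_space set \<Rightarrow> ('a \<Rightarrow> 'a \<Rightarrow> real) \<Rightarrow> 'a \<Rightarrow> 'a \<Rightarrow> bool" where
  "reeb_vector_at M \<alpha> x v \<longleftrightarrow>
     v \<in> tangent_space M x \<and> (\<forall>w\<in>tangent_space M x. ext_deriv \<alpha> x v w = 0) \<and> \<alpha> x v = 1"

text \<open>\<open>T\<close> need not be the minimal period, so multiple covers count as periodic orbits.\<close>

definition periodic_reeb_orbit ::
    "'a::euclidean_space set \<Rightarrow> ('a \<Rightarrow> 'a \<Rightarrow> real) \<Rightarrow> (real \<Rightarrow> 'a) \<Rightarrow> real \<Rightarrow> bool" where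
  "periodic_reeb_orbit M \<alpha> \<gamma> T \<longleftrightarrow>
     T > 0 \<and> (\<forall>t. \<gamma> (t + T) = \<gamma> t) \<and>
     (\<forall>t. \<gamma> t \<in> M \<and> (\<exists>v. (\<gamma> has_vector_derivative v) (at t) \<and> reeb_vector_at M \<alpha> (\<gamma> t) v))"

definition orbit_action :: "('a::euclidean_space \<Rightarrow> 'a \<Rightarrow> real) \<Rightarrow> (real \<Rightarrow> 'a) \<Rightarrow> real \<Rightarrow> real" where
  "orbit_action \<alpha> \<gamma> T = integral {0..T} (\<lambda>t. \<alpha> (\<gamma> t) (vector_derivative \<gamma> (at t)))"

definition reeb_actions :: "'a::euclidean_space set \<Rightarrow> ('a \<Rightarrow> 'a \<Rightarrow> real) \<Rightarrow> real set" where
  "reeb_actions M \<alpha> = {orbit_action \<alpha> \<gamma> T | \<gamma> T. periodic_reeb_orbit M \<alpha> \<gamma> T}"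

text \<open>Only meaningful if the minimum exists; see \<open>has_min_action\<close>.\<close>

definition min_action :: "'a::euclidean_space set \<Rightarrow> ('a \<Rightarrow> 'a \<Rightarrow> real) \<Rightarrow> real" where
  "min_action M \<alpha> = (LEAST a. a \<in> reeb_actions M \<alpha>)"

definition has_min_action :: "'a::euclidean_space set \<Rightarrow> ('a \<Rightarrow> 'a \<Rightarrow> real) \<Rightarrow> bool" where
  "has_min_action M \<alpha> \<longleftrightarrow> (\<exists>a\<in>reeb_actions M \<alpha>. \<forall>b\<in>reeb_actions M \<alpha>. a \<le> b)"

lemma periodic_reeb_orbit_action:
  assumes "periodic_reeb_orbit M \<alpha> \<gamma> T"
  shows "orbit_action \<alpha> \<gamma> T = T"
proof -
  have "\<alpha> (\<gamma> t) (vector_derivative \<gamma> (at t)) = 1" for t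
  proof -
    obtain v where v: "(\<gamma> has_vector_derivative v) (at t)" "reeb_vector_at M \<alpha> (\<gamma> t) v"
      using assms unfolding periodic_reeb_orbit_def by blast
    show ?thesis
      using v(2) unfolding vector_derivative_at[OF v(1)] reeb_vector_at_def by blast
  qed
  then have "orbit_action \<alpha> \<gamma> T = integral {0..T} (\<lambda>t. 1)"
    unfolding orbit_action_def by presburger
  moreover have "T > 0"
    using assms unfolding periodic_reeb_orbit_def by blast
  ultimately show ?thesis
    by simp
qed

text \<open>The cotangent bundle of the unit sphere in Euclidean 3-space, as a four-dimensional
  submanifold of \<open>\<real>\<^sup>3 \<times> \<real>\<^sup>3\<close>. The point \<open>(q, p)\<close> stands for the covector \<open>v \<mapsto> p \<bullet> v\<close> on the
  tangent plane of the sphere at \<open>q\<close>, where \<open>p\<close> is itself tangent at \<open>q\<close>; that is, covectors are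
  identified with tangent vectors by the round metric, and so the dual metric becomes the
  Euclidean inner product of the \<open>p\<close> components.\<close>

type_synonym cot = "(real ^ 3) \<times> (real ^ 3)"

definition S2 :: "(real ^ 3) set" where
  "S2 = sphere 0 1"

definition cotangent_fibre :: "real ^ 3 \<Rightarrow> (real ^ 3) set" where
  "cotangent_fibre q = {p. p \<bullet> q = 0}"

definition cotangent_S2 :: "cot set" where
  "cotangent_S2 = {(q, p). q \<in> S2 \<and> p \<in> cotangent_fibre q}"

text \<open>The dual metric; both arguments are meant to lie over the same point of the sphere.\<close>

definition dual_round_metric :: "cot \<Rightarrow> cot \<Rightarrow> real" where
  "dual_round_metric \<nu> \<mu> = snd \<nu> \<bullet> snd \<mu>"

text \<open>The form \<open>\<Sum>\<^sub>i p\<^sub>i dq\<^sub>i\<close>: the covector at the base point, applied to the image of the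
  tangent vector \<open>X\<close> under the differential of the bundle projection.\<close>

definition tautological_form :: "cot \<Rightarrow> cot \<Rightarrow> real" where
  "tautological_form \<nu> X = snd \<nu> \<bullet> fst X"

lemma ext_deriv_tautological_form:
  "ext_deriv tautological_form \<nu> X Y = snd X \<bullet> fst Y - snd Y \<bullet> fst X"
proof -
  have "frechet_derivative (\<lambda>y. tautological_form y Z) (at \<nu>) = (\<lambda>W. snd W \<bullet> fst Z)" for Z
    unfolding tautological_form_def
    by (intro frechet_derivative_at[symmetric] bounded_linear_imp_has_derivative
        bounded_linear_inner_left_comp bounded_linear_snd)
  then show ?thesis
    by (simp add: ext_deriv_def)
qed

definition positive_ray :: "real ^ 3 \<Rightarrow> real ^ 3 \<Rightarrow> cot set" where
  "positive_ray q p = {(q, t *\<^sub>R p) | t. t > 0}"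

definition fiberwise_star_shaped :: "cot set \<Rightarrow> bool" where
  "fiberwise_star_shaped M \<longleftrightarrow>
     M \<subseteq> cotangent_S2 \<and> smooth_submanifold 3 M \<and> compact M \<and>
     (\<forall>q\<in>S2. \<forall>p\<in>cotangent_fibre q - {0}.
        (\<exists>!\<nu>. \<nu> \<in> M \<inter> positive_ray q p) \<and>
        (\<forall>\<nu>\<in>M \<inter> positive_ray q p. transverse_at cotangent_S2 (positive_ray q p) M \<nu>))"

definition max_radius :: "cot set \<Rightarrow> real" where
  "max_radius M = (GREATEST r. r \<in> (\<lambda>\<nu>. sqrt (dual_round_metric \<nu> \<nu>)) ` M)"

lemma max_radius_is_max:
  assumes "fiberwise_star_shaped M"
  shows "\<exists>\<nu>\<in>M. max_radius M = sqrt (dual_round_metric \<nu> \<nu>)"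
    and "\<And>\<nu>. \<nu> \<in> M \<Longrightarrow> sqrt (dual_round_metric \<nu> \<nu>) \<le> max_radius M"
proof -
  let ?r = "\<lambda>\<nu>. sqrt (dual_round_metric \<nu> \<nu>)"
  have "axis 1 1 \<in> S2" "axis 2 1 \<in> cotangent_fibre (axis 1 1) - {0}"
    by (simp_all add: S2_def cotangent_fibre_def inner_axis_axis)
  then have ne: "M \<noteq> {}"
    using assms unfolding fiberwise_star_shaped_def by blast
  have "compact M" "continuous_on M ?r"
    using assms unfolding fiberwise_star_shaped_def dual_round_metric_def
    by (blast, intro continuous_intros)
  from continuous_attains_sup[OF this(1) ne this(2)]
  obtain \<nu> where \<nu>: "\<nu> \<in> M" "\<And>\<mu>. \<mu> \<in> M \<Longrightarrow> ?r \<mu> \<le> ?r \<nu>"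
    by (elim bexE) (rule that, assumption, erule bspec)
  then have "max_radius M = ?r \<nu>"
    unfolding max_radius_def by (intro Greatest_equality imageI) (assumption, erule imageE, simp)
  with \<nu> show "\<exists>\<nu>\<in>M. max_radius M = ?r \<nu>" "\<And>\<nu>. \<nu> \<in> M \<Longrightarrow> ?r \<nu> \<le> max_radius M"
    by (blast, simp)
qed

end

theory Submission
  imports Defs "HOL-Analysis.Cross3" "HOL-Complex_Analysis.Great_Picard" "HOL-Homology.Brouwer_Degree"
begin

text \<open>
  Off the zero section, \<open>T\<^sup>*S\<^sup>2\<close> is doubly covered by \<open>\<complex>\<^sup>2 - {0}\<close> (a Hopf map), and the tautological form
  pulls back to four times the standard Liouville form. The hypersurface becomes the level set \<open>F = 1\<close> of an
  even, 2-homogeneous function with \<open>R F(x) \<ge> |x|\<^sup>2\<close>, where \<open>R\<close> is the maximal radius. It therefore suffices to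
  find a loop \<open>z\<close> with \<open>z' = \<mu> i grad F(z)\<close>, \<open>z(t + \<pi>) = - z(t)\<close> and \<open>0 < \<mu> \<le> R/2\<close>: it projects to a closed Reeb
  orbit of period \<open>4 \<pi> \<mu> \<le> 2 \<pi> R\<close>. Antiperiodicity is essential, since among all loops in \<open>\<complex>\<^sup>2\<close> one would only
  get twice this bound.

  Such loops are critical points of the quotient of the symplectic action by \<open>\<integral> F(z)\<close>. On antiperiodic
  trigonometric polynomials, which have odd frequencies only, the action has no kernel, and
  the half-space spanned by the negative frequencies and one vector of frequency 1 links the sublevel set of
  level 0; on that half-space the quotient is at most \<open>R/2\<close>. So there is a critical value in \<open>(0, R/2]\<close>, or else
  a sphere would be contractible. The critical points are bounded in \<open>H\<^sup>1\<close>, and a uniform limit of them solves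
  the equation.
\<close>

text \<open>The action is unbounded in both directions on all of loop space, and the unit sphere of
  an infinite-dimensional negative space is contractible; finitely many modes restore the
  topological obstruction, provided that all bounds are uniform in the truncation. The bound R/2 is
  uniform because only the lowest positive frequency, 1, enters it. Antiperiodic loops are the lifts
  of the non-contractible loops of the hypersurface, which is a real projective 3-space. After
  projection they close up after time pi instead of 2 pi, which gains the factor 2. The constant is
  attained: for the round unit cotangent bundle F x = |x|^2, and e^(i t) z0 solves the equation with
  \<mu> = 1/2 = R/2. F is in general no better than C^1 at the origin. The deformation therefore
  uses no gradient flow but finitely many explicit steps, each renormalised to the sphere, and asks
  only for a uniform first-order expansion. That the minimal action exists is a separate compactness
  argument on the hypersurface, which needs one closed orbit to start from.\<close>

section \<open>A finite-dimensional linking argument\<close>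

text \<open>\<open>R\<^sup>N\<close> is the space of sequences supported below \<open>N\<close>, because the dimension has to vary in the
  Galerkin argument and cannot be a type.\<close>

definition coord_space :: "nat \<Rightarrow> (nat \<Rightarrow> real) set" where
  "coord_space N = {a. \<forall>i\<ge>N. a i = 0}"

abbreviation sqsum :: "nat \<Rightarrow> (nat \<Rightarrow> real) \<Rightarrow> real" where "sqsum N a \<equiv> \<Sum>i<N. (a i)\<^sup>2"

definition coord_sphere :: "nat \<Rightarrow> (nat \<Rightarrow> real) set" where
  "coord_sphere N = {a \<in> coord_space N. (sqsum N a) = 1}"

definition coord_normalize :: "nat \<Rightarrow> (nat \<Rightarrow> real) \<Rightarrow> nat \<Rightarrow> real" where
  "coord_normalize N a = (\<lambda>i. if i < N then a i / sqrt (sqsum N a) else 0)"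

text \<open>Ties the sequence model to the sphere of homology theory, whose non-contractibility ends
  the linking argument.\<close>

lemma nsphere_eq_coord_sphere: "nsphere k = top_of_set (coord_sphere (Suc k))"
proof -
  have "{x. (\<Sum>i\<le>k. (x i)\<^sup>2) = 1 \<and> (\<forall>i>k. x i = 0)} = coord_sphere (Suc k)"
    by (auto simp: coord_sphere_def coord_space_def lessThan_Suc_atMost Suc_le_eq)
  then show ?thesis by (simp add: nsphere euclidean_product_topology)
qed

text \<open>Sequences carry the product topology, so this is Tychonoff's theorem for a box whose
  factors beyond \<open>N\<close> are trivial.\<close>

lemma compact_coord_sphere: "compact (coord_sphere N)"
proof -
  let ?B = "PiE UNIV (\<lambda>i. if i < N then {-1..1} else {0::real})"
  have "compactin (product_topology (\<lambda>i::nat. euclidean) UNIV) ?B"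
    by (subst compactin_PiE) (auto simp: compactin_euclidean_iff)
  then have B: "compact ?B" by (simp add: euclidean_product_topology)
  have C: "closed {a::nat\<Rightarrow>real. (sqsum N a) = 1}"
    by (intro closed_Collect_eq continuous_intros continuous_on_product_coordinates)
  have "coord_sphere N = ?B \<inter> {a. (sqsum N a) = 1}"
  proof (intro equalityI subsetI IntI)
    fix a assume a: "a \<in> coord_sphere N"
    have "\<bar>a i\<bar> \<le> 1" if "i < N" for i
    proof -
      have "(a i)\<^sup>2 \<le> (sqsum N a)" using that by (intro member_le_sum) auto
      then show ?thesis using a by (simp add: coord_sphere_def abs_square_le_1)
    qed
    then show "a \<in> ?B" using a
      by (auto simp: coord_sphere_def coord_space_def abs_le_iff split: if_splits)
  next
    fix a assume "a \<in> ?B \<inter> {a. (sqsum N a) = 1}"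
    moreover then have "a i = 0" if "i \<ge> N" for i using that by (auto simp: PiE_def Pi_def dest: spec[of _ i])
    ultimately show "a \<in> coord_sphere N" by (auto simp: coord_sphere_def coord_space_def)
  qed (auto simp: coord_sphere_def)
  then show ?thesis using B C by (simp add: compact_Int_closed)
qed

lemma continuous_on_coord_normalize:
  assumes "continuous_on S f" "\<And>x. x \<in> S \<Longrightarrow> (\<Sum>i<N. (f x i)\<^sup>2) \<noteq> 0"
  shows "continuous_on S (\<lambda>x. coord_normalize N (f x))"
proof (intro continuous_on_coordinatewise_then_product)
  have c: "continuous_on S (\<lambda>x. f x i)" for i
    using continuous_on_compose2[OF continuous_on_product_coordinates assms(1)] by blast
  fix i show "continuous_on S (\<lambda>x. coord_normalize N (f x) i)"
    unfolding coord_normalize_def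
    by (cases "i < N") (auto intro!: continuous_intros c dest: assms(2))
qed

lemma coord_normalize_in_sphere:
  assumes "(sqsum N a) \<noteq> 0"
  shows "coord_normalize N a \<in> coord_sphere N"
proof -
  have "(sqsum N a) \<ge> 0" by (intro sum_nonneg) auto
  then have "(\<Sum>i<N. (a i / sqrt (sqsum N a))\<^sup>2) = 1"
    using assms by (simp add: power_divide flip: sum_divide_distrib)
  then show ?thesis by (simp add: coord_sphere_def coord_space_def coord_normalize_def)
qed

lemma coord_normalize_sphere: "a \<in> coord_sphere N \<Longrightarrow> coord_normalize N a = a"
  by (auto simp: coord_sphere_def coord_space_def coord_normalize_def fun_eq_iff)

text \<open>In the application \<open>lam\<close> lists the frequencies, \<open>b\<close> is the
  integral of F along the loop with coefficients \<open>a\<close>, and \<open>db\<close> is its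
  gradient. The indices up to \<open>k\<close> span the negative space, and \<open>Suc k\<close> is
  the extra direction of the half-space. The expansion \<open>b_diff\<close> is uniform over the
  sphere and stands in for a Lipschitz condition on the gradient.\<close>

locale linking =
  fixes N k :: nat and lam :: "nat \<Rightarrow> real" and b :: "(nat \<Rightarrow> real) \<Rightarrow> real"
    and db :: "(nat \<Rightarrow> real) \<Rightarrow> nat \<Rightarrow> real" and \<kappa> :: real
  assumes kN: "Suc k < N"
    and lam_neg: "\<And>i. i \<le> k \<Longrightarrow> lam i < 0"
    and lam_pos: "\<And>i. k < i \<Longrightarrow> i < N \<Longrightarrow> lam i > 0"
    and b_cont: "continuous_on UNIV b"
    and db_cont: "\<And>i. continuous_on UNIV (\<lambda>a. db a i)"
    and b_hom: "\<And>s a. s > 0 \<Longrightarrow> b (\<lambda>i. s * a i) = s\<^sup>2 * b a"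
    and \<kappa>: "\<kappa> > 0"
    and b_lower: "\<And>a. a \<in> coord_space N \<Longrightarrow> \<kappa> * (sqsum N a) \<le> b a"
    and b_diff: "\<And>e. e > 0 \<Longrightarrow> \<exists>d>0. \<forall>a\<in>coord_sphere N. \<forall>h\<in>coord_space N.
        (sqsum N h) \<le> d\<^sup>2 \<longrightarrow>
        \<bar>b (\<lambda>i. a i + h i) - b a - (\<Sum>i<N. db a i * h i)\<bar> \<le> e * sqrt (sqsum N h)"
begin

text \<open>In the application this is the symplectic action of the loop, divided by 2 pi.\<close>

definition A :: "(nat \<Rightarrow> real) \<Rightarrow> real" where "A a = (\<Sum>i<N. lam i * (a i)\<^sup>2) / 2"

definition sub :: "real \<Rightarrow> (nat \<Rightarrow> real) set" where
  "sub c = {a \<in> coord_sphere N. A a \<le> c * b a}"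

definition V :: "(nat \<Rightarrow> real) \<Rightarrow> nat \<Rightarrow> real" where
  "V a = (\<lambda>i. if i < N then lam i * a i - A a / b a * db a i else 0)"

definition v2 :: "(nat \<Rightarrow> real) \<Rightarrow> real" where "v2 a = (\<Sum>i<N. (V a i)\<^sup>2)"

definition step :: "real \<Rightarrow> (nat \<Rightarrow> real) \<Rightarrow> nat \<Rightarrow> real" where
  "step s a = coord_normalize N (\<lambda>i. a i - s * V a i)"

lemma b_sphere: "a \<in> coord_sphere N \<Longrightarrow> \<kappa> \<le> b a"
  using b_lower[of a] by (auto simp: coord_sphere_def)

lemma A_hom: "A (\<lambda>i. s * a i) = s\<^sup>2 * A a"
  by (simp add: A_def power_mult_distrib sum_distrib_left sum_divide_distrib mult_ac)

lemma A_cont: "continuous_on S A"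
  unfolding A_def
  by (intro continuous_intros continuous_on_subset[OF continuous_on_product_coordinates]) auto

lemma cont_coord: "continuous_on S (\<lambda>a::nat\<Rightarrow>real. a i)"
  by (rule continuous_on_subset[OF continuous_on_product_coordinates]) auto

lemma continuous_on_coordinate: "continuous_on S f \<Longrightarrow> continuous_on S (\<lambda>x. f x i :: real)" for f :: "'b::topological_space \<Rightarrow> nat \<Rightarrow> real"
  by (rule continuous_on_compose2[OF continuous_on_product_coordinates[where i = i]]) auto

lemma continuous_on_snd_coordinate: "continuous_on S (\<lambda>z. snd z i :: real)" for S :: "('b::topological_space \<times> (nat \<Rightarrow> real)) set"
  by (rule continuous_on_coordinate) (intro continuous_on_snd continuous_on_id)

lemma V_cont: "continuous_on (coord_sphere N) (\<lambda>a. V a i)"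
proof -
  have "b a \<noteq> 0" if "a \<in> coord_sphere N" for a using b_sphere[OF that] \<kappa> by auto
  then show ?thesis
    unfolding V_def using kN
    by (cases "i < N") (auto intro!: continuous_intros A_cont cont_coord
        continuous_on_subset[OF b_cont] continuous_on_subset[OF db_cont])
qed

lemma v2_cont: "continuous_on (coord_sphere N) v2"
  unfolding v2_def by (intro continuous_intros V_cont)

text \<open>\<open>A\<close> and \<open>b\<close> are both 2-homogeneous, so their quotient does not
  change under scaling. This allows a step to leave the sphere and to be normalised
  afterwards.\<close>

lemma normalize_sublevel:
  assumes "(sqsum N a) \<noteq> 0" "a \<in> coord_space N" "A a \<le> c * b a"
  shows "coord_normalize N a \<in> sub c"
proof -
  let ?r = "sqrt (sqsum N a)"
  have "(sqsum N a) \<ge> 0" by (intro sum_nonneg) auto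
  then have r: "?r > 0" using assms(1) by simp
  have eq: "coord_normalize N a = (\<lambda>i. (1 / ?r) * a i)"
    using assms(2) by (auto simp: coord_normalize_def coord_space_def fun_eq_iff)
  have "A (coord_normalize N a) = (1/?r)\<^sup>2 * A a" unfolding eq by (rule A_hom)
  moreover have "b (coord_normalize N a) = (1/?r)\<^sup>2 * b a" unfolding eq by (rule b_hom) (use r in auto)
  ultimately show ?thesis
    using assms(3) coord_normalize_in_sphere[OF assms(1)] mult_left_mono[OF assms(3), of "(1/?r)\<^sup>2"]
    by (simp add: sub_def mult_ac)
qed

lemma A_diff:
  assumes "e > 0"
  shows "\<exists>d>0. \<forall>a\<in>coord_sphere N. \<forall>h\<in>coord_space N. (sqsum N h) \<le> d\<^sup>2 \<longrightarrow>
        \<bar>A (\<lambda>i. a i + h i) - A a - (\<Sum>i<N. lam i * a i * h i)\<bar> \<le> e * sqrt (sqsum N h)"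
proof -
  define L where "L = (\<Sum>i<N. \<bar>lam i\<bar>) + 1"
  have L: "L > 0" unfolding L_def by (intro add_nonneg_pos sum_nonneg) auto
  show ?thesis
  proof (intro exI[of _ "e / L"] conjI ballI impI)
    show "e / L > 0" using L assms by simp
    fix a h assume h: "(sqsum N h) \<le> (e / L)\<^sup>2"
    let ?q = "\<Sum>i<N. (h i)\<^sup>2"
    have q0: "?q \<ge> 0" by (intro sum_nonneg) auto
    have "A (\<lambda>i. a i + h i) - A a - (\<Sum>i<N. lam i * a i * h i) = (\<Sum>i<N. lam i * (h i)\<^sup>2) / 2"
      unfolding A_def
      by (simp add: field_simps power2_sum sum.distrib sum_distrib_left flip: sum_divide_distrib)
    also have "\<bar>\<dots>\<bar> \<le> (\<Sum>i<N. \<bar>lam i\<bar> * (h i)\<^sup>2)"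
      using sum_abs[of "\<lambda>i. lam i * (h i)\<^sup>2" "{..<N}"] by (simp add: abs_mult)
    also have "\<dots> \<le> (\<Sum>i<N. L * (h i)\<^sup>2)"
    proof (intro sum_mono mult_right_mono)
      fix i assume "i \<in> {..<N}"
      then show "\<bar>lam i\<bar> \<le> L" unfolding L_def
        using member_le_sum[of i "{..<N}" "\<lambda>i. \<bar>lam i\<bar>"] by auto
    qed auto
    also have "\<dots> = L * sqrt ?q * sqrt ?q" using q0 by (simp add: sum_distrib_left[symmetric] mult.assoc)
    also have "\<dots> \<le> L * (e / L) * sqrt ?q"
      using h L q0 assms real_sqrt_le_mono[OF h] by (intro mult_right_mono mult_left_mono) auto
    finally show "\<bar>A (\<lambda>i. a i + h i) - A a - (\<Sum>i<N. lam i * a i * h i)\<bar> \<le> e * sqrt ?q"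
      using L by simp
  qed
qed

lemma g_bounded: "\<exists>G>0. \<forall>a\<in>coord_sphere N. \<bar>A a / b a\<bar> \<le> G"
proof -
  have "b a \<noteq> 0" if "a \<in> coord_sphere N" for a using b_sphere[OF that] \<kappa> by auto
  then have "compact ((\<lambda>a. A a / b a) ` coord_sphere N)"
    by (intro compact_continuous_image compact_coord_sphere continuous_intros A_cont
        continuous_on_subset[OF b_cont]) auto
  from compact_imp_bounded[OF this] show ?thesis unfolding bounded_pos by auto
qed

text \<open>With the quotient g = A a / b a frozen at \<open>a\<close>, the function A - g b
  vanishes at \<open>a\<close>, and it is at most 0 exactly where the quotient is at most g.
  Expanding it avoids differentiating the quotient; the uniform bound on g controls the error coming
  from \<open>b\<close>.\<close>

lemma f_diff:
  assumes "e > 0"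
  shows "\<exists>d>0. \<forall>a\<in>coord_sphere N. \<forall>h\<in>coord_space N. (sqsum N h) \<le> d\<^sup>2 \<longrightarrow>
     A (\<lambda>i. a i + h i) - A a / b a * b (\<lambda>i. a i + h i) \<le>
       (\<Sum>i<N. V a i * h i) + e * sqrt (sqsum N h)"
proof -
  obtain G where G: "G > 0" "\<And>a. a \<in> coord_sphere N \<Longrightarrow> \<bar>A a / b a\<bar> \<le> G"
    using g_bounded by auto
  obtain d1 where d1: "d1 > 0" "\<And>a h. a\<in>coord_sphere N \<Longrightarrow> h\<in>coord_space N \<Longrightarrow> (sqsum N h) \<le> d1\<^sup>2 \<Longrightarrow>
        \<bar>A (\<lambda>i. a i + h i) - A a - (\<Sum>i<N. lam i * a i * h i)\<bar> \<le> e/2 * sqrt (sqsum N h)"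
    using A_diff[OF half_gt_zero[OF assms]] by blast
  obtain d2 where d2: "d2 > 0" "\<And>a h. a\<in>coord_sphere N \<Longrightarrow> h\<in>coord_space N \<Longrightarrow> (sqsum N h) \<le> d2\<^sup>2 \<Longrightarrow>
        \<bar>b (\<lambda>i. a i + h i) - b a - (\<Sum>i<N. db a i * h i)\<bar> \<le> e/(2*G) * sqrt (sqsum N h)"
    using b_diff[of "e/(2*G)"] divide_pos_pos[OF assms, of "2*G"] G(1) by auto
  show ?thesis
  proof (intro exI[of _ "min d1 d2"] conjI ballI impI)
    show "min d1 d2 > 0" using d1 d2 by simp
    fix a h assume a: "a\<in>coord_sphere N" and h: "h\<in>coord_space N"
      and hd: "(sqsum N h) \<le> (min d1 d2)\<^sup>2"
    have "(min d1 d2)\<^sup>2 \<le> d1\<^sup>2" "(min d1 d2)\<^sup>2 \<le> d2\<^sup>2" using d1 d2 by (auto intro!: power_mono)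
    then have hd1: "(sqsum N h) \<le> d1\<^sup>2" and hd2: "(sqsum N h) \<le> d2\<^sup>2" using hd by auto
    define g where "g = A a / b a"
    define rA where "rA = A (\<lambda>i. a i + h i) - A a - (\<Sum>i<N. lam i * a i * h i)"
    define rb where "rb = b (\<lambda>i. a i + h i) - b a - (\<Sum>i<N. db a i * h i)"
    let ?q = "sqrt (sqsum N h)"
    have q: "?q \<ge> 0" by (simp add: sum_nonneg)
    have "b a \<noteq> 0" using b_sphere[OF a] \<kappa> by auto
    then have gA: "A a = g * b a" by (simp add: g_def)
    have 1: "\<bar>rA\<bar> \<le> e/2 * ?q" unfolding rA_def by (rule d1(2)[OF a h hd1])
    have "\<bar>g * rb\<bar> \<le> G * (e/(2*G) * ?q)" unfolding abs_mult
      using G(1) G(2)[OF a] d2(2)[OF a h hd2] by (intro mult_mono) (auto simp: g_def rb_def)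
    then have 2: "\<bar>g * rb\<bar> \<le> e/2 * ?q" using G by simp
    have "(\<Sum>i<N. V a i * h i) = (\<Sum>i<N. lam i * a i * h i) - g * (\<Sum>i<N. db a i * h i)"
      unfolding V_def g_def[symmetric]
      by (simp add: sum_distrib_left algebra_simps flip: sum_subtractf)
    then have "A (\<lambda>i. a i + h i) - g * b (\<lambda>i. a i + h i) = (\<Sum>i<N. V a i * h i) + rA - g * rb"
      using gA by (simp add: rA_def rb_def algebra_simps)
    then show "A (\<lambda>i. a i + h i) - A a / b a * b (\<lambda>i. a i + h i) \<le> (\<Sum>i<N. V a i * h i) + e * ?q"
      using 1 2 by (simp add: g_def[symmetric])
  qed
qed

text \<open>Up to a positive factor, \<open>V\<close> is the gradient of the quotient \<open>A / b\<close>, whose critical points with value in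
  \<open>[0, c0]\<close> are excluded here.\<close>

lemma v2_alternative:
  assumes "\<And>a. a \<in> coord_sphere N \<Longrightarrow> 0 \<le> A a \<Longrightarrow> A a \<le> c0 * b a \<Longrightarrow> v2 a \<noteq> 0"
  shows "\<exists>m0>0. \<forall>a\<in>sub c0. v2 a \<ge> m0 \<or> A a \<le> - m0 * b a"
proof -
  have v2: "v2 a \<ge> 0" for a unfolding v2_def by (intro sum_nonneg) auto
  have bpos: "b a > 0" if "a \<in> sub c0" for a using b_sphere[of a] \<kappa> that by (auto simp: sub_def)
  have sub_sphere: "sub c0 \<subseteq> coord_sphere N" by (auto simp: sub_def)
  have "sub c0 = coord_sphere N \<inter> {a. A a \<le> c0 * b a}" by (auto simp: sub_def)
  then have comp: "compact (sub c0)"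
    using compact_Int_closed[OF compact_coord_sphere, of "{a. A a \<le> c0 * b a}" N]
    by (simp add: closed_Collect_le continuous_on_mult_const A_cont b_cont continuous_on_mult_left)
  \<comment> \<open>One continuous function covers both alternatives. It is positive on the compact
    set \<open>sub c0\<close>, and its minimum serves as \<open>m0\<close>.\<close>
  let ?u = "\<lambda>a. max (v2 a) (- (A a / b a))"
  have pos: "?u a > 0" if a: "a \<in> sub c0" for a
  proof (cases "A a < 0")
    case True
    then show ?thesis using bpos[OF a] by (simp add: less_max_iff_disj divide_neg_pos)
  next
    case False
    then have "v2 a \<noteq> 0" using a assms by (auto simp: sub_def)
    then show ?thesis using v2[of a] by (simp add: less_max_iff_disj)
  qed
  show ?thesis
  proof (cases "sub c0 = {}")
    case True then show ?thesis by (intro exI[of _ 1]) auto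
  next
    case False
    have "continuous_on (sub c0) ?u"
      using bpos by (intro continuous_intros continuous_on_subset[OF v2_cont sub_sphere] A_cont
          continuous_on_subset[OF b_cont]) force+
    from continuous_attains_inf[OF comp False this]
    obtain z where z: "z \<in> sub c0" "\<And>a. a \<in> sub c0 \<Longrightarrow> ?u z \<le> ?u a" by blast
    show ?thesis
    proof (intro exI[of _ "?u z"] conjI ballI)
      show "?u z > 0" by (rule pos[OF z(1)])
      fix a assume a: "a \<in> sub c0"
      have "?u z \<le> v2 a \<or> ?u z \<le> - (A a / b a)" using z(2)[OF a] by (simp add: le_max_iff_disj)
      then show "v2 a \<ge> ?u z \<or> A a \<le> - ?u z * b a"
      proof
        assume "?u z \<le> - (A a / b a)"
        then have "A a / b a \<le> - ?u z" by linarith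
        then show ?thesis using bpos[OF a] by (simp only: pos_divide_le_eq simp_thms)
      qed simp
    qed
  qed
qed

text \<open>Where \<open>v2\<close> is large, moving along \<open>- V\<close> lowers the quotient at
  a definite rate; elsewhere the quotient is already at most - m0, and a short step cannot lift it
  above 0. Compactness makes step size and gain uniform over \<open>sub c0\<close>. The first clause
  treats all shorter steps as well because they form the homotopy from the identity to the full
  step.\<close>

lemma descent:
  assumes "\<And>a. a \<in> coord_sphere N \<Longrightarrow> 0 \<le> A a \<Longrightarrow> A a \<le> c0 * b a \<Longrightarrow> v2 a \<noteq> 0"
  shows "\<exists>\<epsilon>>0. \<exists>\<delta>>0. (\<forall>s\<in>{0..\<epsilon>}. \<forall>a\<in>sub c0. (\<Sum>i<N. (a i - s * V a i)\<^sup>2) \<noteq> 0 \<and>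
           (A a \<le> 0 \<longrightarrow> step s a \<in> sub 0)) \<and>
       (\<forall>c. \<forall>a\<in>sub c0. A a \<le> c * b a \<longrightarrow> step \<epsilon> a \<in> sub (max 0 (c - \<delta>)))"
proof -
  obtain m0 where m0: "m0 > 0" "\<And>a. a \<in> sub c0 \<Longrightarrow> v2 a \<ge> m0 \<or> A a \<le> - m0 * b a"
    using v2_alternative[OF assms] by blast
  have v2n: "v2 a \<ge> 0" for a unfolding v2_def by (intro sum_nonneg) auto
  \<comment> \<open>With the error rate \<open>sqrt m0 / 2\<close> the remainder is at most half of
    the gain \<open>s * v2 a\<close> as soon as \<open>v2 a\<close> is at least
    \<open>m0\<close>.\<close>
  obtain d where d: "d > 0" "\<And>a h. a\<in>coord_sphere N \<Longrightarrow> h\<in>coord_space N \<Longrightarrow> (sqsum N h) \<le> d\<^sup>2 \<Longrightarrow>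
     A (\<lambda>i. a i + h i) - A a / b a * b (\<lambda>i. a i + h i) \<le>
       (\<Sum>i<N. V a i * h i) + sqrt m0 / 2 * sqrt (sqsum N h)"
    using f_diff[of "sqrt m0 / 2"] m0(1) by auto
  have "bounded (v2 ` coord_sphere N)"
    by (intro compact_imp_bounded compact_continuous_image v2_cont compact_coord_sphere)
  then obtain M where M: "M > 0" "\<And>a. a \<in> coord_sphere N \<Longrightarrow> v2 a \<le> M"
    unfolding bounded_pos by force
  have "bounded (b ` coord_sphere N)"
    by (intro compact_imp_bounded compact_continuous_image continuous_on_subset[OF b_cont] compact_coord_sphere) auto
  then obtain B where B: "B > 0" "\<And>a. a \<in> coord_sphere N \<Longrightarrow> b a \<le> B"
    unfolding bounded_pos by force
  \<comment> \<open>The first bound keeps the displacement below \<open>d\<close> and below 1/2, so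
    that the expansion applies and the norm before renormalising lies between 1/2 and 3/2. The bound
    \<open>\<kappa> / 2\<close> makes s / 2 at most \<open>b a'\<close>, which is needed where the
    quotient is below - m0.\<close>
  define \<epsilon> where "\<epsilon> = min (min d (1/2) / sqrt M) (\<kappa> / 2)"
  \<comment> \<open>A step gains \<open>\<epsilon> * m0 / 2\<close> in \<open>A\<close>; as
    \<open>b\<close> is at most 8 B at the new point, the level drops by at least this
    quotient.\<close>
  define \<delta> where "\<delta> = \<epsilon> * m0 / (16 * B)"
  have \<epsilon>: "\<epsilon> > 0" using d M \<kappa> by (simp add: \<epsilon>_def)
  have \<delta>: "\<delta> > 0" using \<epsilon> m0 B by (simp add: \<delta>_def)
  {
    fix s a assume s: "0 \<le> s" "s \<le> \<epsilon>" and a: "a \<in> sub c0"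
    define h where "h = (\<lambda>i. - s * V a i)"
    define a' where "a' = (\<lambda>i. a i + h i)"
    have aS: "a \<in> coord_sphere N" using a by (simp add: sub_def)
    have hX: "h \<in> coord_space N" by (simp add: h_def coord_space_def V_def)
    have a'X: "a' \<in> coord_space N" using hX aS by (simp add: a'_def coord_space_def coord_sphere_def)
    have hq: "(sqsum N h) = s\<^sup>2 * v2 a"
      by (simp add: h_def v2_def power_mult_distrib sum_distrib_left)
    have sq: "s * sqrt (v2 a) \<le> min d (1/2)"
    proof -
      have "s * sqrt (v2 a) \<le> (min d (1/2) / sqrt M) * sqrt M"
        using s v2n M(2)[OF aS] M(1) d(1) by (intro mult_mono) (auto simp: \<epsilon>_def)
      then show ?thesis using M(1) by simp
    qed
    have hle: "s\<^sup>2 * v2 a \<le> (min d (1/2))\<^sup>2"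
      using power_mono[OF sq, of 2] s v2n[of a] by (simp add: power_mult_distrib)
    have "(min d (1/2))\<^sup>2 \<le> d\<^sup>2" using d by (intro power_mono) auto
    then have f: "A a' - A a / b a * b a' \<le> (\<Sum>i<N. V a i * h i) + sqrt m0 / 2 * sqrt (sqsum N h)"
      unfolding a'_def using hle hq by (intro d(2)[OF aS hX]) auto
    have Vh: "(\<Sum>i<N. V a i * h i) = - s * v2 a"
      by (simp add: h_def v2_def sum_distrib_left power2_eq_square mult_ac sum_negf)
    have sqh: "sqrt (sqsum N h) = s * sqrt (v2 a)"
      unfolding hq using s by (simp add: real_sqrt_mult)
    have f': "A a' \<le> A a / b a * b a' - s * v2 a + sqrt m0 / 2 * (s * sqrt (v2 a))"
      using f unfolding Vh sqh by linarith
    have norm_a': "sqrt (sqsum N a') \<ge> 1/2" "sqrt (sqsum N a') \<le> 3/2"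
    proof -
      have L1: "L2_set a {..<N} = 1" using aS by (simp add: L2_set_def coord_sphere_def)
      have L2: "L2_set h {..<N} \<le> 1/2" using sqh sq by (simp add: L2_set_def)
      have "L2_set (\<lambda>i. - h i) {..<N} = L2_set h {..<N}" by (simp add: L2_set_def)
      moreover have "L2_set a {..<N} \<le> L2_set a' {..<N} + L2_set (\<lambda>i. - h i) {..<N}"
        using L2_set_triangle_ineq[of a' "\<lambda>i. - h i" "{..<N}"] by (simp add: a'_def)
      moreover have "L2_set a' {..<N} \<le> L2_set a {..<N} + L2_set h {..<N}"
        using L2_set_triangle_ineq[of a h "{..<N}"] by (simp add: a'_def)
      ultimately show "sqrt (sqsum N a') \<ge> 1/2" "sqrt (sqsum N a') \<le> 3/2"
        using L1 L2 by (simp_all add: L2_set_def)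
    qed
    have n0: "(sqsum N a') \<noteq> 0" using norm_a'(1) by auto
    have qn: "(sqsum N a') \<ge> 0" by (intro sum_nonneg) auto
    have q4: "(sqsum N a') \<ge> 1/4"
      using power_mono[OF norm_a'(1), of 2] qn by (simp add: power2_eq_square)
    have q4': "(sqsum N a') \<le> 4"
      using power_mono[OF norm_a'(2), of 2] norm_a'(1) qn by (simp add: power2_eq_square)
    have bl: "b a' \<ge> \<kappa> / 4" using b_lower[OF a'X] mult_left_mono[OF q4, of \<kappa>] \<kappa> by linarith
    have bu: "b a' \<le> 8 * B"
    proof -
      let ?r = "sqrt (sqsum N a')"
      have r: "?r > 0" using norm_a'(1) by linarith
      have "a' = (\<lambda>i. ?r * coord_normalize N a' i)"
        using r a'X by (auto simp: coord_normalize_def coord_space_def)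
      then have "b a' = ?r\<^sup>2 * b (coord_normalize N a')" using b_hom[OF r, of "coord_normalize N a'"] by simp
      also have "\<dots> \<le> 4 * B" using q4' qn B coord_normalize_in_sphere[OF n0] b_sphere[of "coord_normalize N a'"] \<kappa>
        by (intro mult_mono) (auto simp del: coord_normalize_in_sphere)
      finally show ?thesis using B by simp
    qed
    have sm: "s * m0 / 2 \<le> m0 * b a'"
    proof -
      have "s / 2 \<le> b a'" using bl s by (auto simp: \<epsilon>_def)
      then show ?thesis using m0(1) mult_left_mono[of "s/2" "b a'" m0] by (simp add: mult_ac)
    qed
    have ba: "b a > 0" using b_sphere[OF aS] \<kappa> by simp
    have eqa': "a' = (\<lambda>i. a i - s * V a i)" by (simp add: a'_def h_def)
    have key: "A a' \<le> max 0 (A a / b a * b a' - s * m0 / 2)"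
    proof (cases "v2 a \<ge> m0")
      case True
      have "sqrt m0 * sqrt (v2 a) \<le> v2 a"
        using True v2n[of a] mult_right_mono[of "sqrt m0" "sqrt (v2 a)" "sqrt (v2 a)"] by simp
      then have "sqrt m0 / 2 * (s * sqrt (v2 a)) \<le> s * (v2 a / 2)"
        using s mult_left_mono[of "sqrt m0 * sqrt (v2 a)" "v2 a" "s/2"] by (simp add: mult_ac)
      moreover have "s * m0 \<le> s * v2 a" using True s by (intro mult_left_mono) auto
      ultimately show ?thesis using f' by (simp add: le_max_iff_disj)
    next
      case False
      then have "A a / b a \<le> - m0" using m0(2)[OF a] ba by (simp add: pos_divide_le_eq)
      then have 1: "A a / b a * b a' \<le> - m0 * b a'" using bl \<kappa> by (intro mult_right_mono) auto
      have "sqrt m0 * sqrt (v2 a) \<le> m0"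
        using False v2n[of a] m0(1) mult_left_mono[of "sqrt (v2 a)" "sqrt m0" "sqrt m0"] by simp
      then have 2: "sqrt m0 / 2 * (s * sqrt (v2 a)) \<le> s * m0 / 2"
        using s mult_left_mono[of "sqrt m0 * sqrt (v2 a)" "m0" "s/2"] by (simp add: mult_ac)
      have 3: "s * v2 a \<ge> 0" using s v2n by simp
      have "A a' \<le> 0" using f' 1 2 3 sm by linarith
      then show ?thesis by simp
    qed
    have z: "step s a \<in> sub 0" if "A a \<le> 0"
    proof -
      have "A a / b a * b a' \<le> 0" using that ba bl \<kappa> by (simp add: divide_nonpos_pos mult_nonpos_nonneg)
      moreover have "s * m0 \<ge> 0" using s m0 by simp
      ultimately have "A a' \<le> 0 * b a'" using key by simp
      then show ?thesis unfolding step_def eqa'[symmetric] by (rule normalize_sublevel[OF n0 a'X])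
    qed
    have dd: "step s a \<in> sub (max 0 (c - \<delta>))" if "A a \<le> c * b a" and "s = \<epsilon>" for c
    proof -
      have "A a / b a \<le> c" using that ba by (simp add: pos_divide_le_eq)
      then have 1: "A a / b a * b a' \<le> c * b a'" using bl \<kappa> by (intro mult_right_mono) auto
      have "\<delta> * b a' \<le> \<delta> * (8 * B)" using bu \<delta> by (intro mult_left_mono) auto
      also have "\<dots> = \<epsilon> * m0 / 2" using B by (simp add: \<delta>_def)
      finally have 2: "\<delta> * b a' \<le> s * m0 / 2" using that by simp
      have "A a / b a * b a' - s * m0 / 2 \<le> (c - \<delta>) * b a'"
        using 1 2 by (simp add: left_diff_distrib)
      then have "A a' \<le> max 0 ((c - \<delta>) * b a')" by (rule order_trans[OF key max.mono[OF order_refl]])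
      also have "\<dots> \<le> max 0 (c - \<delta>) * b a'" using bl \<kappa> by (auto simp: max_def mult_right_mono mult_nonpos_nonneg)
      finally have "step s a \<in> sub (max 0 (c - \<delta>))"
        unfolding step_def eqa'[symmetric] by (rule normalize_sublevel[OF n0 a'X])
      then show ?thesis .
    qed
    note n0[unfolded eqa'] z dd
  } note main = this
  show ?thesis using \<epsilon> \<delta> main by (intro exI[of _ \<epsilon>] exI[of _ \<delta>] conjI) auto
qed

lemma homotopic_with_canonI:
  fixes h :: "real \<times> 'b::topological_space \<Rightarrow> 'c::topological_space"
  assumes "continuous_on ({0..1} \<times> S) h" "\<And>t x. 0 \<le> t \<Longrightarrow> t \<le> 1 \<Longrightarrow> x \<in> S \<Longrightarrow> h (t, x) \<in> T"
    "\<And>x. x \<in> S \<Longrightarrow> h (0, x) = f x" "\<And>x. x \<in> S \<Longrightarrow> h (1, x) = g x"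
  shows "homotopic_with_canon (\<lambda>_. True) S T f g"
proof (subst homotopic_with)
  show "\<exists>h. continuous_map (prod_topology (top_of_set {0..1::real}) (top_of_set S)) (top_of_set T) h \<and>
        (\<forall>x\<in>topspace (top_of_set S). h (0, x) = f x) \<and> (\<forall>x\<in>topspace (top_of_set S). h (1, x) = g x) \<and>
        (\<forall>t\<in>{0..1::real}. True)"
    using assms by (intro exI[of _ h]) (auto simp flip: subtopology_Times)
qed simp

text \<open>If there were none, the unit sphere S of the negative space would be contractible:
  coning it off over the direction \<open>Suc k\<close> contracts it inside \<open>sub c0\<close>,
  repeated steps push this contraction into \<open>sub 0\<close>, and normalising the negative
  coordinates retracts \<open>sub 0\<close> onto S.\<close>

theorem critical_point:
  "\<exists>a\<in>coord_sphere N. \<exists>\<mu>. 0 < \<mu> \<and> \<mu> \<le> lam (Suc k) / (2 * \<kappa>) \<and> (\<forall>i<N. lam i * a i = \<mu> * db a i)"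
proof (rule ccontr)
  assume no: "\<not> ?thesis"
  \<comment> \<open>On (1 - t) x + t e, with x in the negative sphere and e the unit vector of index
    \<open>Suc k\<close>, \<open>A\<close> is at most \<open>lam (Suc k)\<close> t^2 / 2 and
    \<open>b\<close> is at least \<kappa> t^2; this is the ratio of the two bounds.\<close>
  define c0 where "c0 = lam (Suc k) / (2 * \<kappa>)"
  have c0: "c0 > 0" using lam_pos[of "Suc k"] kN \<kappa> by (simp add: c0_def)
  have bpos: "b a > 0" if "a \<in> coord_sphere N" for a using b_sphere[of a] \<kappa> that by auto
  \<comment> \<open>A zero of \<open>V\<close> solves the equation with \<mu> = A a / b a. The value
    0 would force a = 0 since no \<open>lam i\<close> vanishes, and values in (0, c0] are excluded
    by \<open>no\<close>.\<close>
  have "v2 a \<noteq> 0" if a: "a \<in> coord_sphere N" and A0: "0 \<le> A a" and Ac: "A a \<le> c0 * b a" for a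
  proof
    assume "v2 a = 0"
    then have Vz: "V a i = 0" if "i < N" for i
      using that by (simp add: v2_def sum_nonneg_eq_0_iff)
    then have eq: "lam i * a i = A a / b a * db a i" if "i < N" for i
      using that by (simp add: V_def split: if_splits)
    have g: "0 \<le> A a / b a" "A a / b a \<le> c0"
      using A0 Ac bpos[OF a] by (simp_all add: pos_divide_le_eq)
    show False
    proof (cases "A a / b a = 0")
      case True
      have "a i = 0" if "i < N" for i
        using eq[OF that] True lam_neg[of i] lam_pos[of i] that by (cases "i \<le> k") auto
      then show False using a by (simp add: coord_sphere_def)
    next
      case False
      then have "0 < A a / b a" using g(1) by linarith
      then show False using no a g(2) eq unfolding c0_def by blast
    qed
  qed
  from descent[OF this, of c0] obtain \<epsilon> \<delta> where \<epsilon>: "\<epsilon> > 0" and \<delta>: "\<delta> > 0"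
    and n0: "\<And>s a. 0 \<le> s \<Longrightarrow> s \<le> \<epsilon> \<Longrightarrow> a \<in> sub c0 \<Longrightarrow> (\<Sum>i<N. (a i - s * V a i)\<^sup>2) \<noteq> 0"
    and st0: "\<And>s a. 0 \<le> s \<Longrightarrow> s \<le> \<epsilon> \<Longrightarrow> a \<in> sub c0 \<Longrightarrow> A a \<le> 0 \<Longrightarrow> step s a \<in> sub 0"
    and st: "\<And>c a. a \<in> sub c0 \<Longrightarrow> A a \<le> c * b a \<Longrightarrow> step \<epsilon> a \<in> sub (max 0 (c - \<delta>))"
    by auto
  have sub_mono: "sub c \<subseteq> sub c'" if "c \<le> c'" for c c'
    using that bpos by (auto simp: sub_def intro: order_trans[OF _ mult_right_mono] less_imp_le)
  define S where "S = coord_sphere (Suc k)"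
  have SX: "x i = 0" if "x \<in> S" "k < i" for x i
    using that by (auto simp: S_def coord_sphere_def coord_space_def)
  have sumS: "(\<Sum>i<N. f i) = (\<Sum>i<Suc k. f i)" if "\<And>i. k < i \<Longrightarrow> f i = 0" for f :: "nat \<Rightarrow> real"
    using kN that by (intro sum.mono_neutral_right) auto
  have SN: "S \<subseteq> coord_sphere N"
  proof
    fix x assume x: "x \<in> S"
    then have "(sqsum N x) = (sqsum (Suc k) x)" by (intro sumS) (auto simp: SX)
    then show "x \<in> coord_sphere N"
      using x kN SX[OF x] by (auto simp: S_def coord_sphere_def coord_space_def)
  qed
  have S0: "S \<subseteq> sub 0"
  proof
    fix x assume x: "x \<in> S"
    have "lam i * (x i)\<^sup>2 \<le> 0" if "i < N" for i
      using lam_neg[of i] SX[OF x, of i] by (cases "i \<le> k") (auto simp: mult_nonpos_nonneg)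
    then have "A x \<le> 0" unfolding A_def by (auto intro!: sum_nonpos)
    then show "x \<in> sub 0" using x SN by (auto simp: sub_def)
  qed
  define P where "P c \<longleftrightarrow> (\<exists>p. homotopic_with_canon (\<lambda>_. True) S (sub c) id (\<lambda>_. p))" for c
  have P0: "P c0"
  proof -
    define h :: "real \<times> (nat \<Rightarrow> real) \<Rightarrow> nat \<Rightarrow> real"
      where "h = (\<lambda>(t, x) i. (1 - t) * x i + t * (if i = Suc k then 1 else 0))"
    have hS: "(\<Sum>i<N. (h (t, x) i)\<^sup>2) = (1-t)\<^sup>2 + t\<^sup>2" if x: "x \<in> S" for t x
    proof -
      have "(h (t, x) i)\<^sup>2 = (1-t)\<^sup>2 * (x i)\<^sup>2 + (if i = Suc k then t\<^sup>2 else 0)" for i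
        using SX[OF x, of "Suc k"] by (simp add: h_def power_mult_distrib)
      then have "(\<Sum>i<N. (h (t, x) i)\<^sup>2) = (1-t)\<^sup>2 * (sqsum N x) + t\<^sup>2"
        using kN by (simp add: sum.distrib sum_distrib_left)
      then show ?thesis using x SN by (auto simp: coord_sphere_def)
    qed
    have hpos: "(1-t)\<^sup>2 + t\<^sup>2 > 0" for t :: real
      by (auto simp: sum_power2_gt_zero_iff)
    have hsub: "coord_normalize N (h (t, x)) \<in> sub c0" if x: "x \<in> S" for t x
    proof (rule normalize_sublevel)
      show "(\<Sum>i<N. (h (t, x) i)\<^sup>2) \<noteq> 0" unfolding hS[OF x] using hpos[of t] by simp
      show hX: "h (t, x) \<in> coord_space N" using SX[OF x] kN by (auto simp: h_def coord_space_def)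
      have "(\<Sum>i<N. lam i * (h (t, x) i)\<^sup>2) \<le> (\<Sum>i<N. if i = Suc k then lam (Suc k) * t\<^sup>2 else 0)"
      proof (intro sum_mono)
        fix i
        consider "i \<le> k" | "i = Suc k" | "i > Suc k" by linarith
        then show "lam i * (h (t, x) i)\<^sup>2 \<le> (if i = Suc k then lam (Suc k) * t\<^sup>2 else 0)"
          using lam_neg[of i] SX[OF x, of i] by cases (auto simp: h_def mult_nonpos_nonneg)
      qed
      also have "\<dots> = lam (Suc k) * t\<^sup>2" using kN by simp
      finally have "A (h (t, x)) \<le> lam (Suc k) * t\<^sup>2 / 2" by (simp add: A_def)
      also have "\<dots> = c0 * (\<kappa> * t\<^sup>2)" using \<kappa> by (simp add: c0_def)
      also have "\<dots> \<le> c0 * b (h (t, x))"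
      proof -
        have "\<kappa> * t\<^sup>2 \<le> \<kappa> * ((1-t)\<^sup>2 + t\<^sup>2)" using \<kappa> by (intro mult_left_mono) auto
        also have "\<dots> \<le> b (h (t, x))" using b_lower[OF hX] unfolding hS[OF x] .
        finally show ?thesis using c0 by simp
      qed
      finally show "A (h (t, x)) \<le> c0 * b (h (t, x))" .
    qed
    have "homotopic_with_canon (\<lambda>_. True) S (sub c0) id
        (\<lambda>_ i. if i = Suc k then 1 else 0)"
    proof (rule homotopic_with_canonI[where h = "\<lambda>z. coord_normalize N (h z)"])
      show "continuous_on ({0..1} \<times> S) (\<lambda>z. coord_normalize N (h z))"
      proof (rule continuous_on_coord_normalize)
        show "continuous_on ({0..1} \<times> S) h" unfolding h_def case_prod_unfold
          by (rule continuous_on_coordinatewise_then_product) (intro continuous_intros continuous_on_snd_coordinate)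
        show "(\<Sum>i<N. (h z i)\<^sup>2) \<noteq> 0" if "z \<in> {0..1} \<times> S" for z
          using that hS[of "snd z" "fst z"] hpos[of "fst z"] by auto
      qed
      show "coord_normalize N (h (0, x)) = id x" if "x \<in> S" for x
        using that SN by (auto simp: h_def intro!: coord_normalize_sphere)
      show "coord_normalize N (h (1, x)) = (\<lambda>i. if i = Suc k then 1 else 0)" for x
        using kN by (auto simp: h_def coord_normalize_def fun_eq_iff if_distrib[of power2] cong: if_cong)
    qed (use hsub in auto)
    then show ?thesis unfolding P_def by blast
  qed
  have step_cont: "continuous_on (sub c0) (step \<epsilon>)"
    unfolding step_def
  proof (rule continuous_on_coord_normalize)
    show "continuous_on (sub c0) (\<lambda>a i. a i - \<epsilon> * V a i)"
      by (intro continuous_on_coordinatewise_then_product continuous_intros cont_coord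
          continuous_on_subset[OF V_cont]) (auto simp: sub_def)
  qed (use n0 \<epsilon> in auto)
  \<comment> \<open>The full step carries the contraction to the lower level. It also moves S, but S
    lies in \<open>sub 0\<close>, which all shorter steps preserve, so the moved inclusion is
    homotopic to the original one inside the lower sublevel.\<close>
  have Pstep: "P (max 0 (c - \<delta>))" if Pc: "P c" and c: "0 \<le> c" "c \<le> c0" for c
  proof -
    let ?c' = "max 0 (c - \<delta>)"
    have cc0: "sub c \<subseteq> sub c0" by (rule sub_mono[OF c(2)])
    have "step \<epsilon> a \<in> sub ?c'" if "a \<in> sub c" for a
      using st[of a c] that cc0 by (auto simp: sub_def)
    then have map: "continuous_map (top_of_set (sub c)) (top_of_set (sub ?c')) (step \<epsilon>)"
      using continuous_on_subset[OF step_cont cc0] by auto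
    obtain p where p: "homotopic_with_canon (\<lambda>_. True) S (sub c) id (\<lambda>_. p)"
      using Pc by (auto simp: P_def)
    have 1: "homotopic_with_canon (\<lambda>_. True) S (sub ?c') (step \<epsilon>) (\<lambda>_. step \<epsilon> p)"
      using homotopic_with_compose_continuous_map_left[OF p map, of "\<lambda>_. True"] by (simp add: o_def)
    have Sc0: "S \<subseteq> sub c0" using S0 sub_mono[of 0 c0] c0 by auto
    have "homotopic_with_canon (\<lambda>_. True) S (sub ?c') id (step \<epsilon>)"
    proof (rule homotopic_with_canonI[where h = "\<lambda>(t, x). step (t * \<epsilon>) x"])
      have te: "0 \<le> t * \<epsilon>" "t * \<epsilon> \<le> \<epsilon>" if "0 \<le> t" "t \<le> 1" for t
        using that \<epsilon> by (auto simp: mult_left_le_one_le)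
      show "continuous_on ({0..1} \<times> S) (\<lambda>(t, x). step (t * \<epsilon>) x)"
        unfolding step_def case_prod_unfold
      proof (rule continuous_on_coord_normalize)
        have "continuous_on ({0..1::real} \<times> S) (\<lambda>z. V (snd z) i)" for i
          by (rule continuous_on_compose2[OF V_cont continuous_on_snd]) (use SN in auto)
        then have "continuous_on ({0..1} \<times> S) (\<lambda>z. snd z i - fst z * \<epsilon> * V (snd z) i)" for i
          by (intro continuous_on_diff continuous_on_mult continuous_on_snd_coordinate continuous_on_fst continuous_on_id
              continuous_on_const)
        then show "continuous_on ({0..1} \<times> S) (\<lambda>z i. snd z i - fst z * \<epsilon> * V (snd z) i)"
          by (rule continuous_on_coordinatewise_then_product)
      qed (use n0 te Sc0 in auto)
      show "(case (t, x) of (t, x) \<Rightarrow> step (t * \<epsilon>) x) \<in> sub ?c'"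
        if "0 \<le> t" "t \<le> 1" "x \<in> S" for t x
        using st0[OF te[OF that(1,2)], of x] that Sc0 S0 sub_mono[of 0 ?c'] by (auto simp: sub_def)
      show "(case (0, x) of (t, x) \<Rightarrow> step (t * \<epsilon>) x) = id x" if "x \<in> S" for x
        using that SN by (auto simp: step_def intro!: coord_normalize_sphere)
    qed auto
    from homotopic_with_trans[OF this 1] show ?thesis unfolding P_def by blast
  qed
  have "P (max 0 (c0 - real n * \<delta>))" for n
  proof (induction n)
    case 0 then show ?case using P0 c0 by simp
  next
    case (Suc n)
    have "max 0 (max 0 (c0 - real n * \<delta>) - \<delta>) = max 0 (c0 - real (Suc n) * \<delta>)"
      using \<delta> by (auto simp: max_def algebra_simps)
    moreover have "max 0 (c0 - real n * \<delta>) \<le> c0" using c0 \<delta> by simp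
    ultimately show ?case using Pstep[OF Suc.IH] by simp
  qed
  moreover obtain n where n: "c0 < real n * \<delta>" using reals_Archimedean3[OF \<delta>] by blast
  moreover have "max 0 (c0 - real n * \<delta>) = 0" using n by simp
  ultimately have "P 0" by metis
  then obtain p where p: "homotopic_with_canon (\<lambda>_. True) S (sub 0) id (\<lambda>_. p)"
    by (auto simp: P_def)
  \<comment> \<open>Without negative coordinates \<open>A\<close> is nonnegative, hence 0 on
    \<open>sub 0\<close>; the remaining \<open>lam i\<close> are positive, so all coordinates would
    vanish.\<close>
  have neg0: "(sqsum (Suc k) a) \<noteq> 0" if a: "a \<in> sub 0" for a
  proof
    assume "(sqsum (Suc k) a) = 0"
    then have z: "a i = 0" if "i \<le> k" for i
      using that by (simp add: sum_nonneg_eq_0_iff del: sum.lessThan_Suc)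
    have nn: "lam i * (a i)\<^sup>2 \<ge> 0" if "i < N" for i
      using z[of i] lam_pos[of i] that by (cases "i \<le> k") auto
    have "(\<Sum>i<N. lam i * (a i)\<^sup>2) \<le> 0" using a by (simp add: sub_def A_def)
    then have "(\<Sum>i<N. lam i * (a i)\<^sup>2) = 0"
      using sum_nonneg[of "{..<N}" "\<lambda>i. lam i * (a i)\<^sup>2"] nn by force
    then have l0: "lam i * (a i)\<^sup>2 = 0" if "i < N" for i
      using that nn by (subst (asm) sum_nonneg_eq_0_iff) auto
    have "a i = 0" if "i < N" for i
      using z[of i] lam_pos[of i] l0[OF that] that by (cases "i \<le> k") auto
    then show False using a by (simp add: sub_def coord_sphere_def)
  qed
  have "continuous_map (top_of_set (sub 0)) (top_of_set S) (coord_normalize (Suc k))"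
    using continuous_on_coord_normalize[of "sub 0" "\<lambda>x. x" "Suc k"] neg0 coord_normalize_in_sphere
    by (auto simp: S_def continuous_on_id)
  from homotopic_with_compose_continuous_map_left[OF p this, of "\<lambda>_. True"]
  have "homotopic_with_canon (\<lambda>_. True) S S (coord_normalize (Suc k)) (\<lambda>_. coord_normalize (Suc k) p)"
    by (simp add: o_def)
  moreover have "homotopic_with_canon (\<lambda>_. True) S S id (coord_normalize (Suc k))"
    by (rule homotopic_with_equal) (auto simp: S_def coord_normalize_sphere)
  ultimately have "contractible_space (nsphere k)"
    unfolding contractible_space_def nsphere_eq_coord_sphere S_def[symmetric]
    by (meson homotopic_with_trans)
  then show False using non_contractible_space_nsphere by blast
qed

end

section \<open>Uniqueness of Fourier coefficients\<close>

text \<open>On the circle a real-linear function is a combination of e^(i t) and e^(- i t), so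
  multiplying by it only shifts \<open>m\<close> by one. The weight \<open>w\<close> is generalised
  because in the product case the first factor is absorbed into it.\<close>

lemma integral_trig_polynomial_eq_0:
  fixes g :: "complex \<Rightarrow> real"
  assumes "real_polynomial_function g" "continuous_on {0..2*pi} w"
    and "\<And>m::int. integral {0..2*pi} (\<lambda>t. w t * cis (m * t)) = 0"
  shows "integral {0..2*pi} (\<lambda>t. w t * of_real (g (cis t)) * cis (of_int m * t)) = 0"
  using assms
proof (induction g arbitrary: w m rule: real_polynomial_function.induct)
  case (linear f)
  interpret f: bounded_linear f by fact
  define \<alpha> where "\<alpha> = (f 1 - \<i> * f \<i>) / 2"
  define \<beta> where "\<beta> = (f 1 + \<i> * f \<i>) / 2"
  have f: "complex_of_real (f (cis t)) = \<alpha> * cis t + \<beta> * cis (- t)" for t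
  proof -
    have "cis t = cos t *\<^sub>R 1 + sin t *\<^sub>R \<i>" by (simp add: complex_eq_iff)
    then have "f (cis t) = cos t * f 1 + sin t * f \<i>" by (simp only: f.add f.scaleR) simp
    then show ?thesis by (simp add: \<alpha>_def \<beta>_def complex_eq_iff field_simps)
  qed
  have eq: "w t * of_real (f (cis t)) * cis (of_int m * t) =
      \<alpha> * (w t * cis (of_int (m + 1) * t)) + \<beta> * (w t * cis (of_int (m - 1) * t))" for t
    unfolding f by (simp add: algebra_simps cis_mult)
  have i: "(\<lambda>t. c * (w t * cis (of_int k * t))) integrable_on {0..2*pi}" for k c
    by (intro integrable_continuous_real continuous_intros linear)
  show ?case unfolding eq integral_add[OF i i] integral_mult_right
    using linear(3)[of "m + 1"] linear(3)[of "m - 1"] by simp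
next
  case (const c)
  have eq: "w t * of_real c * cis (of_int m * t) = c * (w t * cis (of_int m * t))" for t by simp
  show ?case unfolding eq integral_mult_right using const by simp
next
  case (add f g)
  have i: "(\<lambda>t. w t * of_real (h (cis t)) * cis (of_int m * t)) integrable_on {0..2*pi}"
    if "real_polynomial_function h" for h
  proof -
    have "continuous_on UNIV h"
      using that continuous_on_polymonial_function real_polynomial_function_eq by blast
    then have "continuous_on {0..2*pi} (\<lambda>s. h (cis s))"
      by (rule continuous_on_compose2[OF _ continuous_on_cis[OF continuous_on_id]]) simp
    then show ?thesis by (intro integrable_continuous_real continuous_intros add)
  qed
  show ?case
    using add.IH(1)[OF add.prems] add.IH(2)[OF add.prems] integral_add[OF i[OF add.hyps(1)] i[OF add.hyps(2)]]
    by (simp add: algebra_simps)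
next
  case (mult f g)
  have "continuous_on UNIV f"
    using mult(1) continuous_on_polymonial_function real_polynomial_function_eq by blast
  then have "continuous_on {0..2*pi} (\<lambda>s. f (cis s))"
    by (rule continuous_on_compose2[OF _ continuous_on_cis[OF continuous_on_id]]) simp
  then have c: "continuous_on {0..2*pi} (\<lambda>t. w t * of_real (f (cis t)))"
    by (intro continuous_intros mult)
  show ?case
    using mult.IH(2)[OF c mult.IH(1)[OF mult.prems]] by (simp add: mult_ac)
qed

text \<open>The integral of w times any trigonometric polynomial is 0. Choosing a polynomial
  uniformly e-close to the conjugate of w bounds the integral of |w|^2 by e times the integral of
  |w|.\<close>

theorem Fourier_coefficients_eq_0_imp_eq_0:
  fixes w :: "real \<Rightarrow> complex"
  assumes w: "continuous_on {0..2*pi} w" "w (2*pi) = w 0"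
    and coeff: "\<And>m::int. integral {0..2*pi} (\<lambda>t. w t * cis (m * t)) = 0"
    and t: "t \<in> {0..2*pi}"
  shows "w t = 0"
proof -
  let ?I = "{0..2*pi}"
  define f where "f = (\<lambda>z. cnj (w (Arg2pi z)))"
  \<comment> \<open>A loop is homotopic to itself; passing to circle maps turns this into continuity
    of w composed with \<open>Arg2pi\<close>, also at the cut, where the closing condition w (2 pi)
    = w 0 enters.\<close>
  have "homotopic_loops UNIV (\<lambda>s. w (2 * pi * s)) (\<lambda>s. w (2 * pi * s))"
    using w by (auto simp: homotopic_loops_refl path_def pathstart_def pathfinish_def
        intro!: continuous_on_compose2[OF w(1)] continuous_intros)
  from homotopic_with_imp_continuous[OF homotopic_loops_imp_homotopic_circlemaps[OF this]]
  have "continuous_on (sphere 0 1) f"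
    unfolding f_def o_def by (intro continuous_intros) simp
  note SW = Stone_Weierstrass_polynomial_function[OF compact_sphere this]
  have fcis: "f (cis s) = cnj (w s)" if s: "s \<in> ?I" for s
  proof (cases "s = 2*pi")
    case True then show ?thesis using w(2) Arg2pi_unique[of 1 0 1] by (simp add: f_def)
  next
    case False
    then have "Arg2pi (cis s) = s" using s by (intro Arg2pi_unique[of 1]) (auto simp: cis_conv_exp)
    then show ?thesis by (simp add: f_def)
  qed
  define K where "K = integral ?I (\<lambda>s. norm (w s))"
  have K: "K \<ge> 0" unfolding K_def by (intro integral_nonneg integrable_continuous_real continuous_intros w) auto
  have le: "integral ?I (\<lambda>s. (norm (w s))\<^sup>2) \<le> e * K" if e: "e > 0" for e
  proof -
    obtain g where g: "polynomial_function g" "\<And>x. x \<in> sphere 0 1 \<Longrightarrow> norm (f x - g x) < e"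
      using SW[OF e] by blast
    have gr: "real_polynomial_function (Re o g)" "real_polynomial_function (Im o g)"
      using g(1) bounded_linear_Re bounded_linear_Im unfolding polynomial_function_def by blast+
    have "continuous_on UNIV g" using g(1) continuous_on_polymonial_function by blast
    then have cg: "continuous_on ?I (\<lambda>s. g (cis s))"
      by (rule continuous_on_compose2[OF _ continuous_on_cis[OF continuous_on_id]]) simp
    have "w s * g (cis s) = w s * of_real ((Re o g) (cis s)) * cis (of_int 0 * s)
       + \<i> * (w s * of_real ((Im o g) (cis s)) * cis (of_int 0 * s))" for s
      by (subst complex_eq[of "g (cis s)"]) (simp add: algebra_simps)
    then have "integral ?I (\<lambda>s. w s * g (cis s)) =
       integral ?I (\<lambda>s. w s * of_real ((Re o g) (cis s)) * cis (of_int 0 * s))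
       + integral ?I (\<lambda>s. \<i> * (w s * of_real ((Im o g) (cis s)) * cis (of_int 0 * s)))"
      by (simp only: o_def) (intro integral_add integrable_continuous_real continuous_intros w cg; simp)
    also have "\<dots> = 0"
      using integral_trig_polynomial_eq_0[OF gr(1) w(1) coeff, of 0] integral_trig_polynomial_eq_0[OF gr(2) w(1) coeff, of 0]
      by simp
    finally have 0: "integral ?I (\<lambda>s. w s * g (cis s)) = 0" .
    have "(\<lambda>s. (norm (w s))\<^sup>2) integrable_on ?I"
      by (intro integrable_continuous_real continuous_intros w)
    from integral_linear[OF this bounded_linear_of_real[where 'a = complex]]
    have "of_real (integral ?I (\<lambda>s. (norm (w s))\<^sup>2)) = integral ?I (\<lambda>s. w s * cnj (w s))"
      by (simp add: o_def complex_norm_square[symmetric] del: of_real_power)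
    also have "\<dots> = integral ?I (\<lambda>s. w s * (cnj (w s) - g (cis s)))"
      unfolding right_diff_distrib
      by (subst integral_diff) (intro integrable_continuous_real continuous_intros w cg | simp add: 0)+
    finally have "\<bar>integral ?I (\<lambda>s. (norm (w s))\<^sup>2)\<bar> = norm (integral ?I (\<lambda>s. w s * (cnj (w s) - g (cis s))))"
      by (metis norm_of_real)
    also have "\<dots> \<le> integral ?I (\<lambda>s. e * norm (w s))"
    proof (intro integral_norm_bound_integral integrable_continuous_real continuous_intros w cg)
      fix s assume "s \<in> ?I"
      then have "norm (cnj (w s) - g (cis s)) \<le> e" using g(2)[of "cis s"] fcis[of s] by simp
      then show "norm (w s * (cnj (w s) - g (cis s))) \<le> e * norm (w s)"
        unfolding norm_mult by (subst mult.commute) (rule mult_right_mono, simp_all)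
    qed
    finally show ?thesis by (simp add: K_def)
  qed
  have "integral ?I (\<lambda>s. (norm (w s))\<^sup>2) \<le> 0"
  proof (rule field_le_epsilon)
    fix e :: real assume e: "e > 0"
    have "integral ?I (\<lambda>s. (norm (w s))\<^sup>2) \<le> e / (K + 1) * K" using e K by (intro le) simp
    also have "\<dots> \<le> e" using e K by (simp add: field_simps)
    finally show "integral ?I (\<lambda>s. (norm (w s))\<^sup>2) \<le> 0 + e" by simp
  qed
  moreover have "integral ?I (\<lambda>s. (norm (w s))\<^sup>2) \<ge> 0"
    by (intro integral_nonneg integrable_continuous_real continuous_intros w) auto
  ultimately have "integral ?I (\<lambda>s. (norm (w s))\<^sup>2) = 0" by simp
  then have "\<forall>s\<in>?I. (norm (w s))\<^sup>2 = 0"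
    by (subst integral_eq_0_iff[symmetric]) (auto intro!: continuous_intros w)
  then show ?thesis using t by simp
qed

section \<open>Galerkin approximation\<close>

type_synonym c2 = "complex \<times> complex"

definition cmul :: "complex \<Rightarrow> c2 \<Rightarrow> c2" where "cmul c x = (c * fst x, c * snd x)"

definition c2_basis :: "nat \<Rightarrow> c2" where
  "c2_basis j = (if j = 0 then (1, 0) else if j = 1 then (\<i>, 0) else if j = 2 then (0, 1) else (0, \<i>))"

text \<open>Only odd frequencies occur; the indices below \<open>4 n\<close> carry the negative ones, and the index \<open>4 n\<close> has frequency 1.\<close>

definition freq :: "nat \<Rightarrow> nat \<Rightarrow> int" where
  "freq n i = (if i < 4 * n then - (2 * int (i div 4) + 1) else 2 * int ((i - 4 * n) div 4) + 1)"

definition mode :: "nat \<Rightarrow> nat \<Rightarrow> real \<Rightarrow> c2" where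
  "mode n i t = cmul (cis (real_of_int (freq n i) * t)) (c2_basis (i mod 4))"

text \<open>The frequencies are the odd numbers from - (2 n - 1) to 2 n - 1, each with the four real
  directions of C^2, hence \<open>8 * n\<close> real coefficients.\<close>

definition trig_loop :: "nat \<Rightarrow> (nat \<Rightarrow> real) \<Rightarrow> real \<Rightarrow> c2" where
  "trig_loop n a t = (\<Sum>i<8*n. a i *\<^sub>R mode n i t)"

section \<open>Real Fourier modes: orthogonality, derivative, antiperiodicity\<close>

lemma bounded_linear_cmul: "bounded_linear (cmul c)"
  unfolding cmul_def
  by (intro bounded_linear_Pair bounded_linear_mult_right[THEN bounded_linear_compose]
      bounded_linear_fst bounded_linear_snd)

lemma norm_cmul: "norm (cmul c x) = norm c * norm x"
  by (simp add: cmul_def norm_prod_def norm_mult power_mult_distrib real_sqrt_mult flip: distrib_left)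

lemma inner_cmul_cis:
  "inner (cmul (cis \<alpha>) x) (cmul (cis \<beta>) y) =
     cos (\<alpha> - \<beta>) * inner x y + sin (\<alpha> - \<beta>) * inner (cmul \<i> x) y"
  by (simp add: cmul_def inner_prod_def inner_complex_def cos_diff sin_diff algebra_simps)

lemma inner_c2_basis: "p < 4 \<Longrightarrow> q < 4 \<Longrightarrow> inner (c2_basis p) (c2_basis q) = (if p = q then 1 else 0)"
  by (auto simp: c2_basis_def inner_prod_def inner_complex_def)

lemma norm_c2_basis: "norm (c2_basis j) = 1"
  by (simp add: c2_basis_def norm_prod_def)

lemma norm_mode: "norm (mode n i t) = 1"
  by (simp add: mode_def norm_cmul norm_c2_basis)

lemma odd_freq: "odd (freq n i)" by (simp add: freq_def)

lemma freq_inj: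
  assumes "i < 8 * n" "j < 8 * n" "freq n i = freq n j" "i mod 4 = j mod 4"
  shows "i = j"
proof -
  have "(i - 4 * n) mod 4 = i mod 4" if "i \<ge> 4 * n" for i
    using that by (metis le_add_diff_inverse mod_mult_self4)
  then have m: "(i - 4 * n) mod 4 = (j - 4 * n) mod 4" if "i \<ge> 4 * n" "j \<ge> 4 * n"
    using that assms(4) by simp
  show ?thesis
  proof (cases "i < 4 * n")
    case True
    then have "i div 4 = j div 4" using assms(3) by (auto simp: freq_def split: if_splits)
    then show ?thesis using assms(4) by (metis div_mult_mod_eq)
  next
    case False
    then have j: "\<not> j < 4 * n" and "(i - 4 * n) div 4 = (j - 4 * n) div 4"
      using assms(3) by (auto simp: freq_def split: if_splits)
    then have "i - 4 * n = j - 4 * n" using m False by (metis div_mult_mod_eq not_less)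
    then show ?thesis using False j by simp
  qed
qed

lemma has_integral_cos_sin_period:
  fixes m :: int assumes "m \<noteq> 0"
  shows "((\<lambda>t. cos (real_of_int m * t)) has_integral 0) {0..2*pi}" "((\<lambda>t. sin (real_of_int m * t)) has_integral 0) {0..2*pi}"
proof -
  have m: "real_of_int m \<noteq> 0" using assms by simp
  have s: "sin (m * (2 * pi)) = 0" "cos (m * (2 * pi)) = 1"
    using sin_int_2pin[of m] cos_int_2pin[of m] by (simp_all add: mult.commute)
  have "((\<lambda>t. cos (real_of_int m * t)) has_integral sin (m * (2*pi)) / m - sin (real_of_int m * 0) / m) {0..2*pi}"
    using m by (intro fundamental_theorem_of_calculus)
      (auto intro!: derivative_eq_intros simp flip: has_real_derivative_iff_has_vector_derivative)
  then show "((\<lambda>t. cos (real_of_int m * t)) has_integral 0) {0..2*pi}" unfolding s by simp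
  have "((\<lambda>t. sin (real_of_int m * t)) has_integral - cos (m * (2*pi)) / m - - cos (real_of_int m * 0) / m) {0..2*pi}"
    using m by (intro fundamental_theorem_of_calculus)
      (auto intro!: derivative_eq_intros simp flip: has_real_derivative_iff_has_vector_derivative)
  then show "((\<lambda>t. sin (real_of_int m * t)) has_integral 0) {0..2*pi}" unfolding s by simp
qed

lemma mode_orthogonal:
  assumes "i < 8 * n" "j < 8 * n"
  shows "((\<lambda>t. inner (mode n i t) (mode n j t)) has_integral (if i = j then 2 * pi else 0)) {0..2*pi}"
proof (cases "freq n i = freq n j")
  case True
  then have eq: "inner (mode n i t) (mode n j t) = (if i = j then 1 else 0)" for t
    unfolding mode_def inner_cmul_cis using freq_inj[OF assms] by (auto simp: inner_c2_basis)
  show ?thesis unfolding eq using has_integral_const_real[of "if i = j then 1 else 0 :: real" 0 "2*pi"]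
    by auto
next
  case False
  define m where "m = freq n i - freq n j"
  have m: "m \<noteq> 0" using False by (simp add: m_def)
  have eq: "real_of_int (freq n i) * t - freq n j * t = real_of_int m * t" for t :: real by (simp add: m_def algebra_simps)
  note h = has_integral_cos_sin_period[OF m]
  have "((\<lambda>t. inner (mode n i t) (mode n j t)) has_integral
      0 * inner (c2_basis (i mod 4)) (c2_basis (j mod 4)) + 0 * inner (cmul \<i> (c2_basis (i mod 4))) (c2_basis (j mod 4))) {0..2*pi}"
    unfolding mode_def inner_cmul_cis eq by (intro has_integral_add has_integral_mult_left h)
  then show ?thesis using False by auto
qed

text \<open>Parseval's identity; 2 pi is the squared L2 norm of a mode.\<close>

lemma trig_loop_inner:
  "((\<lambda>t. inner (trig_loop n a t) (trig_loop n c t)) has_integral 2 * pi * (\<Sum>i<8*n. a i * c i)) {0..2*pi}"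
proof -
  have eq: "inner (trig_loop n a t) (trig_loop n c t) =
      (\<Sum>i<8*n. \<Sum>j<8*n. a i * c j * inner (mode n i t) (mode n j t))" for t
    unfolding trig_loop_def inner_sum_left by (simp add: inner_sum_right sum_distrib_left mult_ac)
  have "((\<lambda>t. inner (trig_loop n a t) (trig_loop n c t)) has_integral
      (\<Sum>i<8*n. \<Sum>j<8*n. a i * c j * (if i = j then 2 * pi else 0))) {0..2*pi}"
    unfolding eq by (intro has_integral_sum has_integral_mult_right mode_orthogonal) auto
  also have "(\<Sum>i<8*n. \<Sum>j<8*n. a i * c j * (if i = j then 2 * pi else 0)) = 2 * pi * (\<Sum>i<8*n. a i * c i)"
    by (simp add: if_distrib sum_distrib_left mult_ac cong: if_cong)
  finally show ?thesis .
qed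

lemma continuous_on_mode: "continuous_on S (\<lambda>t. mode n i t)"
  unfolding mode_def cmul_def by (intro continuous_intros)

lemma continuous_on_trig_loop: "continuous_on S (\<lambda>t. trig_loop n a t)"
  unfolding trig_loop_def by (intro continuous_intros continuous_on_mode)

lemma trig_loop_add: "trig_loop n (\<lambda>i. a i + h i) t = trig_loop n a t + trig_loop n h t"
  by (simp add: trig_loop_def algebra_simps sum.distrib)

lemma trig_loop_scale: "trig_loop n (\<lambda>i. s * a i) t = s *\<^sub>R trig_loop n a t"
  by (simp add: trig_loop_def scaleR_sum_right)

text \<open>The constant grows with \<open>n\<close>. This is harmless because the bound serves only
  to verify the first-order expansion required by \<open>linking\<close>, with \<open>n\<close>
  fixed.\<close>

lemma norm_trig_loop_le: "norm (trig_loop n a t) \<le> 8 * n * sqrt (sqsum (8*n) a)"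
proof -
  have "norm (trig_loop n a t) \<le> (\<Sum>i<8*n. \<bar>a i\<bar>)"
    unfolding trig_loop_def by (rule order_trans[OF norm_sum]) (simp add: norm_mode)
  also have "\<dots> \<le> (\<Sum>i<8*n. sqrt (sqsum (8*n) a))"
    by (intro sum_mono real_le_rsqrt) (auto intro!: member_le_sum)
  finally show ?thesis by simp
qed

text \<open>Multiplying the coefficients by the frequencies is thus the operator - i d/dt, whose
  quadratic form gives the action.\<close>

lemma trig_loop_has_vector_derivative:
  "(trig_loop n a has_vector_derivative cmul \<i> (trig_loop n (\<lambda>i. real_of_int (freq n i) * a i) t)) (at t)"
proof -
  have m: "(mode n i has_vector_derivative cmul \<i> (of_int (freq n i) *\<^sub>R mode n i t)) (at t)" for i
  proof -
    have "((\<lambda>t. cis (real_of_int (freq n i) * t)) has_vector_derivative of_int (freq n i) *\<^sub>R (\<i> * cis (freq n i * t))) (at t)"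
      unfolding cis.ctr has_vector_derivative_complex_iff
      by (auto intro!: derivative_eq_intros simp: cis.ctr)
    from bounded_linear.has_vector_derivative[OF bounded_linear_mult_left this]
    have c: "((\<lambda>t. cis (real_of_int (freq n i) * t) * z) has_vector_derivative of_int (freq n i) *\<^sub>R (\<i> * cis (freq n i * t)) * z) (at t)" for z .
    show ?thesis unfolding mode_def[abs_def] cmul_def
      by (rule has_vector_derivative_eq_rhs[OF has_vector_derivative_Pair[OF c c]]) (simp add: algebra_simps)
  qed
  interpret c: bounded_linear "cmul \<i>" by (rule bounded_linear_cmul)
  have "(trig_loop n a has_vector_derivative (\<Sum>i<8*n. a i *\<^sub>R cmul \<i> (of_int (freq n i) *\<^sub>R mode n i t))) (at t)"
    unfolding trig_loop_def[abs_def]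
    by (intro has_vector_derivative_sum bounded_linear.has_vector_derivative[OF bounded_linear_scaleR_right] m)
  then show ?thesis by (simp add: trig_loop_def c.sum c.scaleR mult.commute)
qed

lemma trig_loop_antiperiodic: "trig_loop n a (t + pi) = - trig_loop n a t"
proof -
  have "cis (real_of_int (freq n i) * (t + pi)) = - cis (freq n i * t)" for i
  proof -
    have "cis (freq n i * pi) = -1"
    proof -
      obtain k where "freq n i = 2 * k + 1" using odd_freq[of n i] by (elim oddE)
      then have "cis (freq n i * pi) = cis (2 * pi * of_int k) * cis pi"
        unfolding cis_mult by (simp add: algebra_simps)
      then show ?thesis by (simp add: cis_multiple_2pi)
    qed
    then show ?thesis by (simp add: distrib_left cis_mult[symmetric])
  qed
  then show ?thesis by (simp add: trig_loop_def mode_def cmul_def sum_negf[symmetric])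
qed

text \<open>What the variational argument uses of the pulled-back defining function. C^1 is the
  natural regularity: a positively 2-homogeneous function is C^2 at the origin only if it is
  quadratic. The maximal radius enters through \<open>F_lower\<close>; \<open>F_even\<close>
  reflects that x and - x have the same projection.\<close>

locale homogeneous_hamiltonian =
  fixes F :: "c2 \<Rightarrow> real" and gF :: "c2 \<Rightarrow> c2" and R :: real
  assumes F_deriv: "\<And>x. (F has_derivative (\<lambda>h. inner (gF x) h)) (at x)"
    and gF_cont: "continuous_on UNIV gF"
    and F_hom: "\<And>s x. s > 0 \<Longrightarrow> F (s *\<^sub>R x) = s\<^sup>2 * F x"
    and F_even: "\<And>x. F (- x) = F x"
    and R_pos: "R > 0"
    and F_lower: "\<And>x. (norm x)\<^sup>2 \<le> R * F x"
begin

lemma F_cont: "continuous_on S F"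
  using F_deriv by (meson continuous_at_imp_continuous_on has_derivative_continuous)

lemma F_first_order:
  assumes "\<And>s. 0 \<le> s \<Longrightarrow> s \<le> 1 \<Longrightarrow> norm (gF (x + s *\<^sub>R y) - gF x) \<le> e"
  shows "\<bar>F (x + y) - F x - inner (gF x) y\<bar> \<le> e * norm y"
proof -
  have "norm (F (x + y) - F x - inner (gF x) ((x + y) - x)) \<le> norm ((x + y) - x) * e"
  proof (rule differentiable_bound_linearization[where S = "(\<lambda>s. x + s *\<^sub>R y) ` {0..1}" and f' = "\<lambda>z h. inner (gF z) h"])
    show "x + t *\<^sub>R (x + y - x) \<in> (\<lambda>s. x + s *\<^sub>R y) ` {0..1}" if "t \<in> {0..1}" for t
      using that by (intro image_eqI[of _ _ t]) auto
    show "(F has_derivative (\<lambda>h. inner (gF z) h)) (at z within (\<lambda>s. x + s *\<^sub>R y) ` {0..1})" for z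
      using F_deriv has_derivative_at_withinI by blast
    show "x \<in> (\<lambda>s. x + s *\<^sub>R y) ` {0..1}" by (rule image_eqI[of _ _ 0]) auto
    fix z assume "z \<in> (\<lambda>s. x + s *\<^sub>R y) ` {0..1}"
    then have n: "norm (gF z - gF x) \<le> e" using assms by auto
    show "onorm (inner (gF z) - inner (gF x)) \<le> e" unfolding fun_diff_def
    proof (rule onorm_le)
      fix h
      have "norm (inner (gF z) h - inner (gF x) h) = \<bar>inner (gF z - gF x) h\<bar>" by (simp add: inner_diff_left)
      also have "\<dots> \<le> norm (gF z - gF x) * norm h" by (rule Cauchy_Schwarz_ineq2)
      also have "\<dots> \<le> e * norm h" using n by (intro mult_right_mono) auto
      finally show "norm (inner (gF z) h - inner (gF x) h) \<le> e * norm h" .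
    qed
  qed
  then show ?thesis by (simp add: mult.commute)
qed

lemma trig_loop_param_cont:
  "continuous_on UNIV (\<lambda>z :: (nat \<Rightarrow> real) \<times> real. trig_loop n (fst z) (snd z))"
proof -
  have "continuous_on UNIV (\<lambda>z :: (nat \<Rightarrow> real) \<times> real. fst z i)" for i
    by (rule continuous_on_compose2[OF continuous_on_product_coordinates[of i] continuous_on_fst[OF continuous_on_id]]) auto
  then show ?thesis
    unfolding trig_loop_def mode_def cmul_def by (intro continuous_intros)
qed

text \<open>With z the loop of coefficients \<open>a\<close>, the equations say that - i z' - \<mu>
  grad F(z) is orthogonal in L2 to every mode.\<close>

lemma galerkin:
  assumes n: "n \<ge> 1"
  shows "\<exists>a \<mu>. (sqsum (8*n) a) = 1 \<and> 0 < \<mu> \<and> \<mu> \<le> R / 2 \<and>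
    (\<forall>i<8*n. 2 * pi * (real_of_int (freq n i) * a i) = \<mu> * integral {0..2*pi} (\<lambda>t. inner (gF (trig_loop n a t)) (mode n i t)))"
proof -
  define N where "N = 8 * n"
  define b where "b = (\<lambda>a. integral {0..2*pi} (\<lambda>t. F (trig_loop n a t)))"
  define db where "db = (\<lambda>a i. integral {0..2*pi} (\<lambda>t. inner (gF (trig_loop n a t)) (mode n i t)))"
  have iF: "(\<lambda>t. F (trig_loop n a t)) integrable_on {0..2*pi}" for a
    by (intro integrable_continuous_real continuous_on_compose2[OF F_cont continuous_on_trig_loop]) auto
  have cg: "continuous_on {0..2*pi} (\<lambda>t. gF (trig_loop n a t))" for a
    by (rule continuous_on_compose2[OF gF_cont continuous_on_trig_loop]) auto
  have N0: "N > 0" using n by (simp add: N_def)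
  have parseval: "((\<lambda>t. (norm (trig_loop n a t))\<^sup>2) has_integral 2 * pi * (sqsum N a)) {0..2*pi}" for a
    using trig_loop_inner[of n a a] unfolding power2_norm_eq_inner N_def power2_eq_square[of "a _"] .
  \<comment> \<open>\<open>4 * n - 1\<close> is the last index of negative frequency. The lower
    constant 2 pi / R combines Parseval's identity with \<open>F_lower\<close>.\<close>
  interpret linking N "4 * n - 1" "\<lambda>i. of_int (freq n i)" b db "2 * pi / R"
  proof
    show "Suc (4 * n - 1) < N" using n by (simp add: N_def)
    show "real_of_int (freq n i) < 0" if "i \<le> 4 * n - 1" for i using that n by (simp add: freq_def)
    show "real_of_int (freq n i) > 0" if "4 * n - 1 < i" for i using that n by (simp add: freq_def)
    have "continuous_on UNIV (\<lambda>z::(nat\<Rightarrow>real)\<times>real. F (trig_loop n (fst z) (snd z)))"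
      by (rule continuous_on_compose2[OF F_cont trig_loop_param_cont]) auto
    then have "continuous_on (UNIV \<times> cbox 0 (2*pi)) (\<lambda>(a, t). F (trig_loop n a t))"
      by (auto simp: case_prod_unfold intro: continuous_on_subset)
    then show "continuous_on UNIV b" unfolding b_def
      using integral_continuous_on_param[where U = UNIV and a = 0 and b = "2*pi"] by fastforce
    show "continuous_on UNIV (\<lambda>a. db a i)" for i
    proof -
      have "continuous_on UNIV (\<lambda>z::(nat\<Rightarrow>real)\<times>real. inner (gF (trig_loop n (fst z) (snd z))) (mode n i (snd z)))"
        by (intro continuous_intros continuous_on_compose2[OF gF_cont trig_loop_param_cont]
            continuous_on_compose2[OF continuous_on_mode[of UNIV] continuous_on_snd]) auto
      then have "continuous_on (UNIV \<times> cbox 0 (2*pi)) (\<lambda>(a, t). inner (gF (trig_loop n a t)) (mode n i t))"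
        by (auto simp: case_prod_unfold intro: continuous_on_subset)
      then show ?thesis unfolding db_def
        using integral_continuous_on_param[where U = UNIV and a = 0 and b = "2*pi"] by fastforce
    qed
    show "b (\<lambda>i. s * a i) = s\<^sup>2 * b a" if "s > 0" for s a
      by (simp add: b_def trig_loop_scale F_hom[OF that])
    show "2 * pi / R > 0" using R_pos by simp
    show "2 * pi / R * (sqsum N a) \<le> b a" for a
    proof -
      have "((\<lambda>t. R * F (trig_loop n a t)) has_integral R * b a) {0..2*pi}"
        unfolding b_def by (intro has_integral_mult_right integrable_integral iF)
      then have "2 * pi * (sqsum N a) \<le> R * b a"
        by (intro has_integral_le[OF parseval _ F_lower])
      then show ?thesis using R_pos by (simp add: field_simps)
    qed
    fix e :: real assume e: "e > 0"
    \<comment> \<open>N compares the sup norm of a loop with the norm of its coefficients, and 2 pi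
      is the length of the interval of integration.\<close>
    define e' where "e' = e / (2 * pi * N)"
    have e': "e' > 0" using e N0 by (simp add: e'_def)
    have "uniformly_continuous_on (cball 0 (N + 1)) gF"
      by (intro compact_uniformly_continuous continuous_on_subset[OF gF_cont]) auto
    then obtain \<delta> where \<delta>: "\<delta> > 0"
      "\<And>x y. x \<in> cball 0 (N+1) \<Longrightarrow> y \<in> cball 0 (N+1) \<Longrightarrow> dist y x < \<delta> \<Longrightarrow> dist (gF y) (gF x) < e'"
      unfolding uniformly_continuous_on_def using e' by metis
    show "\<exists>d>0. \<forall>a\<in>coord_sphere N. \<forall>h\<in>coord_space N. (sqsum N h) \<le> d\<^sup>2 \<longrightarrow>
        \<bar>b (\<lambda>i. a i + h i) - b a - (\<Sum>i<N. db a i * h i)\<bar> \<le> e * sqrt (sqsum N h)"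
    \<comment> \<open>Small enough that the loop of \<open>h\<close> has sup norm at most 1 and less
      than \<delta>. All points then lie in the ball of radius N + 1, on which \<open>gF\<close> is
      uniformly continuous with this \<delta>.\<close>
    proof (intro exI[of _ "min 1 (\<delta>/2) / N"] conjI ballI impI)
      show "min 1 (\<delta>/2) / N > 0" using \<delta> N0 by simp
      fix a h assume a: "a \<in> coord_sphere N" and h: "(sqsum N h) \<le> (min 1 (\<delta>/2) / N)\<^sup>2"
      let ?q = "sqrt (sqsum N h)"
      have "?q \<le> min 1 (\<delta>/2) / N" using real_sqrt_le_mono[OF h] \<delta>(1) by simp
      then have q: "N * ?q \<le> min 1 (\<delta>/2)" using N0 by (simp add: field_simps)
      have nx: "norm (trig_loop n a t) \<le> N" for t
        using norm_trig_loop_le[of n a t] a by (simp add: coord_sphere_def N_def)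
      have ny: "norm (trig_loop n h t) \<le> N * ?q" for t
        using norm_trig_loop_le[of n h t] by (simp add: N_def)
      have pt: "\<bar>F (trig_loop n a t + trig_loop n h t) - F (trig_loop n a t)
          - inner (gF (trig_loop n a t)) (trig_loop n h t)\<bar> \<le> e' * (N * ?q)" for t
      proof -
        have "\<bar>F (trig_loop n a t + trig_loop n h t) - F (trig_loop n a t)
          - inner (gF (trig_loop n a t)) (trig_loop n h t)\<bar> \<le> e' * norm (trig_loop n h t)"
        proof (rule F_first_order)
          fix s :: real assume s: "0 \<le> s" "s \<le> 1"
          have ss: "norm (s *\<^sub>R trig_loop n h t) \<le> min 1 (\<delta>/2)"
            using s ny[of t] q mult_left_le_one_le[of "norm (trig_loop n h t)" s] by simp
          then have "norm (trig_loop n a t + s *\<^sub>R trig_loop n h t) \<le> N + 1"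
            using nx[of t] norm_triangle_ineq[of "trig_loop n a t" "s *\<^sub>R trig_loop n h t"] by linarith
          then have "dist (gF (trig_loop n a t + s *\<^sub>R trig_loop n h t)) (gF (trig_loop n a t)) < e'"
            using ss nx[of t] \<delta>(1) by (intro \<delta>(2)) (simp_all only: mem_cball dist_0_norm, simp_all add: dist_norm)
          then show "norm (gF (trig_loop n a t + s *\<^sub>R trig_loop n h t) - gF (trig_loop n a t)) \<le> e'"
            by (simp add: dist_norm)
        qed
        also have "\<dots> \<le> e' * (N * ?q)" using ny e' by (intro mult_left_mono) auto
        finally show ?thesis .
      qed
      have I1: "((\<lambda>t. inner (gF (trig_loop n a t)) (trig_loop n h t)) has_integral (\<Sum>i<N. db a i * h i)) {0..2*pi}"
      proof -
        have "inner (gF (trig_loop n a t)) (trig_loop n h t) = (\<Sum>i<N. inner (gF (trig_loop n a t)) (mode n i t) * h i)" for t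
          by (simp add: trig_loop_def inner_sum_right N_def mult.commute)
        then show ?thesis unfolding db_def
          by (simp only:) (intro has_integral_sum has_integral_mult_left integrable_integral
              integrable_continuous_real continuous_intros cg continuous_on_mode; simp)
      qed
      have I2: "((\<lambda>t. F (trig_loop n a t + trig_loop n h t) - F (trig_loop n a t)
          - inner (gF (trig_loop n a t)) (trig_loop n h t)) has_integral
          b (\<lambda>i. a i + h i) - b a - (\<Sum>i<N. db a i * h i)) {0..2*pi}"
        using integrable_integral[OF iF[of "\<lambda>i. a i + h i"]] integrable_integral[OF iF[of a]]
        by (intro has_integral_diff I1) (simp_all add: b_def trig_loop_add)
      have "norm (b (\<lambda>i. a i + h i) - b a - (\<Sum>i<N. db a i * h i)) \<le> e' * (real N * ?q) * measure lborel (cbox 0 (2*pi))"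
        using pt e' by (intro has_integral_bound[OF _ I2[folded box_real(2)]]) (auto simp: sum_nonneg)
      also have "\<dots> = e * ?q" using N0 by (simp add: e'_def)
      finally show "\<bar>b (\<lambda>i. a i + h i) - b a - (\<Sum>i<N. db a i * h i)\<bar> \<le> e * ?q" by simp
    qed
  qed
  obtain a \<mu> where a: "a \<in> coord_sphere N" and \<mu>: "0 < \<mu>" "\<mu> \<le> freq n (Suc (4 * n - 1)) / (2 * (2 * pi / R))"
    and eq: "\<And>i. i < N \<Longrightarrow> real_of_int (freq n i) * a i = \<mu> * db a i"
    using critical_point by blast
  \<comment> \<open>With lowest positive frequency 1 the linking bound is R / (4 pi); the factor 2
    pi from the norm of the modes is then moved into the multiplier, which gives R / 2.\<close>
  have "freq n (Suc (4 * n - 1)) = 1" using n by (simp add: freq_def)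
  then have \<mu>': "2 * pi * \<mu> \<le> R / 2" using \<mu>(2) R_pos by (simp add: field_simps)
  show ?thesis
    using a \<mu>(1) \<mu>' eq unfolding db_def coord_sphere_def N_def
    by (intro exI[of _ a] exI[of _ "2 * pi * \<mu>"]) auto
qed

end

section \<open>The limit of the Galerkin approximations\<close>

lemma integral_antiperiodic_eq_0:
  fixes f :: "real \<Rightarrow> 'a::euclidean_space"
  assumes c: "continuous_on {0..2*pi} f" and a: "\<And>t. 0 \<le> t \<Longrightarrow> t \<le> pi \<Longrightarrow> f (t + pi) = - f t"
  shows "integral {0..2*pi} f = 0"
proof -
  have i: "f integrable_on {0..2*pi}" by (rule integrable_continuous_real[OF c])
  have "continuous_on {0+pi..pi+pi} f" by (rule continuous_on_subset[OF c]) auto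
  from integral_shift[OF this] have "integral {0+pi..pi+pi} f = integral {0..pi} (f \<circ> (\<lambda>x. x + pi))" by simp
  also have "\<dots> = integral {0..pi} (\<lambda>t. - f t)" by (intro integral_cong) (simp add: a)
  finally have "integral {pi..2*pi} f = - integral {0..pi} f" by simp
  moreover have "integral {0..pi} f + integral {pi..2*pi} f = integral {0..2*pi} f"
    by (rule Henstock_Kurzweil_Integration.integral_combine[OF _ _ i]) auto
  ultimately show ?thesis by simp
qed

text \<open>Let Q be a primitive of q and consider p - i \<mu> Q. Its odd Fourier coefficients
  vanish by integration by parts and the weak equation, its nonzero even ones by antiperiodicity of
  p and q. By uniqueness of Fourier coefficients it is constant, so p is as differentiable as
  Q.\<close>

lemma weak_derivative_imp_derivative:
  fixes p q :: "real \<Rightarrow> complex" and \<mu> :: real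
  assumes p: "continuous_on {0..2*pi} p" and q: "continuous_on {0..2*pi} q"
    and pa: "\<And>t. 0 \<le> t \<Longrightarrow> t \<le> pi \<Longrightarrow> p (t + pi) = - p t"
    and qa: "\<And>t. 0 \<le> t \<Longrightarrow> t \<le> pi \<Longrightarrow> q (t + pi) = - q t"
    and weak: "\<And>m::int. odd m \<Longrightarrow> m * integral {0..2*pi} (\<lambda>t. p t * cis (- real_of_int m * t))
                 = \<mu> * integral {0..2*pi} (\<lambda>t. q t * cis (- real_of_int m * t))"
    and t: "t \<in> {0<..<2*pi}"
  shows "(p has_vector_derivative \<i> * \<mu> * q t) (at t)"
proof -
  let ?I = "{0..2*pi}"
  define Q where "Q = (\<lambda>t. integral {0..t} q)"
  have Qd: "(Q has_vector_derivative q t) (at t within ?I)" if "t \<in> ?I" for t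
    unfolding Q_def by (rule integral_has_vector_derivative[OF q that])
  have Qc: "continuous_on ?I Q"
    by (meson Qd continuous_on_eq_continuous_within has_vector_derivative_continuous)
  have Q0: "Q 0 = 0" by (simp add: Q_def)
  \<comment> \<open>q has mean 0 by antiperiodicity, so its primitive closes up; this removes the
    boundary terms in the integration by parts.\<close>
  have Q2: "Q (2*pi) = 0" unfolding Q_def by (rule integral_antiperiodic_eq_0[OF q qa])
  define u where "u = (\<lambda>t. p t - \<i> * \<mu> * Q t)"
  have uc: "continuous_on ?I u" unfolding u_def by (intro continuous_intros p Qc)
  define c where "c = integral ?I u / (2*pi)"
  have even0: "integral ?I (\<lambda>t. f t * cis (- real_of_int m * t)) = 0"
    if m: "even m" and f: "continuous_on ?I f" and fa: "\<And>t. 0 \<le> t \<Longrightarrow> t \<le> pi \<Longrightarrow> f (t + pi) = - f t" for m :: int and f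
  proof (rule integral_antiperiodic_eq_0)
    show "continuous_on ?I (\<lambda>t. f t * cis (- real_of_int m * t))" by (intro continuous_intros f)
    obtain k where "m = 2 * k" using m by (elim evenE)
    then have "cis (- real_of_int m * (t + pi)) = cis (- real_of_int m * t) * cis (2 * pi * of_int (- k))" for t
      unfolding cis_mult by (simp add: algebra_simps)
    moreover have "cis (2 * pi * of_int (- k)) = 1" by (rule cis_multiple_2pi) simp
    ultimately have "cis (- real_of_int m * (t + pi)) = cis (- real_of_int m * t)" for t
      by (metis mult.right_neutral)
    then show "f (t + pi) * cis (- real_of_int m * (t + pi)) = - (f t * cis (- real_of_int m * t))"
      if "0 \<le> t" "t \<le> pi" for t using fa[OF that] by simp
  qed
  have parts: "integral ?I (\<lambda>t. Q t * cis (- real_of_int m * t)) = integral ?I (\<lambda>t. q t * cis (- real_of_int m * t)) / (\<i> * m)"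
    if m: "m \<noteq> 0" for m :: int
  proof -
    define E where "E = (\<lambda>t. cis (- real_of_int m * t) * (1 / (- \<i> * m)))"
    have "((\<lambda>t. cis (- real_of_int m * t)) has_vector_derivative (- real_of_int m) *\<^sub>R (\<i> * cis (- real_of_int m * t))) (at t)" for t
      unfolding cis.ctr has_vector_derivative_complex_iff
      by (auto intro!: derivative_eq_intros simp: cis.ctr)
    from bounded_linear.has_vector_derivative[OF bounded_linear_mult_left this]
    have "((\<lambda>t. cis (- real_of_int m * t) * (1 / (- \<i> * m))) has_vector_derivative
      (- real_of_int m) *\<^sub>R (\<i> * cis (- real_of_int m * t)) * (1 / (- \<i> * m))) (at t within ?I)" for t
      by (rule has_vector_derivative_at_within)
    then have Ed: "(E has_vector_derivative cis (- real_of_int m * t)) (at t within ?I)" for t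
      unfolding E_def by (rule has_vector_derivative_eq_rhs) (use m in \<open>simp add: scaleR_conv_of_real\<close>)
    have "((\<lambda>t. Q t * E t) has_vector_derivative Q t * cis (- real_of_int m * t) + q t * E t) (at t within ?I)"
      if "t \<in> ?I" for t
      by (rule has_vector_derivative_mult[OF Qd[OF that] Ed])
    from fundamental_theorem_of_calculus[OF _ this]
    have "((\<lambda>t. Q t * cis (- real_of_int m * t) + q t * E t) has_integral Q (2*pi) * E (2*pi) - Q 0 * E 0) ?I"
      by simp
    then have "integral ?I (\<lambda>t. Q t * cis (- real_of_int m * t) + q t * E t) = 0"
      using Q0 Q2 by (simp add: integral_unique)
    moreover have "integral ?I (\<lambda>t. Q t * cis (- real_of_int m * t) + q t * E t) =
       integral ?I (\<lambda>t. Q t * cis (- real_of_int m * t)) + integral ?I (\<lambda>t. q t * E t)"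
      unfolding E_def using m by (intro integral_add integrable_continuous_real continuous_intros Qc q) auto
    moreover have "integral ?I (\<lambda>t. q t * E t) = - integral ?I (\<lambda>t. q t * cis (- real_of_int m * t)) / (\<i> * m)"
    proof -
      have "q t * E t = - (1 / (\<i> * m)) * (q t * cis (- real_of_int m * t))" for t by (simp add: E_def)
      then show ?thesis unfolding integral_mult_right[symmetric] by simp
    qed
    ultimately show ?thesis by (simp add: eq_neg_iff_add_eq_0)
  qed
  have wz: "integral ?I (\<lambda>t. (u t - c) * cis (real_of_int m * t)) = 0" for m
  proof (cases "m = 0")
    case True
    have "integral ?I (\<lambda>t. u t - c) = integral ?I u - integral ?I (\<lambda>t. c)"
      by (intro integral_diff integrable_continuous_real uc continuous_intros)
    then show ?thesis using True by (simp add: c_def scaleR_conv_of_real)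
  next
    case False
    define k where "k = - m"
    have k: "k \<noteq> 0" "real_of_int m = - real_of_int k" using False by (auto simp: k_def)
    have c0: "integral ?I (\<lambda>t. cis (- real_of_int k * t)) = 0"
    proof -
      have "((\<lambda>t. cos (real_of_int m * t)) has_integral 0) ?I" "((\<lambda>t. sin (real_of_int m * t)) has_integral 0) ?I"
        using has_integral_cos_sin_period[OF False] by auto
      from has_integral_add[OF has_integral_linear[OF this(1) bounded_linear_of_real[where 'a = complex]]
          has_integral_mult_right[OF has_integral_linear[OF this(2) bounded_linear_of_real[where 'a = complex]], of \<i>]]
      have "((\<lambda>t. cis (real_of_int m * t)) has_integral 0) ?I"
        by (simp add: o_def cis.ctr Complex_eq)
      then show ?thesis unfolding k(2) by (rule integral_unique)
    qed
    have "integral ?I (\<lambda>t. (u t - c) * cis (- real_of_int k * t)) =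
        integral ?I (\<lambda>t. p t * cis (- real_of_int k * t) - (\<i> * \<mu>) * (Q t * cis (- real_of_int k * t)) - c * cis (- real_of_int k * t))"
      by (simp add: u_def algebra_simps)
    also have "\<dots> = integral ?I (\<lambda>t. p t * cis (- real_of_int k * t)) - \<i> * \<mu> * integral ?I (\<lambda>t. Q t * cis (- real_of_int k * t))
        - c * integral ?I (\<lambda>t. cis (- real_of_int k * t))"
    proof -
      have i: "(\<lambda>t. p t * cis (- real_of_int k * t)) integrable_on ?I"
        "(\<lambda>t. \<i> * \<mu> * (Q t * cis (- real_of_int k * t))) integrable_on ?I"
        "(\<lambda>t. c * cis (- real_of_int k * t)) integrable_on ?I"
        by (intro integrable_continuous_real continuous_intros p Qc)+
      show ?thesis
        unfolding integral_diff[OF integrable_diff[OF i(1,2)] i(3)] integral_diff[OF i(1,2)] integral_mult_right ..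
    qed
    also have "\<dots> = integral ?I (\<lambda>t. p t * cis (- real_of_int k * t)) - \<mu> * integral ?I (\<lambda>t. q t * cis (- real_of_int k * t)) / k"
      unfolding c0 parts[OF k(1)] by simp
    also have "\<dots> = 0"
    proof (cases "even k")
      case True
      show ?thesis using even0[OF True p pa] even0[OF True q qa] by simp
    next
      case False
      then show ?thesis using weak[of k] k(1) by (simp add: field_simps)
    qed
    finally show ?thesis unfolding k(2) .
  qed
  have eq: "p s = c + \<i> * \<mu> * Q s" if "s \<in> ?I" for s
  proof -
    have "u s - c = 0"
    proof (rule Fourier_coefficients_eq_0_imp_eq_0[OF _ _ wz that])
      show "continuous_on ?I (\<lambda>t. u t - c)" by (intro continuous_intros uc)
      have "p (2 * pi) = p 0" using pa[of 0] pa[of pi] by simp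
      then show "u (2*pi) - c = u 0 - c" using Q0 Q2 by (simp add: u_def)
    qed
    then show ?thesis by (simp add: u_def algebra_simps)
  qed
  have "(Q has_vector_derivative q t) (at t)"
    using Qd[of t] t by (simp add: at_within_Icc_at)
  then have "((\<lambda>s. c + \<i> * \<mu> * Q s) has_vector_derivative \<i> * \<mu> * q t) (at t)"
    by (auto intro!: derivative_eq_intros)
  then show ?thesis
    by (rule has_vector_derivative_transform_within_open[where S = "{0<..<2*pi}"]) (use t eq in auto)
qed

text \<open>Differentiate y -> F (s y) once by the chain rule and once by homogeneity. Formulated
  for bare gradients so that it also serves before the pulled-back function is known to be
  differentiable at the origin.\<close>

lemma homogeneous_gradient:
  fixes F :: "'a::euclidean_space \<Rightarrow> real"
  assumes hom: "\<And>s x. s > 0 \<Longrightarrow> F (s *\<^sub>R x) = s\<^sup>2 * F x" and s: "s > 0"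
    and d: "(F has_derivative inner u) (at (s *\<^sub>R x))" "(F has_derivative inner v) (at x)"
  shows "u = s *\<^sub>R v"
proof -
  have "((\<lambda>y. F (s *\<^sub>R y)) has_derivative (\<lambda>h. inner u (s *\<^sub>R h))) (at x)"
    by (rule has_derivative_compose[where f = "\<lambda>y. s *\<^sub>R y" and g = F, OF _ d(1)]) (auto intro!: derivative_eq_intros)
  moreover have "((\<lambda>y. F (s *\<^sub>R y)) has_derivative (\<lambda>h. s\<^sup>2 * inner v h)) (at x)"
    unfolding hom[OF s] by (intro has_derivative_mult_right d(2))
  ultimately have eq: "(\<lambda>h. inner u (s *\<^sub>R h)) = (\<lambda>h. s\<^sup>2 * inner v h)"
    by (rule has_derivative_unique)
  have "inner u h = inner (s *\<^sub>R v) h" for h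
    using fun_cong[OF eq, of h] s by (simp add: power2_eq_square)
  then show ?thesis by (rule vector_eq_rdot[THEN iffD1, OF allI])
qed

lemma periodic_of_int:
  fixes f :: "real \<Rightarrow> 'a" and c :: real
  assumes "\<And>t. f (t + c) = f t"
  shows "f (t + c * of_int j) = f t"
proof -
  have nat: "f (t + c * real k) = f t" for t k
  proof (induction k)
    case (Suc k)
    then show ?case using assms[of "t + c * real k"] by (simp add: algebra_simps)
  qed simp
  show ?thesis
  proof (cases "j \<ge> 0")
    case True
    then show ?thesis using nat[of t "nat j"] by simp
  next
    case False
    then show ?thesis using nat[of "t + c * of_int j" "nat (- j)"] by simp
  qed
qed

lemma inner_cmul_i_self: "inner v (cmul \<i> v) = 0"
  by (simp add: cmul_def inner_prod_def inner_complex_def)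

section \<open>A priori bounds for the Galerkin solutions\<close>

context homogeneous_hamiltonian
begin

lemma gF_scale: "s > 0 \<Longrightarrow> gF (s *\<^sub>R x) = s *\<^sub>R gF x"
  by (rule homogeneous_gradient[where F = F and s = s and x = x]) (assumption | rule F_hom F_deriv)+

lemma gF_minus: "gF (- x) = - gF x"
proof -
  have "((\<lambda>y. F (- y)) has_derivative (\<lambda>h. inner (gF (- x)) (- h))) (at x)"
    by (rule has_derivative_compose[OF _ F_deriv]) (auto intro!: derivative_eq_intros)
  then have "(F has_derivative (\<lambda>h. inner (gF (- x)) (- h))) (at x)" unfolding F_even .
  from has_derivative_unique[OF this F_deriv]
  have g: "inner (gF (- x)) (- h) = inner (gF x) h" for h by (rule fun_cong)
  have "inner (gF (- x)) h = inner (- gF x) h" for h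
    using g[of h] unfolding inner_minus_left inner_minus_right by linarith
  then show ?thesis by (rule vector_eq_rdot[THEN iffD1, OF allI])
qed

lemma gF_bound: "\<exists>C>0. \<forall>x. norm (gF x) \<le> C * norm x"
proof -
  have "bounded (gF ` sphere 0 1)"
    by (intro compact_imp_bounded compact_continuous_image continuous_on_subset[OF gF_cont]) auto
  then obtain C where C: "C > 0" "\<And>x. norm x = 1 \<Longrightarrow> norm (gF x) \<le> C"
    unfolding bounded_pos by auto
  have "norm (gF x) \<le> C * norm x" for x
  proof (cases "x = 0")
    case True
    have "gF 0 = 2 *\<^sub>R gF 0" using gF_scale[of 2 0] by simp
    then have "gF 0 = 0" by (metis add_cancel_right_right scaleR_2)
    then show ?thesis using True by simp
  next
    case False
    then have "gF x = norm x *\<^sub>R gF (x /\<^sub>R norm x)" by (simp flip: gF_scale)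
    then have "norm (gF x) = norm x * norm (gF (x /\<^sub>R norm x))" by (metis norm_scaleR abs_norm_cancel)
    also have "\<dots> \<le> norm x * C" using False by (intro mult_left_mono C) auto
    finally show ?thesis by (simp add: mult.commute)
  qed
  then show ?thesis using C(1) by blast
qed

text \<open>Test the Galerkin equation with - i z' itself: the squared L2 norm of z' is \<mu> times
  the integral of the inner product of grad F(z) and - i z'. The inequality between arithmetic and
  geometric mean lets half of it be absorbed on the left. The resulting bound does not depend on
  \<open>n\<close>.\<close>

lemma galerkin_derivative_bound:
  assumes eq: "\<And>i. i < 8*n \<Longrightarrow> 2 * pi * (real_of_int (freq n i) * a i) =
      \<mu> * integral {0..2*pi} (\<lambda>t. inner (gF (trig_loop n a t)) (mode n i t))"
    and C: "C > 0" "\<And>x. norm (gF x) \<le> C * norm x"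
    and a1: "(sqsum (8*n) a) = 1"
  shows "integral {0..2*pi} (\<lambda>t. (norm (trig_loop n (\<lambda>i. real_of_int (freq n i) * a i) t))\<^sup>2) \<le> (\<mu> * C)\<^sup>2 * (2 * pi)"
proof -
  let ?I = "{0..2*pi}"
  define x where "x = trig_loop n a"
  define y where "y = trig_loop n (\<lambda>i. real_of_int (freq n i) * a i)"
  have xc: "continuous_on ?I x" and yc: "continuous_on ?I y"
    unfolding x_def y_def by (rule continuous_on_trig_loop)+
  have gc: "continuous_on ?I (\<lambda>t. gF (x t))"
    by (rule continuous_on_compose2[OF gF_cont xc]) auto
  have yy: "integral ?I (\<lambda>t. (norm (y t))\<^sup>2) = 2 * pi * (\<Sum>i<8*n. (real_of_int (freq n i) * a i) * (real_of_int (freq n i) * a i))"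
    unfolding y_def power2_norm_eq_inner by (rule integral_unique[OF trig_loop_inner])
  have xx: "integral ?I (\<lambda>t. (norm (x t))\<^sup>2) = 2 * pi"
    unfolding x_def power2_norm_eq_inner using a1 by (simp add: integral_unique[OF trig_loop_inner] power2_eq_square)
  have gy: "integral ?I (\<lambda>t. inner (gF (x t)) (y t)) =
      (\<Sum>i<8*n. (real_of_int (freq n i) * a i) * integral ?I (\<lambda>t. inner (gF (x t)) (mode n i t)))"
  proof -
    have "((\<lambda>t. \<Sum>i<8*n. (real_of_int (freq n i) * a i) * inner (gF (x t)) (mode n i t)) has_integral
      (\<Sum>i<8*n. (real_of_int (freq n i) * a i) * integral ?I (\<lambda>t. inner (gF (x t)) (mode n i t)))) ?I"
      by (intro has_integral_sum has_integral_mult_right integrable_integral integrable_continuous_real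
          continuous_intros gc continuous_on_mode) simp
    then show ?thesis by (simp add: y_def trig_loop_def inner_sum_right integral_unique)
  qed
  have "integral ?I (\<lambda>t. (norm (y t))\<^sup>2) = \<mu> * integral ?I (\<lambda>t. inner (gF (x t)) (y t))"
    unfolding yy gy sum_distrib_left
  proof (intro sum.cong refl)
    fix i assume "i \<in> {..<8*n}"
    then have "2 * pi * (real_of_int (freq n i) * a i) = \<mu> * integral ?I (\<lambda>t. inner (gF (x t)) (mode n i t))"
      using eq x_def by simp
    then show "2 * pi * (real_of_int (freq n i) * a i * (real_of_int (freq n i) * a i)) =
         \<mu> * (real_of_int (freq n i) * a i * integral ?I (\<lambda>t. inner (gF (x t)) (mode n i t)))"
      by (simp add: mult.left_commute[of _ "real_of_int (freq n i) * a i"] flip: mult.assoc)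
  qed
  also have "\<dots> = integral ?I (\<lambda>t. \<mu> * inner (gF (x t)) (y t))" by simp
  also have "\<dots> \<le> integral ?I (\<lambda>t. ((\<mu> * C)\<^sup>2 / 2) * (norm (x t))\<^sup>2 + (1/2) * (norm (y t))\<^sup>2)"
  proof (intro integral_le integrable_continuous_real continuous_intros gc xc yc)
    fix t
    have "\<mu> * inner (gF (x t)) (y t) \<le> \<bar>\<mu>\<bar> * (norm (gF (x t)) * norm (y t))"
      using mult_left_mono[OF Cauchy_Schwarz_ineq2[of "gF (x t)" "y t"], of "\<bar>\<mu>\<bar>"]
        abs_ge_self[of "\<mu> * inner (gF (x t)) (y t)"] by (simp add: abs_mult)
    also have "\<dots> \<le> \<bar>\<mu>\<bar> * ((C * norm (x t)) * norm (y t))"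
      by (intro mult_left_mono mult_right_mono C(2)) auto
    also have "\<dots> = (\<bar>\<mu>\<bar> * C * norm (x t)) * norm (y t)" by simp
    also have "\<dots> \<le> ((\<bar>\<mu>\<bar> * C * norm (x t))\<^sup>2 + (norm (y t))\<^sup>2) / 2"
      using sum_squares_bound[of "\<bar>\<mu>\<bar> * C * norm (x t)" "norm (y t)"] by simp
    finally show "\<mu> * inner (gF (x t)) (y t) \<le> ((\<mu> * C)\<^sup>2 / 2) * (norm (x t))\<^sup>2 + (1/2) * (norm (y t))\<^sup>2"
      by (simp add: power_mult_distrib add_divide_distrib)
  qed
  also have "\<dots> = integral ?I (\<lambda>t. ((\<mu> * C)\<^sup>2 / 2) * (norm (x t))\<^sup>2) + integral ?I (\<lambda>t. (1/2) * (norm (y t))\<^sup>2)"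
    by (intro integral_add integrable_continuous_real continuous_intros xc yc)
  also have "\<dots> = ((\<mu> * C)\<^sup>2 / 2) * (2 * pi) + (1/2) * integral ?I (\<lambda>t. (norm (y t))\<^sup>2)"
    unfolding integral_mult_right xx ..
  finally show ?thesis unfolding y_def by simp
qed

text \<open>An L2 bound on the derivative gives Hoelder continuity. The pointwise inequality |y| <=
  \<eta> |y|^2 + 1 / \<eta> replaces Cauchy-Schwarz for integrals, and letting \<eta> vary still
  yields equicontinuity.\<close>

lemma galerkin_equicontinuous:
  fixes a :: "nat \<Rightarrow> real"
  assumes Y: "integral {0..2*pi} (\<lambda>t. (norm (trig_loop n (\<lambda>i. real_of_int (freq n i) * a i) t))\<^sup>2) \<le> Y"
    and \<eta>: "\<eta> > 0" and st: "0 \<le> s" "s \<le> t" "t \<le> 2*pi"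
  shows "norm (trig_loop n a t - trig_loop n a s) \<le> \<eta> * Y + (t - s) / \<eta>"
proof -
  define y where "y = trig_loop n (\<lambda>i. real_of_int (freq n i) * a i)"
  have yc: "continuous_on S y" for S unfolding y_def by (rule continuous_on_trig_loop)
  have "((\<lambda>t. cmul \<i> (y t)) has_integral trig_loop n a t - trig_loop n a s) {s..t}"
    unfolding y_def
    by (rule fundamental_theorem_of_calculus[OF st(2)])
      (rule has_vector_derivative_at_within[OF trig_loop_has_vector_derivative])
  then have "trig_loop n a t - trig_loop n a s = integral {s..t} (\<lambda>t. cmul \<i> (y t))"
    by (simp add: integral_unique)
  also have "norm \<dots> \<le> integral {s..t} (\<lambda>t. \<eta> * (norm (y t))\<^sup>2 + 1 / \<eta>)"
  proof (intro integral_norm_bound_integral integrable_continuous_real continuous_intros yc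
      continuous_on_compose2[OF linear_continuous_on[OF bounded_linear_cmul]])
    fix r
    have "0 \<le> (\<eta> * norm (y r) - 1)\<^sup>2" by simp
    then have "2 * (\<eta> * norm (y r)) \<le> (\<eta> * norm (y r))\<^sup>2 + 1" by (simp add: power2_diff)
    then have "\<eta> * norm (y r) \<le> (\<eta> * norm (y r))\<^sup>2 + 1" using mult_nonneg_nonneg[OF less_imp_le[OF \<eta>] norm_ge_zero[of "y r"]] by linarith
    then show "norm (cmul \<i> (y r)) \<le> \<eta> * (norm (y r))\<^sup>2 + 1 / \<eta>"
      using \<eta> by (simp add: norm_cmul field_simps power2_eq_square)
  qed auto
  also have "\<dots> = integral {s..t} (\<lambda>t. \<eta> * (norm (y t))\<^sup>2) + integral {s..t} (\<lambda>t. 1 / \<eta>)"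
    by (intro integral_add integrable_continuous_real continuous_intros yc)
  also have "integral {s..t} (\<lambda>t. 1 / \<eta>) = (t - s) / \<eta>" using st by simp
  also have "integral {s..t} (\<lambda>t. \<eta> * (norm (y t))\<^sup>2) \<le> integral {0..2*pi} (\<lambda>t. \<eta> * (norm (y t))\<^sup>2)"
    using st \<eta> by (intro integral_subset_le integrable_continuous_real continuous_intros yc) auto
  also have "\<dots> = \<eta> * integral {0..2*pi} (\<lambda>t. (norm (y t))\<^sup>2)" by simp
  also have "\<dots> \<le> \<eta> * Y" using Y \<eta> unfolding y_def by (intro mult_left_mono) auto
  finally show ?thesis by simp
qed

end

section \<open>Compactness and passage to the limit equation\<close>

context homogeneous_hamiltonian
begin

text \<open>Arzela-Ascoli on one period, extended to the line by periodicity. \<open>Suc\<close>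
  appears because \<open>galerkin\<close> needs at least one mode of each sign. The limit multiplier
  might still be 0 here; its positivity can only be read off from the limit equation.\<close>

lemma galerkin_limit:
  obtains x :: "real \<Rightarrow> c2" and \<mu> r a mu where
    "strict_mono (r :: nat \<Rightarrow> nat)" "0 \<le> \<mu>" "\<mu> \<le> R / 2" "mu \<longlonglongrightarrow> \<mu>"
    "\<And>t. (\<lambda>k. trig_loop (Suc (r k)) (a k) t) \<longlonglongrightarrow> x t"
    "continuous_on {0..2*pi} x"
    "\<And>k. (\<Sum>i<8*Suc (r k). (a k i)\<^sup>2) = 1"
    "\<And>k i. i < 8 * Suc (r k) \<Longrightarrow> 2 * pi * (real_of_int (freq (Suc (r k)) i) * a k i) =
       mu k * integral {0..2*pi} (\<lambda>t. inner (gF (trig_loop (Suc (r k)) (a k) t)) (mode (Suc (r k)) i t))"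
    "\<exists>M. \<forall>k. \<forall>t\<in>{0..2*pi}. norm (trig_loop (Suc (r k)) (a k) t) \<le> M"
proof -
  let ?I = "{0..2*pi}"
  define P where "P n a \<mu> \<longleftrightarrow> (\<Sum>i<8*Suc n. (a i)\<^sup>2) = 1 \<and> 0 < \<mu> \<and> \<mu> \<le> R / 2 \<and>
    (\<forall>i<8*Suc n. 2 * pi * (real_of_int (freq (Suc n) i) * a i) =
       \<mu> * integral ?I (\<lambda>t. inner (gF (trig_loop (Suc n) a t)) (mode (Suc n) i t)))" for n a \<mu>
  have "\<forall>n. \<exists>a \<mu>. P n a \<mu>" unfolding P_def by (rule allI, rule galerkin, simp)
  then obtain A m where "\<And>n. P n (A n) (m n)" by metis
  then have A1: "\<And>n. (\<Sum>i<8*Suc n. (A n i)\<^sup>2) = 1" and m: "\<And>n. 0 < m n" "\<And>n. m n \<le> R / 2"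
    and eq: "\<And>n i. i < 8*Suc n \<Longrightarrow> 2 * pi * (real_of_int (freq (Suc n) i) * A n i) =
       m n * integral ?I (\<lambda>t. inner (gF (trig_loop (Suc n) (A n) t)) (mode (Suc n) i t))"
    unfolding P_def by blast+
  obtain C where C: "C > 0" "\<And>x. norm (gF x) \<le> C * norm x" using gF_bound by auto
  define Y where "Y = (R / 2 * C)\<^sup>2 * (2 * pi)"
  have Y0: "Y \<ge> 0" by (simp add: Y_def)
  have Y: "integral ?I (\<lambda>t. (norm (trig_loop (Suc n) (\<lambda>i. real_of_int (freq (Suc n) i) * A n i) t))\<^sup>2) \<le> Y" for n
  proof -
    have "(m n * C)\<^sup>2 \<le> (R / 2 * C)\<^sup>2" using m[of n] C by (intro power_mono mult_right_mono) auto
    then show ?thesis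
      using galerkin_derivative_bound[OF eq C A1, of n] by (simp add: Y_def) (smt (verit, best) mult_right_mono pi_ge_zero)
  qed
  define X where "X = (\<lambda>n. trig_loop (Suc n) (A n))"
  have mod1: "norm (X n t - X n s) \<le> \<eta> * Y + \<bar>t - s\<bar> / \<eta>"
    if "\<eta> > 0" "s \<in> ?I" "t \<in> ?I" for n s t \<eta>
  proof (cases "s \<le> t")
    case True
    then show ?thesis using galerkin_equicontinuous[OF Y that(1), of s t n] that by (simp add: X_def)
  next
    case False
    then show ?thesis using galerkin_equicontinuous[OF Y that(1), of t s n] that
      by (simp add: X_def norm_minus_commute abs_if)
  qed
  have Xa: "X n (t + pi) = - X n t" for n t by (simp add: X_def trig_loop_antiperiodic)
  define M where "M = Y + 2 * pi"
  have bound: "norm (X n t) \<le> M" if t: "t \<in> ?I" for n t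
  proof -
    \<comment> \<open>Antiperiodicity bounds the size by the oscillation: the value - X n t is also
      taken in the interval, so twice the norm of X n t is the norm of a difference of two
      values.\<close>
    obtain s where s: "s \<in> ?I" "X n s = - X n t"
    proof (cases "t \<le> pi")
      case True then show ?thesis using t Xa[of n t] by (intro that[of "t + pi"]) auto
    next
      case False then show ?thesis using t Xa[of n "t - pi"] by (intro that[of "t - pi"]) auto
    qed
    have "X n t - X n s = 2 *\<^sub>R X n t" using s(2) by (simp add: scaleR_2)
    then have "2 * norm (X n t) = norm (X n t - X n s)" by simp
    also have "\<dots> \<le> 1 * Y + \<bar>t - s\<bar> / 1" by (rule mod1) (use s t in auto)
    also have "\<dots> \<le> M" using s t by (auto simp: M_def abs_if)
    finally show ?thesis using norm_ge_zero[of "X n t"] by linarith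
  qed
  have equi: "\<exists>d>0. \<forall>n s. s \<in> ?I \<and> norm (t - s) < d \<longrightarrow> norm (X n t - X n s) < e"
    if t: "t \<in> ?I" and e: "e > 0" for t e
  proof -
    define \<eta> where "\<eta> = e / (2 * (Y + 1))"
    have \<eta>: "\<eta> > 0" using e Y0 by (simp add: \<eta>_def)
    have "\<eta> * Y \<le> \<eta> * (Y + 1)" using \<eta> by (intro mult_left_mono) auto
    also have "\<dots> = e / 2" using Y0 unfolding \<eta>_def by (simp add: divide_simps)
    finally have 1: "\<eta> * Y \<le> e / 2" .
    show ?thesis
    proof (intro exI[of _ "\<eta> * (e / 2)"] conjI allI impI)
      show "\<eta> * (e / 2) > 0" using \<eta> e by simp
      fix n s assume s: "s \<in> ?I \<and> norm (t - s) < \<eta> * (e / 2)"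
      then have "\<bar>t - s\<bar> / \<eta> < e / 2" using \<eta> by (simp add: pos_divide_less_eq mult.commute)
      then show "norm (X n t - X n s) < e" using mod1[OF \<eta>, of s t n] s t 1 by linarith
    qed
  qed
  obtain g k where g: "continuous_on ?I g" and k: "strict_mono (k :: nat \<Rightarrow> nat)"
    and lim: "\<And>e. 0 < e \<Longrightarrow> \<exists>N. \<forall>n x. n \<ge> N \<and> x \<in> ?I \<longrightarrow> norm (X (k n) x - g x) < e"
    using Arzela_Ascoli[of ?I X M, OF compact_Icc bound equi] by blast
  \<comment> \<open>A second subsequence makes the multipliers converge as well.\<close>
  have "compact {0..R/2}" by simp
  then obtain \<mu> l where \<mu>: "\<mu> \<in> {0..R/2}" and l: "strict_mono (l :: nat \<Rightarrow> nat)" and mlim: "((m \<circ> k) \<circ> l) \<longlonglongrightarrow> \<mu>"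
    unfolding compact_def using m by (metis (no_types, lifting) atLeastAtMost_iff comp_apply less_imp_le)
  define r where "r = k \<circ> l"
  have r: "strict_mono r" unfolding r_def by (rule strict_mono_o[OF k l])
  have Xlim: "(\<lambda>n. X (r n) t) \<longlonglongrightarrow> g t" if "t \<in> ?I" for t
  proof -
    have "(\<lambda>n. X (k n) t) \<longlonglongrightarrow> g t"
      using lim that by (intro LIMSEQ_I) blast
    from LIMSEQ_subseq_LIMSEQ[OF this l] show ?thesis by (simp add: o_def r_def)
  qed
  have per: "X n (t + 2 * pi) = X n t" for n t
    using Xa[of n "t + pi"] Xa[of n t] by (simp add: add.assoc)
  note perz = periodic_of_int[of "X _", OF per]
  define red where "red t = t - 2 * pi * of_int \<lfloor>t / (2*pi)\<rfloor>" for t :: real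
  have red: "red t \<in> ?I" for t
  proof -
    have p: "(2 * pi) > 0" by simp
    have "of_int \<lfloor>t / (2*pi)\<rfloor> \<le> t / (2*pi)" "t / (2*pi) \<le> of_int \<lfloor>t / (2*pi)\<rfloor> + 1" by linarith+
    then have "of_int \<lfloor>t / (2*pi)\<rfloor> * (2*pi) \<le> t" "t \<le> (of_int \<lfloor>t / (2*pi)\<rfloor> + 1) * (2*pi)"
      using pos_le_divide_eq[OF p] pos_divide_le_eq[OF p] by blast+
    then show ?thesis by (simp add: red_def algebra_simps)
  qed
  have Xred: "X n (red t) = X n t" for n t
    using perz[of n "red t" "\<lfloor>t / (2*pi)\<rfloor>"] by (simp add: red_def)
  \<comment> \<open>On the closed period the limit is \<open>g\<close> itself, including the right
    end point, which \<open>red\<close> would send to 0; continuity there is then inherited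
    directly.\<close>
  define x where "x t = (if t \<in> ?I then g t else g (red t))" for t
  have xlim: "(\<lambda>n. X (r n) t) \<longlonglongrightarrow> x t" for t
    using Xlim[of t] Xlim[OF red[of t]] by (auto simp: x_def Xred)
  show ?thesis
  proof (rule that[of r \<mu> "m \<circ> r" "A \<circ> r" x])
    show "strict_mono r" by fact
    show "0 \<le> \<mu>" "\<mu> \<le> R / 2" using \<mu> by auto
    show "(m \<circ> r) \<longlonglongrightarrow> \<mu>" using mlim by (simp add: r_def o_assoc)
    show "(\<lambda>k. trig_loop (Suc (r k)) ((A \<circ> r) k) t) \<longlonglongrightarrow> x t" for t
      using xlim[of t] by (simp add: X_def)
    show "continuous_on ?I x" using g by (rule continuous_on_eq) (simp add: x_def)
    show "(\<Sum>i<8*Suc (r k). ((A \<circ> r) k i)\<^sup>2) = 1" for k using A1[of "r k"] by simp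
    show "2 * pi * (real_of_int (freq (Suc (r k)) i) * (A \<circ> r) k i) =
       (m \<circ> r) k * integral ?I (\<lambda>t. inner (gF (trig_loop (Suc (r k)) ((A \<circ> r) k) t)) (mode (Suc (r k)) i t))"
      if "i < 8 * Suc (r k)" for k i using eq[OF that] by simp
    show "\<exists>M. \<forall>k. \<forall>t\<in>?I. norm (trig_loop (Suc (r k)) ((A \<circ> r) k) t) \<le> M"
      using bound unfolding X_def o_def by blast
  qed
qed

text \<open>Allows one fixed test function to be kept while the approximations grow. The index
  depends on \<open>n\<close> because the positive frequencies start at
  \<open>4 * n\<close>.\<close>

lemma freq_surj:
  assumes "odd m" "j < 4"
  obtains i where "\<And>n. \<bar>m\<bar> \<le> int n \<Longrightarrow> i n < 8 * n \<and> freq n (i n) = m \<and> i n mod 4 = j"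
proof -
  define i where "i n = (if m < 0 then 4 * nat ((- m - 1) div 2) + j else 4 * n + 4 * nat ((m - 1) div 2) + j)" for n
  have "i n < 8 * n \<and> freq n (i n) = m \<and> i n mod 4 = j" if n: "\<bar>m\<bar> \<le> int n" for n
  proof -
    obtain k where k: "m = 2 * k + 1" using assms(1) by (elim oddE)
    show ?thesis
    proof (cases "m < 0")
      case True
      then have i: "i n = 4 * nat (- k - 1) + j" using k by (simp add: i_def)
      have "i n < 4 * n" "(4 * nat (- k - 1) + j) div 4 = nat (- k - 1)" using i k n True assms(2) by auto
      then show ?thesis using i k True assms(2) by (simp add: freq_def)
    next
      case False
      then have i: "i n = 4 * n + (4 * nat k + j)" using k by (simp add: i_def)
      have "(4 * nat k + j) div 4 = nat k" "i n < 8 * n" using i k n False assms(2) by auto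
      moreover have "i n - 4 * n = 4 * nat k + j" "(4 * n + (4 * nat k + j)) mod 4 = j"
        using i assms(2) by (simp_all add: mod_add_eq[symmetric])
      ultimately show ?thesis using i k False by (simp add: freq_def)
    qed
  qed
  then show ?thesis using that by blast
qed

text \<open>Against each fixed mode the equations pass to the limit by dominated convergence, which
  gives the equation weakly and then, by uniqueness of Fourier coefficients, classically. The L2
  norm keeps the limit nontrivial, and homogeneity brings it to the level 1.\<close>

theorem periodic_orbit:
  obtains z :: "real \<Rightarrow> c2" and \<mu> where "0 < \<mu>" "\<mu> \<le> R / 2" "\<And>t. z (t + pi) = - z t" "\<And>t. F (z t) = 1"
    "\<And>t. (z has_vector_derivative \<mu> *\<^sub>R cmul \<i> (gF (z t))) (at t)"
proof -
  let ?I = "{0..2*pi}"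
  obtain x :: "real \<Rightarrow> c2" and \<mu> r a mu where
    r: "strict_mono (r :: nat \<Rightarrow> nat)" and \<mu>: "0 \<le> \<mu>" "\<mu> \<le> R / 2" and mu: "mu \<longlonglongrightarrow> \<mu>"
    and lim: "\<And>t. (\<lambda>k. trig_loop (Suc (r k)) (a k) t) \<longlonglongrightarrow> x t"
    and xc: "continuous_on ?I x"
    and a1: "\<And>k. (\<Sum>i<8*Suc (r k). (a k i)\<^sup>2) = 1"
    and eq: "\<And>k i. i < 8 * Suc (r k) \<Longrightarrow> 2 * pi * (real_of_int (freq (Suc (r k)) i) * a k i) =
       mu k * integral ?I (\<lambda>t. inner (gF (trig_loop (Suc (r k)) (a k) t)) (mode (Suc (r k)) i t))"
    and bd: "\<exists>M. \<forall>k. \<forall>t\<in>?I. norm (trig_loop (Suc (r k)) (a k) t) \<le> M"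
    by (rule galerkin_limit) (rule that, assumption+)
  define X where "X k = trig_loop (Suc (r k)) (a k)" for k
  have Xlim: "(\<lambda>k. X k t) \<longlonglongrightarrow> x t" for t using lim by (simp add: X_def)
  have Xc: "continuous_on S (X k)" for S k unfolding X_def by (rule continuous_on_trig_loop)
  obtain M where M: "\<And>k t. t \<in> ?I \<Longrightarrow> norm (X k t) \<le> M" using bd unfolding X_def by blast
  obtain C where C: "C > 0" "\<And>x. norm (gF x) \<le> C * norm x" using gF_bound by auto
  have Mg: "norm (gF (X k t)) \<le> C * M" if "t \<in> ?I" for k t
    using C(2)[of "X k t"] mult_left_mono[OF M[OF that], of C k] C(1) by linarith
  have gXc: "continuous_on S (\<lambda>t. gF (X k t))" for S k
    by (rule continuous_on_compose2[OF gF_cont Xc]) auto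
  have gXlim: "(\<lambda>k. gF (X k t)) \<longlonglongrightarrow> gF (x t)" for t
    by (rule continuous_on_tendsto_compose[OF gF_cont Xlim]) auto
  have xa: "x (t + pi) = - x t" for t
  proof (rule LIMSEQ_unique[OF Xlim])
    show "(\<lambda>k. X k (t + pi)) \<longlonglongrightarrow> - x t"
      using tendsto_minus[OF Xlim[of t]] by (simp add: X_def trig_loop_antiperiodic)
  qed
  have gxc: "continuous_on ?I (\<lambda>t. gF (x t))"
    by (rule continuous_on_compose2[OF gF_cont xc]) auto
  \<comment> \<open>The L2 norm survives the limit, which excludes the zero loop.\<close>
  have L2: "integral ?I (\<lambda>t. (norm (x t))\<^sup>2) = 2 * pi"
  proof (rule LIMSEQ_unique)
    show "(\<lambda>k. integral ?I (\<lambda>t. (norm (X k t))\<^sup>2)) \<longlonglongrightarrow> integral ?I (\<lambda>t. (norm (x t))\<^sup>2)"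
    proof (rule dominated_convergence(2)[where h = "\<lambda>_. M\<^sup>2"])
      show "(\<lambda>t. (norm (X k t))\<^sup>2) integrable_on ?I" for k
        by (intro integrable_continuous_real continuous_intros Xc)
      show "norm ((norm (X k t))\<^sup>2) \<le> M\<^sup>2" if "t \<in> ?I" for k t
        using M[OF that, of k] by (simp add: power_mono)
      show "(\<lambda>k. (norm (X k t))\<^sup>2) \<longlonglongrightarrow> (norm (x t))\<^sup>2" for t by (intro tendsto_intros Xlim)
    qed (rule integrable_const_ivl)
    show "(\<lambda>k. integral ?I (\<lambda>t. (norm (X k t))\<^sup>2)) \<longlonglongrightarrow> 2 * pi"
    proof -
      have "integral ?I (\<lambda>t. (norm (X k t))\<^sup>2) = 2 * pi" for k
        unfolding X_def power2_norm_eq_inner integral_unique[OF trig_loop_inner]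
        using a1[of k] by (simp add: power2_eq_square)
      then show ?thesis by simp
    qed
  qed
  have weak_inner: "m * integral ?I (\<lambda>t. inner (x t) (cmul (cis (real_of_int m * t)) (c2_basis j))) =
      \<mu> * integral ?I (\<lambda>t. inner (gF (x t)) (cmul (cis (real_of_int m * t)) (c2_basis j)))"
    if m: "odd m" and j: "j < 4" for m :: int and j
  proof -
    let ?E = "\<lambda>t. cmul (cis (real_of_int m * t)) (c2_basis j)"
    have Ec: "continuous_on ?I ?E" unfolding cmul_def by (intro continuous_intros)
    have nE: "norm (?E t) = 1" for t by (simp add: norm_cmul norm_c2_basis)
    obtain i where i: "\<And>n. \<bar>m\<bar> \<le> int n \<Longrightarrow> i n < 8 * n \<and> freq n (i n) = m \<and> i n mod 4 = j"
      using freq_surj[OF m j] by metis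
    \<comment> \<open>The equation for this mode holds exactly, not only asymptotically, once the
      mode belongs to the approximation; \<open>k \<le> r k\<close> ensures this.\<close>
    have ev: "m * integral ?I (\<lambda>t. inner (X k t) (?E t)) = mu k * integral ?I (\<lambda>t. inner (gF (X k t)) (?E t))"
      if k: "\<bar>m\<bar> \<le> int k" for k
    proof -
      define n where "n = Suc (r k)"
      have "k \<le> r k" using r by (simp add: seq_suble)
      then have n: "\<bar>m\<bar> \<le> int n" using k by (simp add: n_def)
      note i = i[OF n]
      have mode: "mode n (i n) t = ?E t" for t using i by (simp add: mode_def)
      have single: "trig_loop n (\<lambda>l. if l = i n then 1 else 0) t = ?E t" for t
        using i mode by (simp add: trig_loop_def if_distrib[of "\<lambda>c. c *\<^sub>R _"] cong: if_cong)
      have "integral ?I (\<lambda>t. inner (X k t) (?E t)) = 2 * pi * (\<Sum>l<8*n. a k l * (if l = i n then 1 else 0))"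
        using integral_unique[OF trig_loop_inner[of n "a k" "\<lambda>l. if l = i n then 1 else 0"]]
        unfolding single by (simp add: X_def n_def)
      also have "\<dots> = 2 * pi * a k (i n)" using i by (simp add: if_distrib[of "\<lambda>c. _ * c"] cong: if_cong)
      finally show ?thesis
        using eq[of "i n" k] i mode unfolding n_def[symmetric] by (simp add: X_def n_def[symmetric] mult_ac)
    qed
    have l1: "(\<lambda>k. integral ?I (\<lambda>t. inner (X k t) (?E t))) \<longlonglongrightarrow> integral ?I (\<lambda>t. inner (x t) (?E t))"
    proof (rule dominated_convergence(2)[where h = "\<lambda>_. M"])
      show "(\<lambda>t. inner (X k t) (?E t)) integrable_on ?I" for k
        by (intro integrable_continuous_real continuous_intros Xc Ec)
      show "norm (inner (X k t) (?E t)) \<le> M" if "t \<in> ?I" for k t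
        using M[OF that, of k] Cauchy_Schwarz_ineq2[of "X k t" "?E t"] nE[of t] by simp
      show "(\<lambda>k. inner (X k t) (?E t)) \<longlonglongrightarrow> inner (x t) (?E t)" for t by (intro tendsto_intros Xlim)
    qed (rule integrable_const_ivl)
    have l2: "(\<lambda>k. integral ?I (\<lambda>t. inner (gF (X k t)) (?E t))) \<longlonglongrightarrow> integral ?I (\<lambda>t. inner (gF (x t)) (?E t))"
    proof (rule dominated_convergence(2)[where h = "\<lambda>_. C * M"])
      show "(\<lambda>t. inner (gF (X k t)) (?E t)) integrable_on ?I" for k
        by (intro integrable_continuous_real continuous_intros gXc Ec)
      show "norm (inner (gF (X k t)) (?E t)) \<le> C * M" if "t \<in> ?I" for k t
        using Mg[OF that, of k] Cauchy_Schwarz_ineq2[of "gF (X k t)" "?E t"] nE[of t] by simp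
      show "(\<lambda>k. inner (gF (X k t)) (?E t)) \<longlonglongrightarrow> inner (gF (x t)) (?E t)" for t by (intro tendsto_intros gXlim)
    qed (rule integrable_const_ivl)
    have r1: "(\<lambda>k. m * integral ?I (\<lambda>t. inner (X k t) (?E t))) \<longlonglongrightarrow> m * integral ?I (\<lambda>t. inner (x t) (?E t))"
      by (intro tendsto_intros l1)
    have r2: "(\<lambda>k. mu k * integral ?I (\<lambda>t. inner (gF (X k t)) (?E t))) \<longlonglongrightarrow> \<mu> * integral ?I (\<lambda>t. inner (gF (x t)) (?E t))"
      by (intro tendsto_intros l2 mu)
    have "\<forall>\<^sub>F k in sequentially. mu k * integral ?I (\<lambda>t. inner (gF (X k t)) (?E t)) = m * integral ?I (\<lambda>t. inner (X k t) (?E t))"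
      unfolding eventually_sequentially using ev by (intro exI[of _ "nat \<bar>m\<bar>"]) auto
    from Lim_transform_eventually[OF r2 this] show ?thesis by (rule LIMSEQ_unique[OF r1])
  qed
  \<comment> \<open>\<open>P\<close> stands for one complex component of C^2; the directions
    \<open>j\<close> and \<open>j'\<close> test its real and its imaginary part.\<close>
  have weak: "m * integral ?I (\<lambda>t. P (x t) * cis (- real_of_int m * t))
            = \<mu> * integral ?I (\<lambda>t. P (gF (x t)) * cis (- real_of_int m * t))"
    if m: "odd m" and P: "bounded_linear P" and j: "j < 4" "j' < 4"
      and Pj: "\<And>v c. inner v (cmul c (c2_basis j)) = Re (P v * cnj c)"
      and Pj': "\<And>v c. inner v (cmul c (c2_basis j')) = Im (P v * cnj c)" for m :: int and j j' and P :: "c2 \<Rightarrow> complex"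
  proof -
    have i: "(\<lambda>t. P (f t) * cis (- real_of_int m * t)) integrable_on ?I" if "continuous_on ?I f" for f
      by (intro integrable_continuous_real continuous_intros continuous_on_compose2[OF linear_continuous_on[OF P] that]) auto
    have c: "cis (- real_of_int m * t) = cnj (cis (real_of_int m * t))" for t by (simp add: cis_cnj)
    have re: "Re (integral ?I (\<lambda>t. P (f t) * cis (- real_of_int m * t))) =
        integral ?I (\<lambda>t. inner (f t) (cmul (cis (real_of_int m * t)) (c2_basis j)))" if "continuous_on ?I f" for f
      using integral_linear[OF i[OF that] bounded_linear_Re] unfolding c o_def Pj ..
    have im: "Im (integral ?I (\<lambda>t. P (f t) * cis (- real_of_int m * t))) =
        integral ?I (\<lambda>t. inner (f t) (cmul (cis (real_of_int m * t)) (c2_basis j')))" if "continuous_on ?I f" for f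
      using integral_linear[OF i[OF that] bounded_linear_Im] unfolding c o_def Pj' ..
    show ?thesis
      using weak_inner[OF m j(1), folded re[OF xc] re[OF gxc]] weak_inner[OF m j(2), folded im[OF xc] im[OF gxc]]
      by (simp add: complex_eq_iff)
  qed
  have comp: "((\<lambda>t. P (x t)) has_vector_derivative \<i> * \<mu> * P (gF (x t))) (at t)"
    if t: "t \<in> {0<..<2*pi}" and P: "bounded_linear P" and j: "j < 4" "j' < 4"
      and Pj: "\<And>v c. inner v (cmul c (c2_basis j)) = Re (P v * cnj c)"
      and Pj': "\<And>v c. inner v (cmul c (c2_basis j')) = Im (P v * cnj c)" for t j j' and P :: "c2 \<Rightarrow> complex"
  proof (rule weak_derivative_imp_derivative[OF _ _ _ _ _ t])
    interpret P: bounded_linear P by fact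
    show "continuous_on ?I (\<lambda>t. P (x t))" "continuous_on ?I (\<lambda>t. P (gF (x t)))"
      by (intro continuous_intros continuous_on_compose2[OF linear_continuous_on[OF P]] xc gxc; auto)+
    show "P (x (t + pi)) = - P (x t)" "P (gF (x (t + pi))) = - P (gF (x t))" for t
      by (simp_all add: xa gF_minus P.neg)
    show "m * integral ?I (\<lambda>t. P (x t) * cis (- real_of_int m * t)) =
        \<mu> * integral ?I (\<lambda>t. P (gF (x t)) * cis (- real_of_int m * t))" if "odd m" for m
      by (rule weak[OF that P j Pj Pj'])
  qed
  define D where "D t \<longleftrightarrow> (x has_vector_derivative \<mu> *\<^sub>R cmul \<i> (gF (x t))) (at t)" for t
  have D0: "D t" if t: "t \<in> {0<..<2*pi}" for t
  proof -
    have "((\<lambda>t. fst (x t)) has_vector_derivative \<i> * \<mu> * fst (gF (x t))) (at t)"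
      by (rule comp[OF t bounded_linear_fst, of 0 1]) (auto simp: c2_basis_def cmul_def inner_prod_def inner_complex_def)
    moreover have "((\<lambda>t. snd (x t)) has_vector_derivative \<i> * \<mu> * snd (gF (x t))) (at t)"
      by (rule comp[OF t bounded_linear_snd, of 2 3]) (auto simp: c2_basis_def cmul_def inner_prod_def inner_complex_def)
    ultimately have "((\<lambda>t. (fst (x t), snd (x t))) has_vector_derivative (\<i> * \<mu> * fst (gF (x t)), \<i> * \<mu> * snd (gF (x t)))) (at t)"
      by (rule has_vector_derivative_Pair)
    then show ?thesis by (simp add: D_def cmul_def scaleR_prod_def scaleR_conv_of_real mult_ac)
  qed
  interpret ci: bounded_linear "cmul \<i>" by (rule bounded_linear_cmul)
  have Dshift: "D (t + c)" if "D t" and c: "\<And>s. x (s + c) = - x s" for t c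
  proof -
    have "(x has_vector_derivative \<mu> *\<^sub>R cmul \<i> (gF (x t))) (at (t + c - c))" using that by (simp add: D_def)
    moreover have "((\<lambda>s. s - c) has_vector_derivative 1) (at (t + c))" by (auto intro!: derivative_eq_intros)
    ultimately have "((\<lambda>s. x (s - c)) has_vector_derivative 1 *\<^sub>R (\<mu> *\<^sub>R cmul \<i> (gF (x t)))) (at (t + c))"
      using vector_diff_chain_at[of "\<lambda>s. s - c" 1 "t + c" x] by (simp add: o_def)
    from has_vector_derivative_minus[OF this]
    have "((\<lambda>s. - x (s - c)) has_vector_derivative \<mu> *\<^sub>R cmul \<i> (gF (x (t + c)))) (at (t + c))"
      by (simp add: c gF_minus ci.neg)
    moreover have "- x (s - c) = x s" for s using c[of "s - c"] by simp
    ultimately show ?thesis by (simp add: D_def)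
  qed
  have xa': "x (s + (- pi)) = - x s" for s using xa[of "s - pi"] by simp
  have Dk: "D (t + of_int k * pi)" if "t \<in> {0<..<2*pi}" for t k
  proof (induction k rule: int_induct[where k = 0])
    case base then show ?case using D0[OF that] by simp
  next
    case (step1 i) then show ?case using Dshift[OF step1(2), of pi] xa by (simp add: algebra_simps)
  next
    case (step2 i) then show ?case using Dshift[OF step2(2), of "- pi"] xa' by (simp add: algebra_simps)
  qed
  \<comment> \<open>So far the equation holds on translates of (0, 2 pi) by multiples of pi. These
    overlap and cover the line: k is chosen so that t - k pi lies in [pi, 2 pi).\<close>
  have Dall: "D t" for t
  proof -
    define k where "k = \<lfloor>t / pi\<rfloor> - 1"
    have "of_int \<lfloor>t / pi\<rfloor> \<le> t / pi" "t / pi < of_int \<lfloor>t / pi\<rfloor> + 1" by linarith+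
    then have "of_int \<lfloor>t / pi\<rfloor> * pi \<le> t" "t < (of_int \<lfloor>t / pi\<rfloor> + 1) * pi"
      using pos_le_divide_eq[OF pi_gt_zero] pos_divide_less_eq[OF pi_gt_zero] by blast+
    then have "t - of_int k * pi \<in> {0<..<2*pi}" using pi_gt_zero by (simp add: k_def algebra_simps)
    from Dk[OF this, of k] show ?thesis by simp
  qed
  \<comment> \<open>Conservation of energy: i grad F is orthogonal to grad F.\<close>
  have Fconst: "F (x t) = F (x 0)" for t
  proof -
    have "((\<lambda>t. F (x t)) has_real_derivative 0) (at t)" for t
    proof -
      have "((\<lambda>t. F (x t)) has_derivative (\<lambda>h. inner (gF (x t)) (h *\<^sub>R (\<mu> *\<^sub>R cmul \<i> (gF (x t)))))) (at t)"
        by (rule has_derivative_compose[OF Dall[of t, unfolded D_def has_vector_derivative_def] F_deriv])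
      moreover have "(\<lambda>h. inner (gF (x t)) (h *\<^sub>R (\<mu> *\<^sub>R cmul \<i> (gF (x t))))) = (*) 0"
        by (auto simp: inner_cmul_i_self)
      ultimately show ?thesis by (simp only: has_field_derivative_def)
    qed
    then show ?thesis by (intro DERIV_isconst_all) blast
  qed
  define f where "f = F (x 0)"
  have f: "f > 0"
  proof -
    have "integral ?I (\<lambda>t. (norm (x t))\<^sup>2) \<le> integral ?I (\<lambda>t. R * f)"
      using F_lower[of "x _"] Fconst
      by (intro integral_le integrable_continuous_real continuous_intros xc) (metis f_def)
    then have "2 * pi * 1 \<le> 2 * pi * (R * f)" unfolding L2 by simp
    then have "R * f > 0" by simp
    then show ?thesis using R_pos by (simp add: zero_less_mult_iff)
  qed
  \<comment> \<open>For \<mu> = 0 the loop would be constant and antiperiodic, hence 0, where F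
    vanishes by homogeneity, against f > 0.\<close>
  have \<mu>pos: "\<mu> > 0"
  proof (rule ccontr)
    assume "\<not> \<mu> > 0"
    then have "\<mu> = 0" using \<mu> by simp
    then have d0: "(x has_derivative (\<lambda>h. 0)) (at t within UNIV)" for t
      using Dall[of t] by (simp add: D_def has_vector_derivative_def)
    have "x pi = x 0"
      by (rule has_derivative_zero_unique_connected[of UNIV x]) (use d0 in auto)
    then have "2 *\<^sub>R x 0 = 0" using xa[of 0] unfolding scaleR_2 by (simp add: eq_neg_iff_add_eq_0)
    then have "x 0 = 0" by simp
    then have "f = F (2 *\<^sub>R 0)" by (simp add: f_def)
    also have "\<dots> = 4 * F 0" by (subst F_hom) auto
    also have "\<dots> = 4 * f" using \<open>x 0 = 0\<close> by (simp add: f_def)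
    finally show False using f by simp
  qed
  \<comment> \<open>Both sides of the equation are 1-homogeneous in the loop, so rescaling to the
    level 1 does not change \<mu>.\<close>
  define s where "s = 1 / sqrt f"
  have s: "s > 0" "s\<^sup>2 * f = 1" using f by (auto simp: s_def power_divide)
  show ?thesis
  proof (rule that[of \<mu> "\<lambda>t. s *\<^sub>R x t"])
    show "((\<lambda>t. s *\<^sub>R x t) has_vector_derivative \<mu> *\<^sub>R cmul \<i> (gF (s *\<^sub>R x t))) (at t)" for t
      using bounded_linear.has_vector_derivative[OF bounded_linear_scaleR_right Dall[of t, unfolded D_def], of s]
      by (simp add: gF_scale[OF s(1)] ci.scaleR mult.commute)
    show "F (s *\<^sub>R x t) = 1" for t using F_hom[OF s(1), of "x t"] Fconst[of t] s(2) by (simp add: f_def)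
  qed (use \<mu>pos \<mu> xa in auto)
qed

end

section \<open>Tangent spaces\<close>

lemma Ck_on_cong_open:
  assumes "open S" "\<And>x. x \<in> S \<Longrightarrow> f x = g x" "Ck_on k S f"
  shows "Ck_on k S g"
  using assms(2,3)
proof (induction k arbitrary: f g)
  case 0
  then show ?case by (simp cong: continuous_on_cong_simp)
next
  case (Suc k)
  have d: "(g has_derivative frechet_derivative f (at x)) (at x)" if x: "x \<in> S" for x
  proof (rule has_derivative_transform_within_open[OF _ assms(1) x Suc.prems(1)])
    show "(f has_derivative frechet_derivative f (at x)) (at x)"
      using Suc.prems(2) x by (simp add: frechet_derivative_works)
  qed
  have e: "frechet_derivative f (at x) = frechet_derivative g (at x)" if x: "x \<in> S" for x
    by (rule frechet_derivative_at[OF d[OF x]])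
  show ?case
  proof (simp, intro conjI ballI allI)
    show "g differentiable (at x)" if "x \<in> S" for x using d[OF that] by (rule differentiableI)
    show "Ck_on k S (\<lambda>x. frechet_derivative g (at x) v)" for v
      using Suc.prems(2) by (rule_tac Suc.IH[of "\<lambda>x. frechet_derivative f (at x) v"]) (simp_all add: e)
  qed
qed

text \<open>Supplies witnesses for \<open>tangent_space\<close>: the image of a line under a smooth
  inverse chart is a smooth curve.\<close>

lemma Ck_on_compose_line:
  fixes f :: "'a::euclidean_space \<Rightarrow> 'b::real_normed_vector" and T :: "real set"
  assumes "open T" "\<And>t. t \<in> T \<Longrightarrow> a + t *\<^sub>R w \<in> S" "Ck_on k S f"
  shows "Ck_on k T (\<lambda>t. f (a + t *\<^sub>R w))"
  using assms(3)
proof (induction k arbitrary: f)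
  case 0
  then show ?case using assms(2)
    by (auto intro!: continuous_on_compose2[of S f] continuous_intros)
next
  case (Suc k)
  have d: "((\<lambda>t. f (a + t *\<^sub>R w)) has_derivative (\<lambda>h. frechet_derivative f (at (a + t *\<^sub>R w)) (h *\<^sub>R w))) (at t)"
    if t: "t \<in> T" for t
  proof (rule has_derivative_compose[where g = f])
    show "((\<lambda>t. a + t *\<^sub>R w) has_derivative (\<lambda>h. h *\<^sub>R w)) (at t)" by (auto intro!: derivative_eq_intros)
    show "(f has_derivative frechet_derivative f (at (a + t *\<^sub>R w))) (at (a + t *\<^sub>R w))"
      using Suc.prems assms(2)[OF t] by (simp add: frechet_derivative_works)
  qed
  show ?case
  proof (simp, intro conjI ballI allI)
    show "(\<lambda>t. f (a + t *\<^sub>R w)) differentiable (at t)" if "t \<in> T" for t using d[OF that] by (rule differentiableI)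
    show "Ck_on k T (\<lambda>t. frechet_derivative (\<lambda>t. f (a + t *\<^sub>R w)) (at t) v)" for v
    proof (rule Ck_on_cong_open[OF assms(1)])
      show "Ck_on k T (\<lambda>t. frechet_derivative f (at (a + t *\<^sub>R w)) (v *\<^sub>R w))"
        using Suc.prems by (rule_tac Suc.IH[of "\<lambda>x. frechet_derivative f (at x) (v *\<^sub>R w)"]) simp
      show "frechet_derivative f (at (a + t *\<^sub>R w)) (v *\<^sub>R w) = frechet_derivative (\<lambda>t. f (a + t *\<^sub>R w)) (at t) v"
        if "t \<in> T" for t using frechet_derivative_at[OF d[OF that]] by metis
    qed
  qed
qed

text \<open>The family is closed under differentiation, so smoothness follows by induction. It
  contains the fibre lines and the rotations that realise tangent vectors of the cotangent
  bundle.\<close>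

lemma smooth_on_affine_trig:
  fixes A B C D :: "'b::real_normed_vector"
  shows "smooth_on S (\<lambda>t::real. A + t *\<^sub>R B + cos t *\<^sub>R C + sin t *\<^sub>R D)"
proof -
  have "Ck_on k S (\<lambda>t::real. A + t *\<^sub>R B + cos t *\<^sub>R C + sin t *\<^sub>R D)" for k
  proof (induction k arbitrary: A B C D)
    case 0 show ?case by (simp, intro continuous_intros)
  next
    case (Suc k)
    have d: "((\<lambda>t::real. A + t *\<^sub>R B + cos t *\<^sub>R C + sin t *\<^sub>R D) has_derivative
       (\<lambda>v. v *\<^sub>R B + 0 *\<^sub>R 0 + cos t *\<^sub>R (v *\<^sub>R D) + sin t *\<^sub>R (- v *\<^sub>R C))) (at t)" for t
      by (auto intro!: derivative_eq_intros simp: algebra_simps)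
    have e: "frechet_derivative (\<lambda>t::real. A + t *\<^sub>R B + cos t *\<^sub>R C + sin t *\<^sub>R D) (at t) v =
       v *\<^sub>R B + t *\<^sub>R 0 + cos t *\<^sub>R (v *\<^sub>R D) + sin t *\<^sub>R (- v *\<^sub>R C)" for t v
      unfolding frechet_derivative_at[OF d[of t], symmetric] by simp
    show ?case unfolding Ck_on.simps e using Suc.IH d differentiableI by blast
  qed
  then show ?thesis by (simp add: smooth_on_def)
qed

lemma has_vector_derivative_const_near:
  fixes f :: "real \<Rightarrow> 'a::real_normed_vector"
  assumes "(f has_vector_derivative D) (at 0)" "\<epsilon> > 0" "\<And>t. t \<in> {-\<epsilon><..<\<epsilon>} \<Longrightarrow> f t = f 0"
  shows "D = 0"
proof -
  have "((\<lambda>_. f 0) has_vector_derivative D) (at 0)"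
    by (rule has_vector_derivative_transform_within_open[OF assms(1) _ _ assms(3), where S = "{-\<epsilon><..<\<epsilon>}"])
      (use assms(2) in auto)
  then show ?thesis by (rule vector_derivative_unique_at[OF _ has_vector_derivative_const])
qed

text \<open>For every n orthogonal to \<open>L\<close> the function \<open>inner n (c t)\<close> is
  constant, so v lies in the double orthogonal complement of \<open>L\<close>.\<close>

lemma has_vector_derivative_in_subspace:
  fixes c :: "real \<Rightarrow> 'a::euclidean_space"
  assumes "(c has_vector_derivative v) (at 0)" "\<epsilon> > 0" "subspace L"
    "\<And>t. t \<in> {-\<epsilon><..<\<epsilon>} \<Longrightarrow> c t - c 0 \<in> L"
  shows "v \<in> L"
proof -
  have "inner n v = 0" if n: "n \<in> orthogonal_comp L" for n
  proof (rule has_vector_derivative_const_near[of "\<lambda>t. inner n (c t)"])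
    show "((\<lambda>t. inner n (c t)) has_vector_derivative inner n v) (at 0)"
      by (rule bounded_linear.has_vector_derivative[OF bounded_linear_inner_right assms(1)])
    show "inner n (c t) = inner n (c 0)" if "t \<in> {-\<epsilon><..<\<epsilon>}" for t
      using n assms(4)[OF that] by (auto simp: orthogonal_comp_def orthogonal_def inner_commute inner_diff_right)
  qed fact
  then have "v \<in> orthogonal_comp (orthogonal_comp L)"
    by (auto simp: orthogonal_comp_def orthogonal_def inner_commute)
  then show ?thesis using orthogonal_comp_self[OF assms(3)] by simp
qed

lemma has_vector_derivative_fst: "(c has_vector_derivative v) F \<Longrightarrow> ((\<lambda>t. fst (c t)) has_vector_derivative fst v) F"
  by (rule bounded_linear.has_vector_derivative[OF bounded_linear_fst])

lemma has_vector_derivative_snd: "(c has_vector_derivative v) F \<Longrightarrow> ((\<lambda>t. snd (c t)) has_vector_derivative snd v) F"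
  by (rule bounded_linear.has_vector_derivative[OF bounded_linear_snd])

text \<open>The kernel of the linearised constraints |q|^2 = 1 and p . q = 0, an algebraic stand-in
  for the tangent space of the cotangent bundle.\<close>

definition cot_tangent :: "cot \<Rightarrow> cot set" where
  "cot_tangent \<nu> = {v. fst v \<bullet> fst \<nu> = 0 \<and> snd v \<bullet> fst \<nu> + snd \<nu> \<bullet> fst v = 0}"

lemma tangent_space_mono: "M \<subseteq> N \<Longrightarrow> tangent_space M x \<subseteq> tangent_space N x"
  unfolding tangent_space_def by blast

lemma inner_has_vector_derivative:
  assumes "(f has_vector_derivative f') (at t)" "(g has_vector_derivative g') (at t)"
  shows "((\<lambda>t. inner (f t) (g t)) has_vector_derivative (inner (f t) g' + inner f' (g t))) (at t)"
  by (rule bounded_bilinear.has_vector_derivative[OF bounded_bilinear_inner assms])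

lemma cot_tangent_curve:
  assumes c: "(c has_vector_derivative v) (at 0)" "\<epsilon> > 0" "c ` {-\<epsilon><..<\<epsilon>} \<subseteq> cotangent_S2"
  shows "v \<in> cot_tangent (c (0::real))"
proof -
  have q: "fst (c t) \<bullet> fst (c t) = 1" "snd (c t) \<bullet> fst (c t) = 0" if "t \<in> {-\<epsilon><..<\<epsilon>}" for t
  proof -
    have "c t \<in> cotangent_S2" using assms(3) that by blast
    then show "fst (c t) \<bullet> fst (c t) = 1" "snd (c t) \<bullet> fst (c t) = 0"
      by (auto simp: cotangent_S2_def S2_def cotangent_fibre_def norm_eq_1)
  qed
  have "fst (c 0) \<bullet> fst v + fst v \<bullet> fst (c 0) = 0"
    by (rule has_vector_derivative_const_near[OF inner_has_vector_derivative assms(2)])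
      (use q assms(2) has_vector_derivative_fst[OF c(1)] in auto)
  moreover have "snd (c 0) \<bullet> fst v + snd v \<bullet> fst (c 0) = 0"
    by (rule has_vector_derivative_const_near[OF inner_has_vector_derivative assms(2)])
      (use q assms(2) has_vector_derivative_fst[OF c(1)] has_vector_derivative_snd[OF c(1)] in auto)
  ultimately show ?thesis by (simp add: cot_tangent_def inner_commute)
qed

lemma tangent_cotangent_S2: "v \<in> tangent_space cotangent_S2 \<nu> \<Longrightarrow> v \<in> cot_tangent \<nu>"
  using cot_tangent_curve unfolding tangent_space_def by blast

lemma tangent_positive_ray:
  assumes "v \<in> tangent_space (positive_ray q p) \<nu>" shows "v \<in> span {(0, p)}"
proof -
  obtain c \<epsilon> where c: "\<epsilon> > 0" "c ` {-\<epsilon><..<\<epsilon>} \<subseteq> positive_ray q p" "(c has_vector_derivative v) (at (0::real))"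
    using assms unfolding tangent_space_def by blast
  show ?thesis
  proof (rule has_vector_derivative_in_subspace[OF c(3,1) subspace_span])
    fix t assume t: "t \<in> {-\<epsilon><..<\<epsilon>}"
    have "\<exists>s. c t = (q, s *\<^sub>R p)" "\<exists>s. c 0 = (q, s *\<^sub>R p)"
      using c(2) t c(1) unfolding positive_ray_def by (force simp: image_subset_iff)+
    then obtain s s' where "c t = (q, s *\<^sub>R p)" "c 0 = (q, s' *\<^sub>R p)" by blast
    then have "c t - c 0 = (s - s') *\<^sub>R (0, p)" by (simp add: algebra_simps)
    then show "c t - c 0 \<in> span {(0, p)}" by (simp only: span_scale span_base insertI1)
  qed
qed

text \<open>Explicit curves: two straight lines in the fibre, the rotation of q towards
  \<open>a\<close> with p fixed, and the geodesic flow in the plane of q and p. The four vectors are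
  independent, so they do not fit into a three-dimensional tangent space.\<close>

lemma tangent_cotangent_S2_basis:
  assumes q: "q \<in> S2" and p: "p \<in> cotangent_fibre q" and a: "a \<in> S2" "a \<bullet> q = 0" "a \<bullet> p = 0" and p0: "p \<noteq> 0"
  shows "(0, p) \<in> tangent_space cotangent_S2 (q, p)"
    "(0, a) \<in> tangent_space cotangent_S2 (q, p)"
    "(a, 0) \<in> tangent_space cotangent_S2 (q, p)"
    "(p /\<^sub>R norm p, - norm p *\<^sub>R q) \<in> tangent_space cotangent_S2 (q, p)"
proof -
  have qq: "q \<bullet> q = 1" "a \<bullet> a = 1" "p \<bullet> q = 0" "q \<bullet> p = 0" "q \<bullet> a = 0" "p \<bullet> a = 0"
    using assms by (auto simp: S2_def cotangent_fibre_def norm_eq_1 inner_commute)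
  have pn: "norm p * norm p = p \<bullet> p" by (simp add: norm_eq_sqrt_inner)
  have *: "v \<in> tangent_space cotangent_S2 (q, p)"
    if c: "\<And>t. A + t *\<^sub>R B + cos t *\<^sub>R C + sin t *\<^sub>R D \<in> cotangent_S2" and "A + C = (q, p)" "v = B + D"
    for A B C D v
    unfolding tangent_space_def
  proof (intro CollectI exI conjI)
    show "(1::real) > 0" by simp
    show "smooth_on {-1<..<1} (\<lambda>t::real. A + t *\<^sub>R B + cos t *\<^sub>R C + sin t *\<^sub>R D)" by (rule smooth_on_affine_trig)
    show "((\<lambda>t::real. A + t *\<^sub>R B + cos t *\<^sub>R C + sin t *\<^sub>R D) has_vector_derivative v) (at 0)"
      unfolding that(3) by (auto intro!: derivative_eq_intros)
  qed (use c that(2) in auto)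
  show "(0, p) \<in> tangent_space cotangent_S2 (q, p)"
    by (rule *[of "(q, p)" "(0, p)" 0 0]) (auto simp: cotangent_S2_def S2_def norm_eq_1 cotangent_fibre_def inner_add qq)
  show "(0, a) \<in> tangent_space cotangent_S2 (q, p)"
    by (rule *[of "(q, p)" "(0, a)" 0 0]) (auto simp: cotangent_S2_def S2_def norm_eq_1 cotangent_fibre_def inner_add qq a)
  show "(a, 0) \<in> tangent_space cotangent_S2 (q, p)"
  proof (rule *[of "(0, p)" 0 "(q, 0)" "(a, 0)"])
    fix t :: real
    have "cos t * cos t + sin t * sin t = 1" using sin_cos_squared_add3 by blast
    then show "(0, p) + t *\<^sub>R 0 + cos t *\<^sub>R (q, 0) + sin t *\<^sub>R (a, 0) \<in> cotangent_S2"
      by (simp add: cotangent_S2_def S2_def norm_eq_1 cotangent_fibre_def inner_add qq a)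
  qed auto
  define e where "e = p /\<^sub>R norm p"
  have e: "e \<bullet> e = 1" "e \<bullet> q = 0" "q \<bullet> e = 0" "p \<bullet> e = norm p" "e \<bullet> p = norm p"
    using p0 qq by (simp_all add: e_def pn[symmetric] field_simps)
  have "(e, - norm p *\<^sub>R q) \<in> tangent_space cotangent_S2 (q, p)"
  proof (rule *[of 0 0 "(q, p)" "(e, - norm p *\<^sub>R q)"])
    fix t :: real
    have cs: "cos t * cos t + sin t * sin t = 1" using sin_cos_squared_add3 by blast
    show "0 + t *\<^sub>R 0 + cos t *\<^sub>R (q, p) + sin t *\<^sub>R (e, - norm p *\<^sub>R q) \<in> cotangent_S2"
      using cs by (simp add: cotangent_S2_def S2_def norm_eq_1 cotangent_fibre_def inner_add inner_diff qq e algebra_simps)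
  qed auto
  then show "(p /\<^sub>R norm p, - norm p *\<^sub>R q) \<in> tangent_space cotangent_S2 (q, p)" by (simp only: e_def)
qed

text \<open>Injectivity of the derivative suffices in finite dimension. For the continuity of
  \<open>g'\<close> put u = g' z v - g' y v; then B (g z) u = (B (g y) - B (g z)) (g' y v), and for
  z near y the bounded inverse of B (g y) absorbs the change of B.\<close>

theorem C1_inverse_function:
  fixes f :: "'a::euclidean_space \<Rightarrow> 'a"
  assumes U: "open U" and x0: "x0 \<in> U"
    and d: "\<And>x. x \<in> U \<Longrightarrow> (f has_derivative f' x) (at x)"
    and c: "\<And>v. continuous_on U (\<lambda>x. f' x v)"
    and inj: "\<And>v. f' x0 v = 0 \<Longrightarrow> v = 0"
  obtains U' V g g' where "open U'" "U' \<subseteq> U" "x0 \<in> U'" "open V" "f x0 \<in> V" "homeomorphism U' V f g"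
    "\<And>y. y \<in> V \<Longrightarrow> (g has_derivative g' y) (at y)"
    "\<And>y v. y \<in> V \<Longrightarrow> f' (g y) (g' y v) = v"
    "\<And>v. continuous_on V (\<lambda>y. g' y v)"
proof -
  define B where "B x = Blinfun (f' x)" for x
  have bl: "bounded_linear (f' x)" if "x \<in> U" for x
    using d[OF that] by (rule has_derivative_bounded_linear)
  have B: "blinfun_apply (B x) = f' x" if "x \<in> U" for x
    unfolding B_def by (rule bounded_linear_Blinfun_apply[OF bl[OF that]])
  have dB: "(f has_derivative blinfun_apply (B x)) (at x)" if "x \<in> U" for x
    using d[OF that] B[OF that] by simp
  have cB: "continuous_on U B"
  proof (rule continuous_on_blinfun_componentwise)
    fix i :: 'a assume "i \<in> Basis"
    show "continuous_on U (\<lambda>x. blinfun_apply (B x) i)"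
      using c[of i] by (rule continuous_on_eq) (simp add: B)
  qed
  interpret l: bounded_linear "f' x0" by (rule bl[OF x0])
  have "inj (f' x0)" using inj by (simp add: l.inj_iff_eq_0)
  then obtain h where h: "linear h" "h \<circ> f' x0 = id"
    using linear_injective_left_inverse[OF l.linear_axioms] by auto
  have hb: "bounded_linear h" using h(1) by (simp add: linear_conv_bounded_linear)
  have inv: "Blinfun h o\<^sub>L B x0 = id_blinfun"
    by (rule blinfun_eqI) (use h(2) in \<open>simp add: bounded_linear_Blinfun_apply[OF hb] B[OF x0] fun_eq_iff\<close>)
  obtain U' V g g' where g: "open U'" "U' \<subseteq> U" "x0 \<in> U'" "open V" "f x0 \<in> V" and hom: "homeomorphism U' V f g"
    and gd: "\<And>y. y \<in> V \<Longrightarrow> (g has_derivative (g' y)) (at y)"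
    and g'eq: "\<And>y. y \<in> V \<Longrightarrow> g' y = Hilbert_Choice.inv (blinfun_apply (B (g y)))"
    and bij: "\<And>y. y \<in> V \<Longrightarrow> bij (blinfun_apply (B (g y)))"
    using inverse_function_theorem[OF U dB cB x0 inv] by metis
  have gU: "g y \<in> U" if "y \<in> V" for y
    using hom g(2) that by (auto simp: homeomorphism_def)
  have gc: "continuous_on V g" using hom by (simp add: homeomorphism_def)
  have r: "blinfun_apply (B (g y)) (g' y v) = v" if "y \<in> V" for y v
    unfolding g'eq[OF that] using bij[OF that] by (simp add: bij_is_surj surj_f_inv_f)
  have cg': "continuous_on V (\<lambda>y. g' y v)" for v
    unfolding continuous_on_eq_continuous_within
  proof
    fix y assume y: "y \<in> V"
    interpret g'y: bounded_linear "g' y" using gd[OF y] by (rule has_derivative_bounded_linear)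
    have gi: "g' y (blinfun_apply (B (g y)) u) = u" for u
      unfolding g'eq[OF y] using bij[OF y] by (simp add: bij_is_inj)
    obtain K where K: "K > 0" "\<And>u. norm (g' y u) \<le> norm u * K" using g'y.pos_bounded by blast
    have tB: "((\<lambda>z. B (g z)) \<longlongrightarrow> B (g y)) (at y within V)"
      using continuous_on_compose2[OF cB gc] gU y by (auto simp: continuous_on_def)
    have t0: "((\<lambda>z. norm (B (g y) - B (g z))) \<longlongrightarrow> 0) (at y within V)"
      using tendsto_norm[OF tendsto_diff[OF tendsto_const[of "B (g y)"] tB]] by simp
    have ev: "\<forall>\<^sub>F z in at y within V. norm (B (g y) - B (g z)) < 1 / (2 * K)"
      using order_tendstoD(2)[OF t0, of "1 / (2*K)"] K(1) by simp
    have evV: "\<forall>\<^sub>F z in at y within V. z \<in> V" unfolding eventually_at_filter by simp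
    have "((\<lambda>z. g' z v - g' y v) \<longlongrightarrow> 0) (at y within V)"
    proof (rule Lim_null_comparison)
      show "((\<lambda>z. 2 * K * norm (B (g y) - B (g z)) * norm (g' y v)) \<longlongrightarrow> 0) (at y within V)"
        using tendsto_mult_right[OF tendsto_mult_left[OF t0, of "2 * K"], of "norm (g' y v)"] by simp
      show "\<forall>\<^sub>F z in at y within V. norm (g' z v - g' y v) \<le> 2 * K * norm (B (g y) - B (g z)) * norm (g' y v)"
        using ev evV
      proof (eventually_elim, goal_cases)
        case (1 z)
        then have small: "norm (B (g y) - B (g z)) < 1 / (2 * K)" and z: "z \<in> V" by auto
        define u where "u = g' z v - g' y v"
        have "blinfun_apply (B (g z)) u = v - blinfun_apply (B (g z)) (g' y v)"
          by (simp add: u_def blinfun.diff_right r[OF z])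
        also have "\<dots> = blinfun_apply (B (g y) - B (g z)) (g' y v)"
          by (simp add: blinfun.diff_left r[OF y])
        finally have e: "norm (blinfun_apply (B (g z)) u) \<le> norm (B (g y) - B (g z)) * norm (g' y v)"
          using norm_blinfun by metis
        have "norm u \<le> norm (blinfun_apply (B (g y)) u) * K" using K(2)[of "blinfun_apply (B (g y)) u"] by (simp add: gi)
        also have "blinfun_apply (B (g y)) u = blinfun_apply (B (g z)) u + blinfun_apply (B (g y) - B (g z)) u"
          by (simp add: blinfun.diff_left)
        also have "norm \<dots> \<le> norm (blinfun_apply (B (g z)) u) + norm (B (g y) - B (g z)) * norm u"
          by (rule order_trans[OF norm_triangle_ineq add_left_mono[OF norm_blinfun]])
        finally have "norm u \<le> (norm (blinfun_apply (B (g z)) u) + norm (B (g y) - B (g z)) * norm u) * K"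
          using K(1) by (simp add: mult_right_mono)
        moreover have "norm (B (g y) - B (g z)) * norm u * K \<le> 1 / (2 * K) * norm u * K"
          using small K(1) by (intro mult_right_mono) auto
        ultimately have "norm u \<le> 2 * (norm (blinfun_apply (B (g z)) u) * K)"
          using K(1) by (simp add: distrib_right)
        also have "\<dots> \<le> 2 * ((norm (B (g y) - B (g z)) * norm (g' y v)) * K)"
          using e K(1) by (intro mult_left_mono mult_right_mono) auto
        finally show ?case by (simp add: u_def mult_ac)
      qed
    qed
    then show "continuous (at y within V) (\<lambda>y. g' y v)"
      unfolding continuous_within by (rule LIM_zero_cancel)
  qed
  show ?thesis
  proof (rule that[OF g hom gd])
    show "f' (g y) (g' y v) = v" if "y \<in> V" for y v using r[OF that, of v] B[OF gU[OF that]] by simp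
  qed (use cg' in auto)
qed

section \<open>Parametrisation of submanifolds and transversality to rays\<close>

lemma smooth_on_differentiable: "smooth_on S f \<Longrightarrow> x \<in> S \<Longrightarrow> f differentiable (at x)"
  unfolding smooth_on_def by (metis Ck_on.simps(2))

lemma smooth_on_frechet_continuous:
  assumes "smooth_on S f" shows "continuous_on S (\<lambda>x. frechet_derivative f (at x) v)"
proof -
  have "Ck_on (Suc 0) S f" using assms unfolding smooth_on_def by blast
  then show ?thesis by simp
qed

lemma open_interval_in_line:
  fixes a w :: "'a::real_normed_vector"
  assumes "open V" "a \<in> V"
  obtains \<epsilon> where "\<epsilon> > 0" "\<And>t. t \<in> {-\<epsilon><..<\<epsilon>} \<Longrightarrow> a + t *\<^sub>R w \<in> V"
proof -
  have "open ((\<lambda>t::real. a + t *\<^sub>R w) -` V)"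
    by (intro open_vimage assms continuous_intros)
  moreover have "0 \<in> (\<lambda>t::real. a + t *\<^sub>R w) -` V" using assms by simp
  ultimately obtain e where "e > 0" "ball 0 e \<subseteq> (\<lambda>t::real. a + t *\<^sub>R w) -` V"
    by (meson open_contains_ball)
  then show ?thesis by (intro that[of e]) (auto simp: ball_def dist_real_def subset_iff abs_less_iff)
qed

text \<open>The inverse slice chart restricted to \<open>L\<close>, after an isometry of
  \<open>real ^ 3\<close> with \<open>L\<close>. The chart composed with it is linear and injective,
  so its derivative is injective too. A curve in M read in the chart runs in \<open>L\<close>, so
  each tangent vector is in the range of the derivative.\<close>

lemma submanifold_parametrization:
  fixes M :: "cot set"
  assumes "smooth_submanifold 3 M" "\<nu> \<in> M"
  obtains Z and m :: "real ^ 3 \<Rightarrow> cot" and dm l0 where "open Z" "l0 \<in> Z" "m l0 = \<nu>"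
    "\<And>l. l \<in> Z \<Longrightarrow> m l \<in> M" "\<And>l. l \<in> Z \<Longrightarrow> (m has_derivative dm l) (at l)"
    "\<And>h. continuous_on Z (\<lambda>l. dm l h)" "\<And>l h. l \<in> Z \<Longrightarrow> dm l h \<in> tangent_space M (m l)"
    "\<And>h. dm l0 h = 0 \<Longrightarrow> h = 0" "tangent_space M \<nu> \<subseteq> range (dm l0)"
proof -
  obtain U V \<phi> \<psi> L where U: "open U" "\<nu> \<in> U" and V: "open (V :: cot set)"
    and hom: "homeomorphism U V \<phi> \<psi>" and s\<phi>: "smooth_on U \<phi>" and s\<psi>: "smooth_on V \<psi>"
    and L: "subspace L" "dim L = 3" and slice: "\<phi> ` (M \<inter> U) = V \<inter> L"
    using bspec[OF assms(1)[unfolded smooth_submanifold_def] assms(2)]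
    by (elim exE conjE) (rule that; assumption)
  have dimL: "dim (UNIV :: (real^3) set) = dim L" using L by simp
  then obtain e :: "real^3 \<Rightarrow> cot" where e: "linear e" "range e = L" "\<And>x. norm (e x) = norm x"
    using isometry_subspaces[OF subspace_UNIV L(1) dimL] by auto
  have be: "bounded_linear e" using e(1) by (simp add: linear_conv_bounded_linear)
  interpret e: bounded_linear e by fact
  have ce: "continuous_on S e" for S by (rule linear_continuous_on[OF be])
  define Z where "Z = e -` V"
  have oZ: "open Z" unfolding Z_def by (intro open_vimage V ce)
  have \<psi>\<phi>: "\<psi> (\<phi> x) = x" if "x \<in> U" for x using hom that by (simp add: homeomorphism_def)
  have "\<phi> \<nu> \<in> V \<inter> L" using slice assms(2) U(2) by blast
  then obtain l0 where l0: "e l0 = \<phi> \<nu>" "l0 \<in> Z" using e(2) by (auto simp: Z_def)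
  define m where "m l = \<psi> (e l)" for l
  define dm where "dm l h = frechet_derivative \<psi> (at (e l)) (e h)" for l h
  have d\<psi>: "(\<psi> has_derivative frechet_derivative \<psi> (at x)) (at x)" if "x \<in> V" for x
    using smooth_on_differentiable[OF s\<psi> that] by (simp add: frechet_derivative_works)
  have d\<phi>: "(\<phi> has_derivative frechet_derivative \<phi> (at x)) (at x)" if "x \<in> U" for x
    using smooth_on_differentiable[OF s\<phi> that] by (simp add: frechet_derivative_works)
  have mM: "m l \<in> M \<inter> U" "\<phi> (m l) = e l" if "l \<in> Z" for l
  proof -
    have "e l \<in> V \<inter> L" using that e(2) by (auto simp: Z_def)
    then obtain z where "z \<in> M \<inter> U" "e l = \<phi> z" using slice by (metis imageE)
    then show "m l \<in> M \<inter> U" "\<phi> (m l) = e l" using \<psi>\<phi> by (auto simp: m_def)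
  qed
  have dmd: "(m has_derivative dm l) (at l)" if "l \<in> Z" for l
    unfolding m_def[abs_def] dm_def[abs_def]
    by (rule has_derivative_compose[OF bounded_linear_imp_has_derivative[OF be] d\<psi>]) (use that in \<open>simp add: Z_def\<close>)
  have m0: "m l0 = \<nu>" using l0 \<psi>\<phi>[OF U(2)] by (simp add: m_def)
  show ?thesis
  proof (rule that[of Z l0 m dm])
    show "m l \<in> M" if "l \<in> Z" for l using mM(1)[OF that] by simp
    show "continuous_on Z (\<lambda>l. dm l h)" for h unfolding dm_def
      by (rule continuous_on_compose2[OF smooth_on_frechet_continuous[OF s\<psi>] ce]) (auto simp: Z_def)
    show "dm l h \<in> tangent_space M (m l)" if l: "l \<in> Z" for l h
    proof -
      obtain \<epsilon> where \<epsilon>: "\<epsilon> > 0" "\<And>t. t \<in> {-\<epsilon><..<\<epsilon>} \<Longrightarrow> e l + t *\<^sub>R e h \<in> V"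
        using open_interval_in_line[OF V, of "e l" "e h"] l unfolding Z_def by blast
      have eq: "\<psi> (e l + t *\<^sub>R e h) = m (l + t *\<^sub>R h)" for t by (simp add: m_def e.add e.scaleR)
      have inM: "m (l + t *\<^sub>R h) \<in> M" if "t \<in> {-\<epsilon><..<\<epsilon>}" for t
        using mM(1)[of "l + t *\<^sub>R h"] \<epsilon>(2)[OF that] by (simp add: Z_def e.add e.scaleR)
      have sm: "smooth_on {-\<epsilon><..<\<epsilon>} (\<lambda>t. \<psi> (e l + t *\<^sub>R e h))"
        using s\<psi> unfolding smooth_on_def by (intro allI Ck_on_compose_line[OF _ \<epsilon>(2)]) auto
      have "((\<lambda>t. l + t *\<^sub>R h) has_derivative (\<lambda>t. t *\<^sub>R h)) (at 0)" by (auto intro!: derivative_eq_intros)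
      from has_derivative_compose[OF this, of m "dm l"]
      have "((\<lambda>t. m (l + t *\<^sub>R h)) has_derivative (\<lambda>t. dm l (t *\<^sub>R h))) (at 0)" using dmd[OF l] by simp
      moreover have "dm l (t *\<^sub>R h) = t *\<^sub>R dm l h" for t
        using has_derivative_bounded_linear[OF dmd[OF l]] by (simp add: linear_simps)
      ultimately have "((\<lambda>t. m (l + t *\<^sub>R h)) has_vector_derivative dm l h) (at 0)"
        by (simp add: has_vector_derivative_def)
      then show ?thesis unfolding tangent_space_def using \<epsilon>(1) sm inM unfolding eq
        by (intro CollectI exI[of _ "\<lambda>t. m (l + t *\<^sub>R h)"] exI[of _ \<epsilon>]) auto
    qed
    have inv: "frechet_derivative \<phi> (at \<nu>) (dm l0 h) = e h" for h
    proof -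
      have "((\<lambda>l. \<phi> (m l)) has_derivative (\<lambda>h. frechet_derivative \<phi> (at \<nu>) (dm l0 h))) (at l0)"
        using has_derivative_compose[OF dmd[OF l0(2)], of \<phi>] d\<phi>[OF U(2)] by (simp add: m0)
      moreover have "((\<lambda>l. \<phi> (m l)) has_derivative e) (at l0)"
        by (rule has_derivative_transform_within_open[OF bounded_linear_imp_has_derivative[OF be] oZ l0(2)])
          (simp add: mM(2))
      ultimately show ?thesis by (metis has_derivative_unique)
    qed
    show "h = 0" if "dm l0 h = 0" for h
    proof -
      have "e h = 0" using inv[of h] that linear_0[OF linear_frechet_derivative[OF smooth_on_differentiable[OF s\<phi> U(2)]]] by simp
      then show ?thesis using e(3)[of h] by simp
    qed
    show "tangent_space M \<nu> \<subseteq> range (dm l0)"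
    proof
      fix v assume "v \<in> tangent_space M \<nu>"
      then obtain c \<epsilon> where c: "\<epsilon> > 0" "c ` {-\<epsilon><..<\<epsilon>} \<subseteq> M" "c 0 = \<nu>" "(c has_vector_derivative v) (at (0::real))"
        unfolding tangent_space_def by blast
      have "isCont c 0" using c(4) by (rule has_vector_derivative_continuous)
      moreover obtain r where r: "r > 0" "ball \<nu> r \<subseteq> U" using U by (meson open_contains_ball)
      ultimately obtain d where d: "d > 0" "\<And>t. dist t 0 < d \<Longrightarrow> dist (c t) (c 0) < r"
        unfolding continuous_at_eps_delta by blast
      have dU: "c t \<in> U" if "dist t 0 < d" for t using d(2)[OF that] r(2) c(3) by (auto simp: dist_commute)
      \<comment> \<open>The curve is only assumed to lie in M; by continuity it also stays in the
        chart domain on this shorter interval.\<close>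
      define \<delta> where "\<delta> = min d \<epsilon>"
      have \<delta>: "\<delta> > 0" using c(1) d(1) by (simp add: \<delta>_def)
      have cM: "c t \<in> M \<inter> U" if "t \<in> {-\<delta><..<\<delta>}" for t
        using that c(2) dU[of t] by (auto simp: \<delta>_def dist_real_def)
      have dc: "((\<lambda>t. \<phi> (c t)) has_vector_derivative frechet_derivative \<phi> (at \<nu>) v) (at 0)"
      proof -
        have "((\<lambda>t. \<phi> (c t)) has_derivative (\<lambda>t. frechet_derivative \<phi> (at \<nu>) (t *\<^sub>R v))) (at 0)"
          using has_derivative_compose[OF c(4)[unfolded has_vector_derivative_def], of \<phi>] d\<phi>[OF U(2)] by (simp add: c(3))
        moreover have "frechet_derivative \<phi> (at \<nu>) (t *\<^sub>R v) = t *\<^sub>R frechet_derivative \<phi> (at \<nu>) v" for t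
          using linear_cmul[OF linear_frechet_derivative[OF smooth_on_differentiable[OF s\<phi> U(2)]]] .
        ultimately show ?thesis by (simp add: has_vector_derivative_def)
      qed
      have "frechet_derivative \<phi> (at \<nu>) v \<in> L"
      proof (rule has_vector_derivative_in_subspace[OF dc \<delta> L(1)])
        fix t assume "t \<in> {-\<delta><..<\<delta>}"
        then have "\<phi> (c t) \<in> L" "\<phi> (c 0) \<in> L" using cM[of t] cM[of 0] slice \<delta> by auto
        then show "\<phi> (c t) - \<phi> (c 0) \<in> L" using L(1) by (rule_tac subspace_diff)
      qed
      then obtain h where h: "e h = frechet_derivative \<phi> (at \<nu>) v" using e(2) by (metis imageE)
      have "((\<lambda>t. \<psi> (\<phi> (c t))) has_vector_derivative dm l0 h) (at 0)"
      proof -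
        have "\<phi> \<nu> \<in> V" using l0 by (simp add: Z_def)
        then have "((\<lambda>t. \<psi> (\<phi> (c t))) has_derivative (\<lambda>t. frechet_derivative \<psi> (at (\<phi> \<nu>)) (t *\<^sub>R e h))) (at 0)"
          using has_derivative_compose[OF dc[unfolded has_vector_derivative_def], of \<psi>] d\<psi>[of "\<phi> \<nu>"] by (simp add: c(3) h)
        moreover have "frechet_derivative \<psi> (at (\<phi> \<nu>)) (t *\<^sub>R e h) = t *\<^sub>R dm l0 h" for t
          using linear_cmul[OF linear_frechet_derivative[OF smooth_on_differentiable[OF s\<psi> \<open>\<phi> \<nu> \<in> V\<close>]]]
          by (simp add: dm_def l0)
        ultimately show ?thesis by (simp add: has_vector_derivative_def)
      qed
      then have "(c has_vector_derivative dm l0 h) (at 0)"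
        by (rule has_vector_derivative_transform_within_open[where S = "{-\<delta><..<\<delta>}"]) (use \<delta> cM \<psi>\<phi> in auto)
      then have "v = dm l0 h" using c(4) by (rule vector_derivative_unique_at[symmetric])
      then show "v \<in> range (dm l0)" by blast
    qed
  qed (use oZ l0 m0 dmd in auto)
qed

lemma cross_unit:
  fixes p q :: "real^3"
  assumes "norm q = 1" "p \<bullet> q = 0" "p \<noteq> 0"
  obtains a where "norm a = 1" "a \<bullet> q = 0" "a \<bullet> p = 0"
proof -
  have "(norm (cross3 q p))\<^sup>2 = (norm p)\<^sup>2" using norm_cross_dot[of q p] assms by (simp add: inner_commute)
  then have n: "cross3 q p \<noteq> 0" using assms by auto
  show ?thesis
    by (rule that[of "sgn (cross3 q p)"]) (use n in \<open>simp_all add: norm_sgn sgn_div_norm dot_cross_self inner_commute[of _ q]\<close>)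
qed

text \<open>Otherwise transversality would put the whole tangent space of the cotangent bundle, with
  its four independent vectors, into the tangent space of M, whose dimension is at most 3.\<close>

lemma ray_not_tangent:
  assumes M: "fiberwise_star_shaped M" and \<nu>: "\<nu> \<in> M" "snd \<nu> \<noteq> 0"
  shows "(0, snd \<nu>) \<notin> tangent_space M \<nu>"
proof
  assume t: "(0, snd \<nu>) \<in> tangent_space M \<nu>"
  obtain q p where qp: "\<nu> = (q, p)" by fastforce
  have q: "q \<in> S2" and p: "p \<in> cotangent_fibre q" and p0: "p \<noteq> 0"
    using M \<nu> qp by (auto simp: fiberwise_star_shaped_def cotangent_S2_def)
  have sm: "smooth_submanifold 3 M" using M by (simp add: fiberwise_star_shaped_def)
  obtain Z and m :: "real ^ 3 \<Rightarrow> cot" and dm l0 where Z: "l0 \<in> Z" "m l0 = \<nu>"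
    and d: "\<And>l. l \<in> Z \<Longrightarrow> (m has_derivative dm l) (at l)"
    and tan: "\<And>l h. l \<in> Z \<Longrightarrow> dm l h \<in> tangent_space M (m l)"
    and sub: "tangent_space M \<nu> \<subseteq> range (dm l0)"
    using submanifold_parametrization[OF sm \<nu>(1)] by metis
  have lin: "linear (dm l0)" using d[OF Z(1)] by (rule has_derivative_linear)
  have T: "tangent_space M \<nu> = range (dm l0)" using sub tan[OF Z(1)] Z(2) by auto
  have sT: "subspace (tangent_space M \<nu>)" unfolding T by (rule linear_subspace_image[OF lin subspace_UNIV])
  have dT: "dim (tangent_space M \<nu>) \<le> 3" unfolding T using dim_image_le[OF lin, of UNIV] by simp
  have "\<nu> \<in> M \<inter> positive_ray q p"
    using \<nu>(1) qp unfolding positive_ray_def by (auto intro!: exI[of _ 1])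
  then have tr: "transverse_at cotangent_S2 (positive_ray q p) M \<nu>"
    using M q p p0 unfolding fiberwise_star_shaped_def by blast
  have NT: "tangent_space cotangent_S2 \<nu> \<subseteq> tangent_space M \<nu>"
  proof
    fix v assume "v \<in> tangent_space cotangent_S2 \<nu>"
    then obtain u w where "v = u + w" "u \<in> tangent_space (positive_ray q p) \<nu>" "w \<in> tangent_space M \<nu>"
      using tr unfolding transverse_at_def by blast
    moreover have "span {(0, p)} \<subseteq> tangent_space M \<nu>"
      by (rule span_minimal[OF _ sT]) (use t qp in auto)
    ultimately show "v \<in> tangent_space M \<nu>" using tangent_positive_ray subspace_add[OF sT] by blast
  qed
  have nq: "norm q = 1" and pq: "p \<bullet> q = 0" using q p by (auto simp: S2_def cotangent_fibre_def)
  obtain a where a: "norm a = 1" "a \<bullet> q = 0" "a \<bullet> p = 0" using cross_unit[OF nq pq p0] .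
  have aS: "a \<in> S2" using a by (simp add: S2_def)
  let ?b = "(p /\<^sub>R norm p, - norm p *\<^sub>R q)"
  let ?S = "{(0, p), (0, a), (a, 0), ?b}"
  have S: "?S \<subseteq> tangent_space M \<nu>"
    using tangent_cotangent_S2_basis[OF q p aS a(2,3) p0] NT qp by auto
  have ne: "p \<noteq> a" "a \<noteq> 0" "q \<noteq> 0" using a p0 nq by auto
  have aa: "a \<bullet> a = 1" "p \<bullet> a = 0" "q \<bullet> a = 0" "q \<bullet> p = 0" using a pq by (simp_all add: norm_eq_1 inner_commute)
  have "a \<noteq> p /\<^sub>R norm p" using a(3) p0 aa by (metis inner_commute inner_scaleR_right mult_zero_right zero_neq_one)
  then have card: "card ?S = 4" using ne p0 by auto
  have "pairwise orthogonal ?S"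
    unfolding pairwise_def orthogonal_def using a aa pq by (auto simp: inner_prod_def)
  then have "independent ?S" by (rule pairwise_orthogonal_independent) (use ne p0 in \<open>auto simp: zero_prod_def\<close>)
  from independent_card_le_dim[OF S this] dT card show False by simp
qed

section \<open>The defining function of a star-shaped hypersurface\<close>

text \<open>The extension from \<open>T\<^sup>*S\<^sup>2\<close> to ambient space is homogeneous of degree 1 in both variables. With this choice, and not with
  one of degree 0 in \<open>q\<close>, the ambient Hamiltonian vector field of \<open>G\<close> is tangent to \<open>T\<^sup>*S\<^sup>2\<close>.\<close>

definition cot_retract :: "cot \<Rightarrow> cot" where
  "cot_retract y = (fst y /\<^sub>R norm (fst y),
     norm (fst y) *\<^sub>R (snd y - ((snd y \<bullet> fst y) / (fst y \<bullet> fst y)) *\<^sub>R fst y))"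

definition cot_nonzero :: "cot set" where
  "cot_nonzero = {\<nu> \<in> cotangent_S2. snd \<nu> \<noteq> 0}"

lemma cot_nonzero_iff: "(q, p) \<in> cot_nonzero \<longleftrightarrow> norm q = 1 \<and> p \<bullet> q = 0 \<and> p \<noteq> 0"
  by (auto simp: cot_nonzero_def cotangent_S2_def S2_def cotangent_fibre_def)

lemma cot_retract_eq:
  assumes "norm q = 1" "p \<bullet> q = 0" "r > 0"
  shows "cot_retract (r *\<^sub>R q, \<sigma> *\<^sub>R p + \<beta> *\<^sub>R q) = (q, (r * \<sigma>) *\<^sub>R p)"
proof -
  have "q \<bullet> q = 1" using assms(1) by (simp add: norm_eq_1)
  then show ?thesis using assms
    by (simp add: cot_retract_def inner_add_left)
qed

lemma adjoint_inner_1: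
  fixes f :: "'a::euclidean_space \<Rightarrow> real"
  assumes "linear f" shows "inner (adjoint f 1) v = f v"
  using adjoint_works[OF assms, of v 1] by (simp add: inner_commute)

locale star_shaped =
  fixes M :: "cot set"
  assumes star: "fiberwise_star_shaped M"
begin

definition ray_time :: "cot \<Rightarrow> real" where
  "ray_time \<nu> = (THE t. t > 0 \<and> (fst \<nu>, t *\<^sub>R snd \<nu>) \<in> M)"

text \<open>The fibrewise Minkowski gauge of M, precomposed with the retraction.\<close>

definition G :: "cot \<Rightarrow> real" where "G y = 1 / ray_time (cot_retract y)"

text \<open>The Euclidean gradient: the value of the adjoint at 1 is the Riesz representative of the
  derivative.\<close>

definition gG :: "cot \<Rightarrow> cot" where "gG y = adjoint (frechet_derivative G (at y)) 1"

lemma M_subset: "M \<subseteq> cotangent_S2" using star by (simp add: fiberwise_star_shaped_def)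

lemma ray_ex1:
  assumes "(q, p) \<in> cot_nonzero"
  shows "\<exists>!t. t > 0 \<and> (q, t *\<^sub>R p) \<in> M"
proof -
  have p0: "p \<noteq> 0" using assms by (simp add: cot_nonzero_iff)
  have "q \<in> S2" "p \<in> cotangent_fibre q - {0}"
    using assms by (auto simp: cot_nonzero_def cotangent_S2_def)
  then have ex1: "\<exists>!\<nu>. \<nu> \<in> M \<inter> positive_ray q p"
    using star unfolding fiberwise_star_shaped_def by simp
  then obtain t where t: "t > 0" "(q, t *\<^sub>R p) \<in> M" by (auto simp: positive_ray_def)
  have "s = t" if s: "s > 0" "(q, s *\<^sub>R p) \<in> M" for s
  proof -
    have "(q, s *\<^sub>R p) \<in> M \<inter> positive_ray q p" "(q, t *\<^sub>R p) \<in> M \<inter> positive_ray q p"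
      using s t unfolding positive_ray_def by auto
    then have "(q, s *\<^sub>R p) = (q, t *\<^sub>R p)" using ex1 by blast
    then show ?thesis using p0 by simp
  qed
  then show ?thesis using t by blast
qed

lemma G_eq:
  assumes "(q, p) \<in> cot_nonzero" "r > 0" "\<sigma> > 0" "T > 0" "(q, T *\<^sub>R p) \<in> M"
  shows "G (r *\<^sub>R q, \<sigma> *\<^sub>R p + \<beta> *\<^sub>R q) = r * \<sigma> / T"
proof -
  have rs: "r * \<sigma> > 0" using assms by simp
  have D: "(q, (r * \<sigma>) *\<^sub>R p) \<in> cot_nonzero" using assms(1-3) by (simp add: cot_nonzero_iff)
  have "ray_time (q, (r * \<sigma>) *\<^sub>R p) = T / (r * \<sigma>)"
    unfolding ray_time_def
    by (rule the1_equality) (use ray_ex1[OF D] assms rs in auto)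
  then show ?thesis
    using assms cot_retract_eq[of q p r \<sigma> \<beta>] by (simp add: G_def cot_nonzero_iff)
qed

lemma G_on_M:
  assumes "(q, p) \<in> M" "p \<noteq> 0" "r > 0" "\<sigma> > 0"
  shows "G (r *\<^sub>R q, \<sigma> *\<^sub>R p + \<beta> *\<^sub>R q) = r * \<sigma>"
proof -
  have "(q, p) \<in> cot_nonzero" using assms M_subset by (auto simp: cot_nonzero_def)
  from G_eq[OF this assms(3,4), of 1 \<beta>] show ?thesis using assms by simp
qed

lemma G_pos_M:
  assumes "(q, p) \<in> cot_nonzero"
  shows "G (q, p) > 0" "(q, (1 / G (q, p)) *\<^sub>R p) \<in> M"
proof -
  obtain T where T: "T > 0" "(q, T *\<^sub>R p) \<in> M" using ray_ex1[OF assms] by blast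
  have "G (q, p) = 1 / T" using G_eq[OF assms _ _ T, of 1 1 0] by simp
  then show "G (q, p) > 0" "(q, (1 / G (q, p)) *\<^sub>R p) \<in> M" using T by auto
qed

lemma G_scale:
  assumes "(q, p) \<in> cot_nonzero" "r > 0" "\<sigma> > 0"
  shows "G (r *\<^sub>R q, \<sigma> *\<^sub>R p + \<beta> *\<^sub>R q) = r * \<sigma> * G (q, p)"
  using G_eq[OF assms(1,2,3) _ G_pos_M(2)[OF assms(1)]] G_pos_M(1)[OF assms(1)] by simp

lemma M_iff_G:
  assumes "(q, p) \<in> cot_nonzero"
  shows "(q, p) \<in> M \<longleftrightarrow> G (q, p) = 1"
proof
  assume "(q, p) \<in> M"
  then show "G (q, p) = 1" using G_on_M[of q p 1 1 0] assms by (simp add: cot_nonzero_iff)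
next
  assume "G (q, p) = 1" then show "(q, p) \<in> M" using G_pos_M(2)[OF assms] by simp
qed

text \<open>If \<open>m\<close> parametrizes the hypersurface with values \<open>(q', p')\<close>, then \<open>(r q', \<sigma> p' + \<beta> q')\<close> are local coordinates of
  ambient space in which \<open>G = r \<sigma>\<close>.\<close>

lemma G_chart:
  assumes \<nu>: "(q, p) \<in> M" "p \<noteq> 0" and s: "s > 0"
  obtains V gd where "open V" "(q, s *\<^sub>R p) \<in> V" "\<And>y. y \<in> V \<Longrightarrow> (G has_derivative gd y) (at y)"
    "\<And>v. continuous_on V (\<lambda>y. gd y v)"
    "\<And>v. s = 1 \<Longrightarrow> v \<in> cot_tangent (q, p) \<Longrightarrow> gd (q, p) v = 0 \<Longrightarrow> v \<in> tangent_space M (q, p)"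
proof -
  have sm: "smooth_submanifold 3 M" using star by (simp add: fiberwise_star_shaped_def)
  obtain Z and m :: "real ^ 3 \<Rightarrow> cot" and dm l0 where oZ: "open Z" and l0: "l0 \<in> Z" "m l0 = (q, p)"
    and mM: "\<And>l. l \<in> Z \<Longrightarrow> m l \<in> M" and dmd: "\<And>l. l \<in> Z \<Longrightarrow> (m has_derivative dm l) (at l)"
    and dmc: "\<And>h. continuous_on Z (\<lambda>l. dm l h)" and dmt: "\<And>l h. l \<in> Z \<Longrightarrow> dm l h \<in> tangent_space M (m l)"
    and dmi: "\<And>h. dm l0 h = 0 \<Longrightarrow> h = 0"
    by (rule submanifold_parametrization[OF sm \<nu>(1)]) (rule that; assumption)
  have mc: "continuous_on Z m"
    using dmd by (meson continuous_at_imp_continuous_on has_derivative_continuous)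
  define Z' where "Z' = Z \<inter> (\<lambda>l. snd (m l)) -` (- {0})"
  have oZ': "open Z'" unfolding Z'_def
    by (intro continuous_open_preimage continuous_intros mc oZ)
  define U0 :: "cot set" where "U0 = Z' \<times> {c. c $ 1 > 0 \<and> c $ 2 > 0}"
  have oU0: "open U0" unfolding U0_def
    by (intro open_Times oZ' open_Collect_conj open_Collect_less continuous_intros)
  define \<Theta> :: "cot \<Rightarrow> cot" where "\<Theta> z = (snd z $ 2 *\<^sub>R fst (m (fst z)),
     snd z $ 1 *\<^sub>R snd (m (fst z)) + snd z $ 3 *\<^sub>R fst (m (fst z)))" for z
  define d\<Theta> :: "cot \<Rightarrow> cot \<Rightarrow> cot" where "d\<Theta> z h =
     (snd z $ 2 *\<^sub>R fst (dm (fst z) (fst h)) + snd h $ 2 *\<^sub>R fst (m (fst z)),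
      (snd z $ 1 *\<^sub>R snd (dm (fst z) (fst h)) + snd h $ 1 *\<^sub>R snd (m (fst z)))
       + (snd z $ 3 *\<^sub>R fst (dm (fst z) (fst h)) + snd h $ 3 *\<^sub>R fst (m (fst z))))" for z h
  \<comment> \<open>The coordinates (\<sigma>, r, \<beta>) of the base point. The scale
    \<open>s\<close> makes the chart available at every point of the ray, not only at the one on
    M.\<close>
  define c0 :: "real^3" where "c0 = vector [s, 1, 0]"
  have c0: "c0 $ 1 = s" "c0 $ 2 = 1" "c0 $ 3 = 0" by (simp_all add: c0_def)
  define x0 :: cot where "x0 = (l0, c0)"
  have x0: "x0 \<in> U0" using l0 \<nu> s by (simp add: x0_def U0_def Z'_def c0)
  have \<Theta>0: "\<Theta> x0 = (q, s *\<^sub>R p)" by (simp add: \<Theta>_def x0_def l0 c0)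
  have U0Z: "fst z \<in> Z" if "z \<in> U0" for z using that by (auto simp: U0_def Z'_def)
  have d\<Theta>: "(\<Theta> has_derivative d\<Theta> z) (at z)" if z: "z \<in> U0" for z
  proof -
    have "((\<lambda>z. m (fst z)) has_derivative (\<lambda>h. dm (fst z) (fst h))) (at z)"
      by (rule has_derivative_compose[OF has_derivative_fst[OF has_derivative_ident] dmd[OF U0Z[OF z]]])
    note m1 = has_derivative_fst[OF this] and m2 = has_derivative_snd[OF this]
    have cc: "((\<lambda>z. snd z $ i) has_derivative (\<lambda>h. snd h $ i)) (at z)" for i and z :: cot
      by (intro bounded_linear_imp_has_derivative bounded_linear_compose[OF bounded_linear_vec_nth bounded_linear_snd])
    show ?thesis unfolding \<Theta>_def[abs_def] d\<Theta>_def[abs_def]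
      by (intro has_derivative_Pair has_derivative_add has_derivative_scaleR m1 m2 cc)
  qed
  have d\<Theta>c: "continuous_on U0 (\<lambda>z. d\<Theta> z h)" for h
  proof -
    have "continuous_on U0 (\<lambda>z. dm (fst z) (fst h))" "continuous_on U0 (\<lambda>z. m (fst z))"
      using U0Z by (auto intro!: continuous_on_compose2[OF dmc] continuous_on_compose2[OF mc] continuous_intros)
    then show ?thesis unfolding d\<Theta>_def by (intro continuous_intros)
  qed
  have qp: "norm q = 1" "q \<bullet> q = 1" "p \<bullet> q = 0" "q \<bullet> p = 0"
    using \<nu> M_subset by (auto simp: cotangent_S2_def S2_def cotangent_fibre_def norm_eq_1 inner_commute)
  have tan: "fst (dm l0 h) \<bullet> q = 0" "snd (dm l0 h) \<bullet> q + p \<bullet> fst (dm l0 h) = 0" for h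
    using tangent_cotangent_S2[OF subsetD[OF tangent_space_mono[OF M_subset] dmt[OF l0(1)]], of h] l0
    by (auto simp: cot_tangent_def)
  have d\<Theta>0: "d\<Theta> x0 h = (fst (dm l0 (fst h)) + snd h $ 2 *\<^sub>R q,
       s *\<^sub>R snd (dm l0 (fst h)) + snd h $ 1 *\<^sub>R p + snd h $ 3 *\<^sub>R q)" for h
    by (simp add: d\<Theta>_def x0_def c0 l0)
  have dml: "bounded_linear (dm l0)" using dmd[OF l0(1)] by (rule has_derivative_bounded_linear)
  \<comment> \<open>Pairing with q removes the components along r and \<beta>. If the radial
    component did not vanish, (0, p) would be tangent to M, against
    \<open>ray_not_tangent\<close>.\<close>
  have inj: "h = 0" if h: "d\<Theta> x0 h = 0" for h
  proof -
    have e1: "fst (dm l0 (fst h)) + snd h $ 2 *\<^sub>R q = 0"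
      and e2: "s *\<^sub>R snd (dm l0 (fst h)) + snd h $ 1 *\<^sub>R p + snd h $ 3 *\<^sub>R q = 0"
      using h unfolding d\<Theta>0 by (auto simp: zero_prod_def)
    have "(fst (dm l0 (fst h)) + snd h $ 2 *\<^sub>R q) \<bullet> q = 0" unfolding e1 by simp
    then have h2: "snd h $ 2 = 0" using tan(1) qp by (simp add: inner_add_left)
    then have u: "fst (dm l0 (fst h)) = 0" using e1 by simp
    then have w: "snd (dm l0 (fst h)) \<bullet> q = 0" using tan(2)[of "fst h"] by simp
    have "(s *\<^sub>R snd (dm l0 (fst h)) + snd h $ 1 *\<^sub>R p + snd h $ 3 *\<^sub>R q) \<bullet> q = 0" unfolding e2 by simp
    then have h3: "snd h $ 3 = 0" using w qp by (simp add: inner_add_left)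
    have h1: "snd h $ 1 = 0"
    proof (rule ccontr)
      assume n: "snd h $ 1 \<noteq> 0"
      have "s *\<^sub>R snd (dm l0 (fst h)) = - (snd h $ 1 *\<^sub>R p)" using e2 h3 by (simp add: eq_neg_iff_add_eq_0)
      then have "p = - (s / snd h $ 1) *\<^sub>R snd (dm l0 (fst h))"
        using n by (simp add: field_simps vec_eq_iff)
      then have "(0, p) = - (s / snd h $ 1) *\<^sub>R dm l0 (fst h)"
        using u by (simp add: prod_eq_iff)
      also have "\<dots> = dm l0 (- (s / snd h $ 1) *\<^sub>R fst h)" using dml by (simp only: linear_simps)
      finally show False using dmt[OF l0(1)] ray_not_tangent[OF star \<nu>(1)] \<nu>(2) l0(2) by fastforce
    qed
    have "snd h = 0" using h1 h2 h3 by (simp add: vec_eq_iff forall_3)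
    moreover have "snd (dm l0 (fst h)) = 0" using e2 h1 h3 s by simp
    then have "dm l0 (fst h) = 0" using u by (simp add: prod_eq_iff)
    then have "fst h = 0" by (rule dmi)
    ultimately show ?thesis by (simp add: prod_eq_iff)
  qed
  have G\<Theta>: "G (\<Theta> z) = snd z $ 1 * snd z $ 2" if z: "z \<in> U0" for z
  proof -
    have "G (snd z $ 2 *\<^sub>R fst (m (fst z)), snd z $ 1 *\<^sub>R snd (m (fst z)) + snd z $ 3 *\<^sub>R fst (m (fst z))) = snd z $ 2 * snd z $ 1"
      by (rule G_on_M) (use z mM[OF U0Z[OF z]] in \<open>auto simp: U0_def Z'_def\<close>)
    then show ?thesis by (simp add: \<Theta>_def mult.commute)
  qed
  obtain U' V g g' where U': "open U'" "U' \<subseteq> U0" "x0 \<in> U'" and V: "open V" "\<Theta> x0 \<in> V" and hom: "homeomorphism U' V \<Theta> g"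
    and gd: "\<And>y. y \<in> V \<Longrightarrow> (g has_derivative g' y) (at y)" and gr: "\<And>y v. y \<in> V \<Longrightarrow> d\<Theta> (g y) (g' y v) = v"
    and g'c: "\<And>v. continuous_on V (\<lambda>y. g' y v)"
    by (rule C1_inverse_function[OF oU0 x0 d\<Theta> d\<Theta>c inj]) (assumption | (rule that; assumption))+
  have gU: "g y \<in> U0" "\<Theta> (g y) = y" if "y \<in> V" for y
    using hom U'(2) that by (auto simp: homeomorphism_def)
  have gc: "continuous_on V g" using hom by (simp add: homeomorphism_def)
  have Gg: "G y = snd (g y) $ 1 * snd (g y) $ 2" if "y \<in> V" for y using G\<Theta>[OF gU(1)[OF that]] gU(2)[OF that] by simp
  define dG where "dG y v = snd (g y) $ 1 * snd (g' y v) $ 2 + snd (g' y v) $ 1 * snd (g y) $ 2" for y v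
  have gx: "g (q, s *\<^sub>R p) = x0" using hom U'(3) \<Theta>0 by (metis homeomorphism_apply1)
  show ?thesis
  proof (rule that[of V dG])
    show "open V" "(q, s *\<^sub>R p) \<in> V" using V \<Theta>0 by auto
    show "(G has_derivative dG y) (at y)" if y: "y \<in> V" for y
    proof -
      have cc: "((\<lambda>y. snd (g y) $ i) has_derivative (\<lambda>v. snd (g' y v) $ i)) (at y)" for i
        by (rule bounded_linear.has_derivative[OF bounded_linear_compose[OF bounded_linear_vec_nth bounded_linear_snd] gd[OF y]])
      have "((\<lambda>y. snd (g y) $ 1 * snd (g y) $ 2) has_derivative dG y) (at y)"
        unfolding dG_def[abs_def] by (rule has_derivative_mult[OF cc cc])
      then show ?thesis by (rule has_derivative_transform_within_open[OF _ V(1) y]) (simp add: Gg)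
    qed
    show "continuous_on V (\<lambda>y. dG y v)" for v
      unfolding dG_def by (intro continuous_intros gc g'c)
    \<comment> \<open>For a vector satisfying the linearised constraints the components along r and
      \<beta> vanish; dG = 0 then removes the radial one, and what remains comes from the
      parametrization of M.\<close>
    fix v assume s1: "s = 1" and v: "v \<in> cot_tangent (q, p)" and dv: "dG (q, p) v = 0"
    have yV: "(q, p) \<in> V" using V \<Theta>0 s1 by simp
    define h where "h = g' (q, p) v"
    have vh: "v = (fst (dm l0 (fst h)) + snd h $ 2 *\<^sub>R q, snd (dm l0 (fst h)) + snd h $ 1 *\<^sub>R p + snd h $ 3 *\<^sub>R q)"
      using gr[OF yV, of v] gx s1 d\<Theta>0[of h] by (simp add: h_def)
    have h12: "snd h $ 1 + snd h $ 2 = 0" using dv gx s1 by (simp add: dG_def h_def x0_def c0 add.commute)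
    have "fst v \<bullet> q = 0" "snd v \<bullet> q + p \<bullet> fst v = 0" using v by (auto simp: cot_tangent_def)
    then have "snd h $ 2 = 0" "snd h $ 3 = 0"
      unfolding vh using tan[of "fst h"] qp by (simp_all add: inner_add_left inner_add_right)
    then have "v = dm l0 (fst h)" using vh h12 by (simp add: prod_eq_iff)
    then show "v \<in> tangent_space M (q, p)" using dmt[OF l0(1), of "fst h"] l0 by simp
  qed
qed

text \<open>The chart is based at the point of M on the same ray, with scale
  \<open>s = G (q, p)\<close>.\<close>

lemma G_C1:
  assumes "y \<in> cot_nonzero"
  shows "\<exists>V. open V \<and> y \<in> V \<and> (\<forall>z\<in>V. (G has_derivative (\<lambda>v. inner (gG z) v)) (at z)) \<and> continuous_on V gG"
proof -
  obtain q p where y: "y = (q, p)" by fastforce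
  have Gp: "G (q, p) > 0" "(q, (1 / G (q, p)) *\<^sub>R p) \<in> M" using G_pos_M assms y by auto
  have "p \<noteq> 0" using assms y by (simp add: cot_nonzero_iff)
  then have "(1 / G (q, p)) *\<^sub>R p \<noteq> 0" using Gp by simp
  then obtain V gd where V: "open V" "(q, G (q, p) *\<^sub>R (1 / G (q, p)) *\<^sub>R p) \<in> V"
    and d: "\<And>y. y \<in> V \<Longrightarrow> (G has_derivative gd y) (at y)" and c: "\<And>v. continuous_on V (\<lambda>y. gd y v)"
    by (rule G_chart[OF Gp(2) _ Gp(1)]) (rule that; assumption)
  have g: "inner (gG z) v = gd z v" if "z \<in> V" for z v
    unfolding gG_def frechet_derivative_at[OF d[OF that], symmetric]
    by (rule adjoint_inner_1[OF has_derivative_linear[OF d[OF that]]])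
  have "continuous_on V gG"
  proof (subst continuous_on_componentwise, rule ballI)
    fix i :: cot
    show "continuous_on V (\<lambda>y. inner (gG y) i)" using c[of i] by (rule continuous_on_eq) (simp add: g)
  qed
  moreover have "(G has_derivative (\<lambda>v. inner (gG z) v)) (at z)" if "z \<in> V" for z
  proof -
    have "gd z = (\<lambda>v. inner (gG z) v)" using g[OF that] by (simp add: fun_eq_iff)
    then show ?thesis using d[OF that] by simp
  qed
  moreover have "y \<in> V" using V(2) Gp(1) y by simp
  ultimately show ?thesis using V(1) by blast
qed

lemma G_deriv: "y \<in> cot_nonzero \<Longrightarrow> (G has_derivative (\<lambda>v. inner (gG y) v)) (at y)"
  using G_C1 by blast

lemma gG_isCont: "y \<in> cot_nonzero \<Longrightarrow> isCont gG y"
  using G_C1[of y] by (auto simp: continuous_on_eq_continuous_at)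

text \<open>Euler's identities for degree 1 in p and degree 1 in q, and the invariance of G under
  adding multiples of q to p. Together they make the ambient Hamiltonian field satisfy the
  linearised constraints.\<close>

lemma gG_identities:
  assumes "(q, p) \<in> cot_nonzero"
  shows "p \<bullet> snd (gG (q, p)) = G (q, p)" "q \<bullet> fst (gG (q, p)) = G (q, p)" "q \<bullet> snd (gG (q, p)) = 0"
proof -
  have key: "inner (gG (q, p)) (A, B) = D"
    if c: "\<And>t. t \<in> {-1<..<1} \<Longrightarrow> G ((q, p) + t *\<^sub>R (A, B)) = G (q, p) + t * D" for A B D
  proof -
    have "((\<lambda>t. (q, p) + t *\<^sub>R (A, B)) has_derivative (\<lambda>t. t *\<^sub>R (A, B))) (at 0)" by (auto intro!: derivative_eq_intros)
    from has_derivative_compose[OF this, of G "\<lambda>v. inner (gG (q, p)) v"]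
    have "((\<lambda>t. G ((q, p) + t *\<^sub>R (A, B))) has_derivative (\<lambda>t. inner (gG (q, p)) (t *\<^sub>R (A, B)))) (at 0)"
      using G_deriv[OF assms] by simp
    then have "((\<lambda>t. G ((q, p) + t *\<^sub>R (A, B))) has_vector_derivative inner (gG (q, p)) (A, B)) (at 0)"
      unfolding has_vector_derivative_def by (simp only: inner_scaleR_right real_scaleR_def)
    then have "((\<lambda>t. G (q, p) + t * D) has_vector_derivative inner (gG (q, p)) (A, B)) (at 0)"
      by (rule has_vector_derivative_transform_within_open[where S = "{-1<..<1}"]) (use c in auto)
    moreover have "((\<lambda>t. G (q, p) + t * D) has_vector_derivative D) (at 0)"
      by (auto intro!: derivative_eq_intros simp flip: has_real_derivative_iff_has_vector_derivative)
    ultimately show ?thesis by (rule vector_derivative_unique_at)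
  qed
  have "G ((q, p) + t *\<^sub>R (0, p)) = G (q, p) + t * G (q, p)" if "t \<in> {-1<..<1}" for t
    using G_scale[OF assms, of 1 "1 + t" 0] that by (simp add: algebra_simps)
  from key[OF this] show "p \<bullet> snd (gG (q, p)) = G (q, p)" by (simp add: inner_prod_def inner_commute)
  have "G ((q, p) + t *\<^sub>R (q, 0)) = G (q, p) + t * G (q, p)" if "t \<in> {-1<..<1}" for t
    using G_scale[OF assms, of "1 + t" 1 0] that by (simp add: algebra_simps)
  from key[OF this] show "q \<bullet> fst (gG (q, p)) = G (q, p)" by (simp add: inner_prod_def inner_commute)
  have "G ((q, p) + t *\<^sub>R (0, q)) = G (q, p) + t * 0" for t
    using G_scale[OF assms, of 1 1 t] by simp
  from key[OF this] show "q \<bullet> snd (gG (q, p)) = 0" by (simp add: inner_prod_def inner_commute)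
qed

lemma tangent_space_M:
  assumes "(q, p) \<in> M" "p \<noteq> 0"
  shows "tangent_space M (q, p) = {v \<in> cot_tangent (q, p). inner (gG (q, p)) v = 0}"
proof (intro equalityI subsetI CollectI conjI)
  have D: "(q, p) \<in> cot_nonzero" using assms M_subset by (auto simp: cot_nonzero_def)
  {
    fix v assume v: "v \<in> tangent_space M (q, p)"
    then show "v \<in> cot_tangent (q, p)" using tangent_cotangent_S2 tangent_space_mono[OF M_subset] by blast
    obtain c \<epsilon> where c: "\<epsilon> > 0" "c ` {-\<epsilon><..<\<epsilon>} \<subseteq> M" "c 0 = (q, p)" "(c has_vector_derivative v) (at (0::real))"
      using v unfolding tangent_space_def by blast
    have "isCont c 0" using c(4) by (rule has_vector_derivative_continuous)
    then have "isCont (\<lambda>t. snd (c t)) 0" by (intro continuous_intros)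
    moreover have "norm p > 0" using assms by simp
    ultimately obtain d where d: "d > 0" "\<And>t. dist t 0 < d \<Longrightarrow> dist (snd (c t)) (snd (c 0)) < norm p"
      unfolding continuous_at_eps_delta by blast
    \<comment> \<open>On this interval the curve also avoids the zero section, so that membership in
      M means G = 1.\<close>
    define \<delta> where "\<delta> = min d \<epsilon>"
    have G1: "G (c t) = 1" if "t \<in> {-\<delta><..<\<delta>}" for t
    proof -
      have "c t \<in> M" using that c(2) by (auto simp: \<delta>_def)
      moreover have "\<bar>t\<bar> < d" using that by (auto simp: \<delta>_def min_def abs_less_iff split: if_splits)
      then have "snd (c t) \<noteq> 0" using d(2)[of t] c(3) by (auto simp: \<delta>_def dist_real_def dist_norm)
      ultimately show ?thesis using M_iff_G[of "fst (c t)" "snd (c t)"] M_subset by (auto simp: cot_nonzero_def)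
    qed
    have "((\<lambda>t. G (c t)) has_derivative (\<lambda>t. inner (gG (q, p)) (t *\<^sub>R v))) (at 0)"
      using has_derivative_compose[OF c(4)[unfolded has_vector_derivative_def], of G "\<lambda>v. inner (gG (q, p)) v"] G_deriv[OF D]
      by (simp add: c(3))
    then have "((\<lambda>t. G (c t)) has_vector_derivative inner (gG (q, p)) v) (at 0)"
      by (simp add: has_vector_derivative_def)
    then show "inner (gG (q, p)) v = 0"
      by (rule has_vector_derivative_const_near[of _ _ \<delta>]) (use G1 c(1) d(1) in \<open>auto simp: \<delta>_def\<close>)
  }
  fix v assume "v \<in> {v \<in> cot_tangent (q, p). inner (gG (q, p)) v = 0}"
  then have v: "v \<in> cot_tangent (q, p)" "inner (gG (q, p)) v = 0" by auto
  obtain V gd where V: "(q, 1 *\<^sub>R p) \<in> V" and d: "\<And>y. y \<in> V \<Longrightarrow> (G has_derivative gd y) (at y)"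
    and t: "\<And>v. (1::real) = 1 \<Longrightarrow> v \<in> cot_tangent (q, p) \<Longrightarrow> gd (q, p) v = 0 \<Longrightarrow> v \<in> tangent_space M (q, p)"
    by (rule G_chart[OF assms zero_less_one]) (rule that; assumption)
  have "gd (q, p) = (\<lambda>v. inner (gG (q, p)) v)"
    using d[of "(q, p)"] V G_deriv[OF D] by (intro has_derivative_unique[of G _ "(q, p)"]) auto
  then show "v \<in> tangent_space M (q, p)" using t v by simp
qed

end

section \<open>The Reeb field and the existence of a shortest closed orbit\<close>

context star_shaped
begin

abbreviation "is_reeb \<equiv> reeb_vector_at M tautological_form"
abbreviation "reeb_orbit \<equiv> periodic_reeb_orbit M tautological_form"

text \<open>The Hamiltonian vector field of G on R^3 x R^3: q' is the p-gradient of G, and p' is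
  minus the q-gradient.\<close>

definition reeb :: "cot \<Rightarrow> cot" where "reeb y = (snd (gG y), - fst (gG y))"

text \<open>The tautological form vanishes on the zero section, so no Reeb vector exists there.
  Working on this part avoids a separate proof that M misses the zero section.\<close>

definition M_nonzero :: "cot set" where "M_nonzero = M \<inter> cot_nonzero"

lemma M_nonzero_iff: "(q, p) \<in> M_nonzero \<longleftrightarrow> (q, p) \<in> M \<and> p \<noteq> 0"
  using M_subset by (auto simp: M_nonzero_def cot_nonzero_def)

text \<open>The exterior derivative paired with the Hamiltonian field is - dG, which vanishes on
  vectors tangent to M. The form itself takes the value p . grad_p G = G = 1 on it.\<close>

lemma reeb_vector_at_reeb:
  assumes "(q, p) \<in> M_nonzero"
  shows "is_reeb (q, p) (reeb (q, p))"
proof -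
  have D: "(q, p) \<in> cot_nonzero" and M: "(q, p) \<in> M" "p \<noteq> 0" using assms by (auto simp: M_nonzero_def cot_nonzero_iff)
  have G1: "G (q, p) = 1" using M_iff_G[OF D] M by simp
  note id = gG_identities[OF D, unfolded G1]
  note T = tangent_space_M[OF M]
  have "reeb (q, p) \<in> tangent_space M (q, p)"
    unfolding T using id by (simp add: cot_tangent_def reeb_def inner_prod_def inner_commute)
  moreover have "ext_deriv tautological_form (q, p) (reeb (q, p)) w = 0" if "w \<in> tangent_space M (q, p)" for w
    using that unfolding T ext_deriv_tautological_form by (simp add: reeb_def inner_prod_def inner_commute)
  ultimately show ?thesis
    unfolding reeb_vector_at_def using id by (simp add: tautological_form_def reeb_def)
qed

text \<open>The difference d of two Reeb vectors pairs to 0 with all vectors tangent to M. It also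
  pairs to 0 with the radial vector (0, p), because the form vanishes on d. Hence it pairs to 0 with
  all of \<open>cot_tangent\<close>, where the symplectic form is nondegenerate.\<close>

lemma reeb_vector_at_unique:
  assumes "(q, p) \<in> M_nonzero" and v: "is_reeb (q, p) v"
  shows "v = reeb (q, p)"
proof -
  have D: "(q, p) \<in> cot_nonzero" and M: "(q, p) \<in> M" "p \<noteq> 0" using assms(1) by (auto simp: M_nonzero_def cot_nonzero_iff)
  have q: "q \<bullet> q = 1" "p \<bullet> q = 0" using D by (auto simp: cot_nonzero_iff norm_eq_1)
  have G1: "G (q, p) = 1" using M_iff_G[OF D] M by simp
  note id = gG_identities[OF D, unfolded G1]
  note T = tangent_space_M[OF M]
  define d where "d = v - reeb (q, p)"
  have r: "is_reeb (q, p) (reeb (q, p))" by (rule reeb_vector_at_reeb[OF assms(1)])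
  have dt: "d \<in> cot_tangent (q, p)"
    using v r unfolding reeb_vector_at_def T d_def by (auto simp: cot_tangent_def inner_diff_left inner_diff_right)
  have pd: "p \<bullet> fst d = 0"
    using v r unfolding reeb_vector_at_def d_def tautological_form_def by (auto simp: inner_diff_right)
  have ext: "snd d \<bullet> fst w - snd w \<bullet> fst d = 0" if w: "w \<in> cot_tangent (q, p)" for w
  proof -
    \<comment> \<open>G has radial derivative 1 on M, so subtracting this radial multiple makes dG
      vanish and \<open>w'\<close> tangent to M.\<close>
    define w' where "w' = w - inner (gG (q, p)) w *\<^sub>R (0, p)"
    have "w' \<in> tangent_space M (q, p)"
      unfolding T w'_def using w id q by (simp add: cot_tangent_def inner_diff_left inner_diff_right inner_prod_def inner_commute)
    then have "ext_deriv tautological_form (q, p) v w' = 0" "ext_deriv tautological_form (q, p) (reeb (q, p)) w' = 0"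
      using v r unfolding reeb_vector_at_def by auto
    then have "snd d \<bullet> fst w' - snd w' \<bullet> fst d = 0"
      unfolding ext_deriv_tautological_form d_def by (simp add: inner_diff_left inner_diff_right)
    moreover have "fst w' = fst w" "snd w' \<bullet> fst d = snd w \<bullet> fst d - inner (gG (q, p)) w * (p \<bullet> fst d)"
      by (simp_all add: w'_def inner_diff_left)
    ultimately show ?thesis using pd by simp
  qed
  have dq: "fst d \<bullet> q = 0" "snd d \<bullet> q + p \<bullet> fst d = 0" using dt by (auto simp: cot_tangent_def)
  have "(0, fst d) \<in> cot_tangent (q, p)" using dq by (simp add: cot_tangent_def)
  from ext[OF this] have f0: "fst d = 0" by simp
  have "snd d \<bullet> q = 0" using dq pd by simp
  \<comment> \<open>The second component is the correction that makes the base direction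
    \<open>snd d\<close> satisfy the linearised constraints.\<close>
  then have "(snd d, - (p \<bullet> snd d) *\<^sub>R q) \<in> cot_tangent (q, p)" using q by (simp add: cot_tangent_def inner_commute)
  from ext[OF this] have "snd d = 0" using f0 by simp
  then show ?thesis using f0 by (simp add: d_def prod_eq_iff)
qed

lemma reeb_iff:
  assumes "y \<in> M"
  shows "is_reeb y v \<longleftrightarrow> y \<in> M_nonzero \<and> v = reeb y"
proof -
  obtain q p where y: "y = (q, p)" by fastforce
  have "p \<noteq> 0" if "is_reeb (q, p) v"
    using that by (auto simp: reeb_vector_at_def tautological_form_def)
  then show ?thesis using reeb_vector_at_unique reeb_vector_at_reeb M_nonzero_iff assms y by blast
qed

lemma periodic_reeb_orbit_iff:
  "reeb_orbit \<gamma> T \<longleftrightarrow>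
     T > 0 \<and> (\<forall>t. \<gamma> (t + T) = \<gamma> t) \<and> (\<forall>t. \<gamma> t \<in> M_nonzero \<and> (\<gamma> has_vector_derivative reeb (\<gamma> t)) (at t))"
proof -
  have "(\<gamma> t \<in> M \<and> (\<exists>v. (\<gamma> has_vector_derivative v) (at t) \<and> is_reeb (\<gamma> t) v)) \<longleftrightarrow>
    (\<gamma> t \<in> M_nonzero \<and> (\<gamma> has_vector_derivative reeb (\<gamma> t)) (at t))" for t
  proof (cases "\<gamma> t \<in> M")
    case True
    show ?thesis unfolding reeb_iff[OF True] using True by blast
  qed (simp add: M_nonzero_def)
  then show ?thesis unfolding periodic_reeb_orbit_def by simp
qed

lemma reeb_actions_eq:
  "reeb_actions M tautological_form = {T. \<exists>\<gamma>. reeb_orbit \<gamma> T}"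
proof (intro equalityI subsetI)
  fix T assume "T \<in> {T. \<exists>\<gamma>. reeb_orbit \<gamma> T}"
  then obtain \<gamma> where \<gamma>: "reeb_orbit \<gamma> T" by blast
  have "T = orbit_action tautological_form \<gamma> T" using periodic_reeb_orbit_action[OF \<gamma>] by simp
  then show "T \<in> reeb_actions M tautological_form" unfolding reeb_actions_def using \<gamma> by blast
qed (auto simp: reeb_actions_def periodic_reeb_orbit_action)

lemma reeb_continuous: "continuous_on cot_nonzero reeb"
  unfolding reeb_def
  using gG_isCont by (intro continuous_intros continuous_at_imp_continuous_on) auto

lemma reeb_nonzero:
  assumes "y \<in> M_nonzero" shows "reeb y \<noteq> 0"
proof -
  obtain q p where y: "y = (q, p)" by fastforce
  have "tautological_form y (reeb y) = 1"
    using reeb_vector_at_reeb[of q p] assms by (simp add: y reeb_vector_at_def)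
  then show ?thesis by (auto simp: tautological_form_def)
qed

text \<open>Radial projection, continuous because G is, maps the compact unit cotangent bundle onto
  this part of M. No statement about M near the zero section is required.\<close>

lemma compact_M_nonzero: "compact M_nonzero"
proof -
  let ?B = "{y :: cot. norm (fst y) = 1 \<and> norm (snd y) = 1 \<and> snd y \<bullet> fst y = 0}"
  have "closed ?B" by (intro closed_Collect_conj closed_Collect_eq continuous_intros)
  moreover have "?B \<subseteq> sphere 0 1 \<times> sphere 0 1" by auto
  then have "bounded ?B" by (rule bounded_subset[rotated]) (intro bounded_Times bounded_sphere)
  ultimately have B: "compact ?B" by (simp add: compact_eq_bounded_closed)
  have sub: "?B \<subseteq> cot_nonzero" using cot_nonzero_iff by fastforce
  have Gc: "continuous_on ?B G"
    using G_deriv sub by (intro continuous_at_imp_continuous_on ballI has_derivative_continuous) blast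
  have G0: "G y \<noteq> 0" if "y \<in> ?B" for y using that sub G_pos_M(1)[of "fst y" "snd y"] by fastforce
  let ?f = "\<lambda>y. (fst y, (1 / G y) *\<^sub>R snd y)"
  have "M_nonzero = ?f ` ?B"
  proof (intro equalityI subsetI)
    fix y assume y: "y \<in> M_nonzero"
    obtain q p where qp: "y = (q, p)" by fastforce
    have D: "(q, p) \<in> cot_nonzero" and G1: "G (q, p) = 1"
      using y qp M_iff_G by (auto simp: M_nonzero_def)
    then have p0: "norm p > 0" by (simp add: cot_nonzero_iff)
    have "G (1 *\<^sub>R q, (1 / norm p) *\<^sub>R p + 0 *\<^sub>R q) = 1 * (1 / norm p) * G (q, p)"
      by (rule G_scale[OF D]) (use p0 in auto)
    then have "G (q, (1 / norm p) *\<^sub>R p) = 1 / norm p" using G1 by simp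
    then have "y = ?f (q, (1 / norm p) *\<^sub>R p)" using p0 by (simp add: qp)
    moreover have "(q, (1 / norm p) *\<^sub>R p) \<in> ?B" using D p0 by (simp add: cot_nonzero_iff)
    ultimately show "y \<in> ?f ` ?B" by blast
  next
    fix y assume "y \<in> ?f ` ?B"
    then obtain q p where qp: "(q, p) \<in> ?B" "y = (q, (1 / G (q, p)) *\<^sub>R p)" by auto
    then have D: "(q, p) \<in> cot_nonzero" using sub by blast
    have "p \<noteq> 0" using D by (simp add: cot_nonzero_iff)
    then show "y \<in> M_nonzero" using G_pos_M[OF D] qp(2) by (simp add: M_nonzero_iff)
  qed
  moreover have "compact (?f ` ?B)"
    by (intro compact_continuous_image[OF _ B] continuous_intros Gc) (use G0 in blast)
  ultimately show ?thesis by simp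
qed

text \<open>Orbits whose periods approach the infimum are rescaled to period 1, so that Arzela--Ascoli applies; the
  infimum is not 0 because the Reeb field has no zeros.\<close>

lemma has_min_action_if_orbit:
  assumes orb: "reeb_orbit \<gamma>0 T0"
  shows "has_min_action M tautological_form"
proof -
  define P where "P = {T. \<exists>\<gamma>. reeb_orbit \<gamma> T}"
  have P0: "P \<noteq> {}" using orb by (auto simp: P_def)
  have Ppos: "T > 0" if "T \<in> P" for T using that by (auto simp: P_def periodic_reeb_orbit_iff)
  have bdd: "bdd_below P" using Ppos by (meson bdd_belowI less_imp_le)
  define \<tau> where "\<tau> = Inf P"
  have \<tau>0: "\<tau> \<ge> 0" unfolding \<tau>_def using P0 Ppos by (intro cInf_greatest) (auto intro: less_imp_le)
  have "\<exists>T\<in>P. T < \<tau> + 1 / real (Suc n)" for n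
    using cInf_lessD[OF P0, of "\<tau> + 1 / real (Suc n)"] by (auto simp: \<tau>_def)
  then obtain T where T: "\<And>n. T n \<in> P" "\<And>n. T n < \<tau> + 1 / real (Suc n)" by metis
  have T\<tau>: "\<tau> \<le> T n" for n unfolding \<tau>_def by (rule cInf_lower[OF T(1) bdd])
  have Tpos: "T n > 0" for n using Ppos T(1) by blast
  have Tlim: "T \<longlonglongrightarrow> \<tau>"
  proof (rule real_tendsto_sandwich[of "\<lambda>_. \<tau>" T _ "\<lambda>n. \<tau> + 1 / real (Suc n)"])
    show "(\<lambda>n. \<tau> + 1 / real (Suc n)) \<longlonglongrightarrow> \<tau>"
      using tendsto_add[OF tendsto_const LIMSEQ_inverse_real_of_nat, of \<tau>] by (simp add: inverse_eq_divide)
  qed (use T\<tau> T(2) in \<open>auto intro: less_imp_le always_eventually\<close>)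
  have Tb: "T n \<le> \<tau> + 1" for n
  proof -
    have "1 / real (Suc n) \<le> 1" by simp
    then show ?thesis using T(2)[of n] by linarith
  qed
  have "\<forall>n. \<exists>\<gamma>. reeb_orbit \<gamma> (T n)" using T(1) by (auto simp: P_def)
  then obtain \<gamma> where \<gamma>: "\<And>n. reeb_orbit (\<gamma> n) (T n)" by metis
  define \<beta> where "\<beta> n t = \<gamma> n (T n * t)" for n t
  have \<beta>M: "\<beta> n t \<in> M_nonzero" for n t using \<gamma>[of n] by (simp add: \<beta>_def periodic_reeb_orbit_iff)
  have \<beta>per: "\<beta> n (t + 1) = \<beta> n t" for n t
    using \<gamma>[of n] by (simp add: \<beta>_def periodic_reeb_orbit_iff distrib_left)
  have \<beta>d: "(\<beta> n has_vector_derivative T n *\<^sub>R reeb (\<beta> n t)) (at t)" for n t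
  proof -
    have "((\<lambda>t. T n * t) has_vector_derivative T n) (at t)"
      by (auto intro!: derivative_eq_intros simp flip: has_real_derivative_iff_has_vector_derivative)
    moreover have "(\<gamma> n has_vector_derivative reeb (\<beta> n t)) (at (T n * t))"
      using \<gamma>[of n] by (simp add: \<beta>_def periodic_reeb_orbit_iff)
    ultimately show ?thesis unfolding \<beta>_def[abs_def] using vector_diff_chain_at[of "\<lambda>t. T n * t" "T n" t "\<gamma> n"]
      by (simp add: o_def \<beta>_def)
  qed
  have "bounded M_nonzero" "bounded (reeb ` M_nonzero)"
    using compact_M_nonzero by (auto intro!: compact_imp_bounded compact_continuous_image
        continuous_on_subset[OF reeb_continuous] simp: M_nonzero_def)
  then obtain B K where B: "\<And>y. y \<in> M_nonzero \<Longrightarrow> norm y \<le> B" and K: "K > 0" "\<And>y. y \<in> M_nonzero \<Longrightarrow> norm (reeb y) \<le> K"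
    unfolding bounded_pos by auto
  define C where "C = (\<tau> + 1) * K"
  have C: "C > 0" using \<tau>0 K(1) by (simp add: C_def)
  have lip: "norm (\<beta> n t - \<beta> n s) \<le> C * \<bar>t - s\<bar>" for n t s
  proof -
    have "norm (\<beta> n t - \<beta> n s) \<le> C * norm (t - s)"
    proof (rule differentiable_bound[of UNIV _ "\<lambda>x h. h *\<^sub>R (T n *\<^sub>R reeb (\<beta> n x))"])
      show "(\<beta> n has_derivative (\<lambda>h. h *\<^sub>R (T n *\<^sub>R reeb (\<beta> n x)))) (at x within UNIV)" for x
        using \<beta>d by (simp add: has_vector_derivative_def)
      show "onorm (\<lambda>h. h *\<^sub>R (T n *\<^sub>R reeb (\<beta> n x))) \<le> C" for x
      proof (rule onorm_le)
        fix h :: real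
        have "T n * norm (reeb (\<beta> n x)) \<le> C" unfolding C_def
          using Tb Tpos[of n] \<tau>0 K(2)[OF \<beta>M] by (intro mult_mono) auto
        then show "norm (h *\<^sub>R (T n *\<^sub>R reeb (\<beta> n x))) \<le> C * norm h"
          using Tpos[of n] mult_left_mono[of "T n * norm (reeb (\<beta> n x))" C "\<bar>h\<bar>"] by (simp add: mult.commute abs_mult)
      qed
    qed auto
    then show ?thesis by simp
  qed
  obtain g k where k: "strict_mono (k :: nat \<Rightarrow> nat)" and
    lim: "\<And>e. 0 < e \<Longrightarrow> \<exists>N. \<forall>n x. n \<ge> N \<and> x \<in> {0..1} \<longrightarrow> norm (\<beta> (k n) x - g x) < e"
  proof (rule Arzela_Ascoli[of "{0..1::real}" \<beta> B])
    show "\<exists>d>0. \<forall>n y. y \<in> {0..1} \<and> norm (x - y) < d \<longrightarrow> norm (\<beta> n x - \<beta> n y) < e" if "e > 0" for x e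
    proof (intro exI[of _ "e / C"] conjI allI impI)
      show "e / C > 0" using C that by simp
      fix n y assume "y \<in> {0..1} \<and> norm (x - y) < e / C"
      then have "C * \<bar>x - y\<bar> < e" using C by (simp add: field_simps)
      then show "norm (\<beta> n x - \<beta> n y) < e" using lip[of n x y] by linarith
    qed
  qed (use \<beta>M B in auto)
  have lim01: "(\<lambda>n. \<beta> (k n) t) \<longlonglongrightarrow> g t" if "t \<in> {0..1}" for t
    using lim that by (intro LIMSEQ_I) blast
  note perz = periodic_of_int[of "\<beta> _" 1, OF \<beta>per, simplified]
  define x where "x t = g (frac t)" for t
  have xlim: "(\<lambda>n. \<beta> (k n) t) \<longlonglongrightarrow> x t" for t
  proof -
    have "\<beta> n (frac t) = \<beta> n t" for n using perz[of n "frac t" "\<lfloor>t\<rfloor>"] by (simp add: frac_def)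
    then show ?thesis using lim01[of "frac t"] frac_lt_1[of t] frac_ge_0[of t] unfolding x_def by (simp add: less_imp_le)
  qed
  have xM: "x t \<in> M_nonzero" for t
    using closed_sequentially[OF compact_imp_closed[OF compact_M_nonzero] _ xlim] \<beta>M by blast
  have xper: "x (t + 1) = x t" for t by (rule LIMSEQ_unique[OF xlim]) (use xlim[of t] \<beta>per in simp)
  have xlip: "norm (x t - x s) \<le> C * \<bar>t - s\<bar>" for t s
    by (rule LIMSEQ_le_const2[OF tendsto_norm[OF tendsto_diff[OF xlim xlim]]]) (use lip in auto)
  have xc: "continuous_on S x" for S
  proof (rule continuous_on_subset[OF _ subset_UNIV])
    show "continuous_on UNIV x" unfolding continuous_on_iff
    proof (intro ballI allI impI)
      fix t e :: real assume e: "e > 0"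
      show "\<exists>d>0. \<forall>x'\<in>UNIV. dist x' t < d \<longrightarrow> dist (x x') (x t) < e"
      proof (intro exI[of _ "e / C"] conjI ballI impI)
        show "e / C > 0" using C e by simp
        fix s assume "dist s t < e / C"
        then have "C * \<bar>s - t\<bar> < e" using C by (simp add: field_simps dist_real_def)
        then show "dist (x s) (x t) < e" using xlip[of s t] by (simp add: dist_norm)
      qed
    qed
  qed
  have rb: "isCont reeb y" if "y \<in> M_nonzero" for y
  proof -
    have "isCont gG y" using gG_isCont that by (auto simp: M_nonzero_def)
    then show ?thesis unfolding reeb_def[abs_def] by (intro continuous_intros)
  qed
  have reeblim: "(\<lambda>n. reeb (\<beta> (k n) t)) \<longlonglongrightarrow> reeb (x t)" for t
    by (rule isCont_tendsto_compose[OF rb[OF xM] xlim])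
  have \<beta>c: "continuous_on S (\<beta> n)" for S n
    using \<beta>d by (meson continuous_at_imp_continuous_on has_vector_derivative_continuous)
  have rxc: "continuous_on S (\<lambda>t. reeb (x t))" for S
    by (rule continuous_on_compose2[OF reeb_continuous xc]) (use xM in \<open>auto simp: M_nonzero_def\<close>)
  have r\<beta>c: "continuous_on S (\<lambda>t. reeb (\<beta> n t))" for S n
    by (rule continuous_on_compose2[OF reeb_continuous \<beta>c]) (use \<beta>M in \<open>auto simp: M_nonzero_def\<close>)
  have Ilim: "(\<lambda>n. integral {s..t} (\<lambda>t. reeb (\<beta> (k n) t))) \<longlonglongrightarrow> integral {s..t} (\<lambda>t. reeb (x t))" for s t
    by (rule dominated_convergence(2)[where h = "\<lambda>_. K"])
      (use K(2)[OF \<beta>M] reeblim in \<open>auto intro: integrable_continuous_real r\<beta>c\<close>)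
  have \<beta>I: "\<beta> n t - \<beta> n s = T n *\<^sub>R integral {s..t} (\<lambda>t. reeb (\<beta> n t))" if "s \<le> t" for n s t
  proof -
    have "((\<lambda>t. T n *\<^sub>R reeb (\<beta> n t)) has_integral \<beta> n t - \<beta> n s) {s..t}"
      by (rule fundamental_theorem_of_calculus[OF that]) (rule has_vector_derivative_at_within[OF \<beta>d])
    from integral_unique[OF this] show ?thesis by simp
  qed
  have Tk: "(\<lambda>n. T (k n)) \<longlonglongrightarrow> \<tau>" using LIMSEQ_subseq_LIMSEQ[OF Tlim k] by (simp add: o_def)
  have xI: "x t - x s = \<tau> *\<^sub>R integral {s..t} (\<lambda>t. reeb (x t))" if "s \<le> t" for s t
  proof (rule LIMSEQ_unique)
    show "(\<lambda>n. \<beta> (k n) t - \<beta> (k n) s) \<longlonglongrightarrow> x t - x s" by (intro tendsto_intros xlim)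
    show "(\<lambda>n. \<beta> (k n) t - \<beta> (k n) s) \<longlonglongrightarrow> \<tau> *\<^sub>R integral {s..t} (\<lambda>t. reeb (x t))"
      unfolding \<beta>I[OF that] by (intro tendsto_intros Tk Ilim)
  qed
  \<comment> \<open>If the periods tended to 0, the limit would stay at one point. Each rescaled
    orbit closes up, so the Reeb field has integral 0 along it; in the limit the field would vanish
    at that point.\<close>
  have "\<tau> \<noteq> 0"
  proof
    assume "\<tau> = 0"
    then have const: "x t = x 0" if "t \<ge> 0" for t using xI[OF that] by simp
    have rconst: "reeb (x t) = reeb (x 0)" if "t \<in> {0..1}" for t using const[of t] that by simp
    have "integral {0..1} (\<lambda>t. reeb (x t)) = integral {0..1::real} (\<lambda>t. reeb (x 0))"
      by (rule Henstock_Kurzweil_Integration.integral_cong) (rule rconst)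
    then have "(\<lambda>n. integral {0..1} (\<lambda>t. reeb (\<beta> (k n) t))) \<longlonglongrightarrow> reeb (x 0)" using Ilim[of 0 1] by simp
    moreover have "integral {0..1} (\<lambda>t. reeb (\<beta> (k n) t)) = 0" for n
      using \<beta>I[of 0 1 "k n"] \<beta>per[of "k n" 0] Tpos[of "k n"] by simp
    ultimately have "reeb (x 0) = 0" by (simp add: LIMSEQ_const_iff)
    then show False using reeb_nonzero[OF xM] by simp
  qed
  then have \<tau>: "\<tau> > 0" using \<tau>0 by simp
  \<comment> \<open>The integral equation upgrades the limit to a C^1 solution; starting the
    integral at t - 1 makes t an interior point.\<close>
  have xd: "(x has_vector_derivative \<tau> *\<^sub>R reeb (x t)) (at t)" for t
  proof -
    have "((\<lambda>s. integral {t-1..s} (\<lambda>t. reeb (x t))) has_vector_derivative reeb (x t)) (at t within {t-1..t+1})"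
      by (rule integral_has_vector_derivative[OF rxc]) auto
    then have "((\<lambda>s. integral {t-1..s} (\<lambda>t. reeb (x t))) has_vector_derivative reeb (x t)) (at t)"
      by (simp add: at_within_Icc_at)
    from has_vector_derivative_add[OF has_vector_derivative_const bounded_linear.has_vector_derivative[OF bounded_linear_scaleR_right this, of \<tau>], of "x (t-1)"]
    have "((\<lambda>s. x (t-1) + \<tau> *\<^sub>R integral {t-1..s} (\<lambda>t. reeb (x t))) has_vector_derivative \<tau> *\<^sub>R reeb (x t)) (at t)" by simp
    then show ?thesis
    proof (rule has_vector_derivative_transform_within_open[where S = "{t-1<..<t+1}"])
      fix s assume "s \<in> {t-1<..<t+1}"
      then show "x (t-1) + \<tau> *\<^sub>R integral {t-1..s} (\<lambda>t. reeb (x t)) = x s" using xI[of "t-1" s] by (simp add: algebra_simps)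
    qed auto
  qed
  have "reeb_orbit (\<lambda>t. x (t / \<tau>)) \<tau>"
    unfolding periodic_reeb_orbit_iff
  proof (intro conjI allI)
    show "x ((t + \<tau>) / \<tau>) = x (t / \<tau>)" for t using xper[of "t / \<tau>"] \<tau> by (simp add: add_divide_distrib)
    show "((\<lambda>t. x (t / \<tau>)) has_vector_derivative reeb (x (t / \<tau>))) (at t)" for t
    proof -
      have "((\<lambda>t. t / \<tau>) has_vector_derivative 1 / \<tau>) (at t)"
        using \<tau> by (auto intro!: derivative_eq_intros simp flip: has_real_derivative_iff_has_vector_derivative)
      from vector_diff_chain_at[OF this xd] show ?thesis using \<tau> by (simp add: o_def)
    qed
  qed (use \<tau> xM in auto)
  then have "\<tau> \<in> P" by (auto simp: P_def)
  moreover have "\<tau> \<le> T" if "T \<in> P" for T unfolding \<tau>_def by (rule cInf_lower[OF that bdd])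
  ultimately show ?thesis unfolding has_min_action_def reeb_actions_eq P_def[symmetric] by blast
qed

end

section \<open>The Hopf covering\<close>

text \<open>With \<open>x = z + w j\<close> a quaternion, \<open>hopf_q x\<close> and \<open>hopf_p x\<close> are the conjugates of \<open>k\<close> and \<open>j\<close>, that is,
  \<open>x\<^sup>* k x\<close> and \<open>x\<^sup>* j x\<close> for the quaternion conjugate \<open>x\<^sup>*\<close> of \<open>x\<close>.\<close>

definition vec3 :: "real \<Rightarrow> real \<Rightarrow> real \<Rightarrow> real ^ 3" where
  "vec3 u v w = u *\<^sub>R axis 1 1 + v *\<^sub>R axis 2 1 + w *\<^sub>R axis 3 1"

lemma vec3_nth [simp]: "vec_nth (vec3 u v w) 1 = u" "vec_nth (vec3 u v w) 2 = v" "vec_nth (vec3 u v w) 3 = w"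
  by (simp_all add: vec3_def axis_def)

lemma inner_vec3: fixes \<alpha> \<beta> :: "real ^ 3" shows "inner \<alpha> \<beta> = vec_nth \<alpha> 1 * vec_nth \<beta> 1 + vec_nth \<alpha> 2 * vec_nth \<beta> 2 + vec_nth \<alpha> 3 * vec_nth \<beta> 3"
  by (simp add: inner_vec_def sum_3)

definition hopf_p :: "c2 \<Rightarrow> real ^ 3" where
  "hopf_p x = vec3 (2 * (Re (fst x) * Im (snd x) + Im (fst x) * Re (snd x)))
     ((Re (fst x))\<^sup>2 - (Im (fst x))\<^sup>2 + (Re (snd x))\<^sup>2 - (Im (snd x))\<^sup>2)
     (2 * (Re (snd x) * Im (snd x) - Re (fst x) * Im (fst x)))"

definition hopf_q :: "c2 \<Rightarrow> real ^ 3" where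
  "hopf_q x = vec3 (2 * (Im (fst x) * Im (snd x) - Re (fst x) * Re (snd x)))
     (2 * (Re (fst x) * Im (fst x) + Re (snd x) * Im (snd x)))
     ((Re (fst x))\<^sup>2 - (Im (fst x))\<^sup>2 - (Re (snd x))\<^sup>2 + (Im (snd x))\<^sup>2)"

definition dhopf_p :: "c2 \<Rightarrow> c2 \<Rightarrow> real ^ 3" where
  "dhopf_p x h = vec3
     (2 * (Re (fst h) * Im (snd x) + Re (fst x) * Im (snd h) + Im (fst h) * Re (snd x) + Im (fst x) * Re (snd h)))
     (2 * (Re (fst x) * Re (fst h) - Im (fst x) * Im (fst h) + Re (snd x) * Re (snd h) - Im (snd x) * Im (snd h)))
     (2 * (Re (snd h) * Im (snd x) + Re (snd x) * Im (snd h) - Re (fst h) * Im (fst x) - Re (fst x) * Im (fst h)))"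

definition dhopf_q :: "c2 \<Rightarrow> c2 \<Rightarrow> real ^ 3" where
  "dhopf_q x h = vec3
     (2 * (Im (fst h) * Im (snd x) + Im (fst x) * Im (snd h) - Re (fst h) * Re (snd x) - Re (fst x) * Re (snd h)))
     (2 * (Re (fst h) * Im (fst x) + Re (fst x) * Im (fst h) + Re (snd h) * Im (snd x) + Re (snd x) * Im (snd h)))
     (2 * (Re (fst x) * Re (fst h) - Im (fst x) * Im (fst h) - Re (snd x) * Re (snd h) + Im (snd x) * Im (snd h)))"

text \<open>The adjoint of \<open>dhopf_p x\<close> applied to \<beta>, that is, the gradient at x
  of the quadratic function y -> hopf_p y . \<beta>; \<open>grad_q\<close> has the same role for
  \<open>hopf_q\<close>.\<close>

definition grad_p :: "c2 \<Rightarrow> real ^ 3 \<Rightarrow> c2" where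
  "grad_p x \<beta> = 2 *\<^sub>R
    (Complex (Im (snd x) * vec_nth \<beta> 1 + Re (fst x) * vec_nth \<beta> 2 - Im (fst x) * vec_nth \<beta> 3)
       (Re (snd x) * vec_nth \<beta> 1 - Im (fst x) * vec_nth \<beta> 2 - Re (fst x) * vec_nth \<beta> 3),
     Complex (Im (fst x) * vec_nth \<beta> 1 + Re (snd x) * vec_nth \<beta> 2 + Im (snd x) * vec_nth \<beta> 3)
       (Re (fst x) * vec_nth \<beta> 1 - Im (snd x) * vec_nth \<beta> 2 + Re (snd x) * vec_nth \<beta> 3))"

definition grad_q :: "c2 \<Rightarrow> real ^ 3 \<Rightarrow> c2" where
  "grad_q x \<alpha> = 2 *\<^sub>R
    (Complex (- Re (snd x) * vec_nth \<alpha> 1 + Im (fst x) * vec_nth \<alpha> 2 + Re (fst x) * vec_nth \<alpha> 3)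
       (Im (snd x) * vec_nth \<alpha> 1 + Re (fst x) * vec_nth \<alpha> 2 - Im (fst x) * vec_nth \<alpha> 3),
     Complex (- Re (fst x) * vec_nth \<alpha> 1 + Im (snd x) * vec_nth \<alpha> 2 - Re (snd x) * vec_nth \<alpha> 3)
       (Im (fst x) * vec_nth \<alpha> 1 + Re (snd x) * vec_nth \<alpha> 2 + Im (snd x) * vec_nth \<alpha> 3))"

lemma norm_c2: "(norm (x :: c2))\<^sup>2 = (Re (fst x))\<^sup>2 + (Im (fst x))\<^sup>2 + (Re (snd x))\<^sup>2 + (Im (snd x))\<^sup>2"
  by (simp add: norm_prod_def cmod_power2)

lemmas hopf_simps = hopf_p_def hopf_q_def dhopf_p_def dhopf_q_def grad_p_def grad_q_def inner_vec3
  inner_prod_def inner_complex_def norm_c2 cmul_def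

lemma c2_cases: obtains a b c d where "x = (Complex a b, Complex c d)"
  by (cases x, cases "fst x", cases "snd x") auto

text \<open>Conjugation by a quaternion x multiplies lengths by |x|^2 and preserves angles, and j is
  orthogonal to k.\<close>

lemma hopf_norms: "hopf_p x \<bullet> hopf_p x = ((norm x)\<^sup>2)\<^sup>2" "hopf_q x \<bullet> hopf_q x = ((norm x)\<^sup>2)\<^sup>2" "hopf_p x \<bullet> hopf_q x = 0"
  by (cases x rule: c2_cases; simp add: hopf_simps; simp add: algebra_simps power2_eq_square)+

lemma inner_grad: "inner (grad_p x \<beta>) h = inner \<beta> (dhopf_p x h)" "inner (grad_q x \<alpha>) h = inner \<alpha> (dhopf_q x h)"
  by (cases x rule: c2_cases; cases h rule: c2_cases; simp add: hopf_simps; simp add: algebra_simps)+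

lemma vec3_eqI: "vec_nth u 1 = vec_nth v 1 \<Longrightarrow> vec_nth u 2 = vec_nth v 2 \<Longrightarrow> vec_nth u 3 = vec_nth v 3 \<Longrightarrow> u = (v :: real ^ 3)"
  by (simp add: vec_eq_iff forall_3)

text \<open>The Poisson brackets between the components of the two maps, as polynomial identities;
  the factor |x|^2 clears denominators. The last two hold because left multiplication by e^(i t)
  amounts to a rotation of the plane of j and k through the angle 2 t.\<close>

lemma hopf_poisson:
  "(norm x)\<^sup>2 *\<^sub>R dhopf_p x (cmul \<i> (grad_p x \<beta>)) = 4 *\<^sub>R ((hopf_q x \<bullet> \<beta>) *\<^sub>R hopf_p x - (hopf_p x \<bullet> \<beta>) *\<^sub>R hopf_q x)"
  "(norm x)\<^sup>2 *\<^sub>R dhopf_q x (cmul \<i> (grad_q x \<alpha>)) = 4 *\<^sub>R ((hopf_q x \<bullet> \<alpha>) *\<^sub>R hopf_p x - (hopf_p x \<bullet> \<alpha>) *\<^sub>R hopf_q x)"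
  "dhopf_p x (cmul \<i> (grad_q x \<alpha>)) = - (4 * (norm x)\<^sup>2) *\<^sub>R \<alpha>"
  "dhopf_q x (cmul \<i> (grad_p x \<beta>)) = (4 * (norm x)\<^sup>2) *\<^sub>R \<beta>"
  "dhopf_p x (cmul \<i> x) = - 2 *\<^sub>R hopf_q x" "dhopf_q x (cmul \<i> x) = 2 *\<^sub>R hopf_p x"
  by (cases x rule: c2_cases; rule vec3_eqI; simp add: hopf_simps; simp add: algebra_simps power2_eq_square)+

lemma hopf_has_derivative: "(hopf_p has_derivative dhopf_p x) (at x)" "(hopf_q has_derivative dhopf_q x) (at x)"
proof -
  have re: "((\<lambda>x. Re (fst x)) has_derivative (\<lambda>h. Re (fst h))) (at x)" "((\<lambda>x. Im (fst x)) has_derivative (\<lambda>h. Im (fst h))) (at x)"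
    "((\<lambda>x. Re (snd x)) has_derivative (\<lambda>h. Re (snd h))) (at x)" "((\<lambda>x. Im (snd x)) has_derivative (\<lambda>h. Im (snd h))) (at x)" for x :: c2
    by (intro has_derivative_Re has_derivative_Im has_derivative_fst has_derivative_snd has_derivative_ident)+
  show "(hopf_p has_derivative dhopf_p x) (at x)"
    unfolding hopf_p_def[abs_def] vec3_def power2_eq_square
    by (rule has_derivative_eq_rhs,
        (rule has_derivative_add has_derivative_diff has_derivative_scaleR_left has_derivative_mult_right has_derivative_mult re)+,
        simp add: fun_eq_iff dhopf_p_def vec3_def algebra_simps)
  show "(hopf_q has_derivative dhopf_q x) (at x)"
    unfolding hopf_q_def[abs_def] vec3_def power2_eq_square
    by (rule has_derivative_eq_rhs,
        (rule has_derivative_add has_derivative_diff has_derivative_scaleR_left has_derivative_mult_right has_derivative_mult re)+,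
        simp add: fun_eq_iff dhopf_q_def vec3_def algebra_simps)
qed

text \<open>Only the base point is normalised. It is then unchanged by scaling x, while the covector
  has norm |x|^2, so that the gauge pulls back to a 2-homogeneous function.\<close>

definition hopf :: "c2 \<Rightarrow> cot" where "hopf x = ((1 / (norm x)\<^sup>2) *\<^sub>R hopf_q x, hopf_p x)"

definition dhopf :: "c2 \<Rightarrow> c2 \<Rightarrow> cot" where
  "dhopf x h = ((1 / (norm x)\<^sup>2) *\<^sub>R dhopf_q x h - (2 * inner x h / ((norm x)\<^sup>2)\<^sup>2) *\<^sub>R hopf_q x, dhopf_p x h)"

lemma hopf_has_derivative':
  assumes "x \<noteq> 0" shows "(hopf has_derivative dhopf x) (at x)"
proof -
  have n: "(norm x)\<^sup>2 \<noteq> 0" using assms by simp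
  have "((\<lambda>x. inner x x) has_derivative (\<lambda>h. 2 * inner x h)) (at x)"
    by (rule has_derivative_eq_rhs, rule has_derivative_inner[OF has_derivative_ident has_derivative_ident])
      (simp add: fun_eq_iff inner_commute)
  then have "((\<lambda>x. (norm x)\<^sup>2) has_derivative (\<lambda>h. 2 * inner x h)) (at x)"
    by (simp add: power2_norm_eq_inner)
  from has_derivative_divide'[OF has_derivative_const this n, of 1]
  have "((\<lambda>x. 1 / (norm x)\<^sup>2) has_derivative (\<lambda>h. - (2 * inner x h / ((norm x)\<^sup>2)\<^sup>2))) (at x)"
    by (simp add: power2_eq_square)
  from has_derivative_Pair[OF has_derivative_scaleR[OF this hopf_has_derivative(2)] hopf_has_derivative(1)]
  show ?thesis unfolding hopf_def[abs_def]
    by (rule has_derivative_eq_rhs) (simp add: fun_eq_iff dhopf_def)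
qed

lemma norm_hopf_p: "norm (hopf_p x) = (norm x)\<^sup>2" and norm_hopf_q: "norm (hopf_q x) = (norm x)\<^sup>2"
  by (simp_all add: norm_eq_sqrt_inner hopf_norms)

lemma hopf_in: "x \<noteq> 0 \<Longrightarrow> hopf x \<in> cot_nonzero"
  by (simp add: hopf_def cot_nonzero_iff norm_hopf_q hopf_norms(3)) (metis norm_hopf_p norm_zero zero_eq_power2 norm_eq_zero)

lemma hopf_scale: "s > 0 \<Longrightarrow> hopf (s *\<^sub>R x) = (fst (hopf x), s\<^sup>2 *\<^sub>R snd (hopf x))"
proof -
  assume s: "s > 0"
  have "hopf_q (s *\<^sub>R x) = s\<^sup>2 *\<^sub>R hopf_q x" "hopf_p (s *\<^sub>R x) = s\<^sup>2 *\<^sub>R hopf_p x"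
    by (rule vec3_eqI; simp add: hopf_simps; simp add: algebra_simps power2_eq_square)+
  then show ?thesis using s by (simp add: hopf_def power_mult_distrib)
qed

lemma hopf_minus: "hopf (- x) = hopf x"
  by (simp add: hopf_def hopf_q_def hopf_p_def)

text \<open>Up to the factor 4 the covering is symplectic, so the Hamiltonian field of a pulled-back
  function is carried to four times the field below. Here \<alpha> and \<beta> are the q- and
  p-gradients of G and f is its value; the hypotheses are Euler's identities. The middle term of
  \<open>g\<close> comes from differentiating 1 / |x|^2.\<close>

lemma hopf_gradient_flow:
  fixes \<alpha> \<beta> :: "real ^ 3"
  assumes x: "x \<noteq> 0" and \<alpha>: "fst (hopf x) \<bullet> \<alpha> = f" and \<beta>: "fst (hopf x) \<bullet> \<beta> = 0" "snd (hopf x) \<bullet> \<beta> = f"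
    and g: "g = (1 / (norm x)\<^sup>2) *\<^sub>R grad_q x \<alpha> - (2 * f / (norm x)\<^sup>2) *\<^sub>R x + grad_p x \<beta>"
  shows "dhopf x (cmul \<i> g) = 4 *\<^sub>R (\<beta>, - \<alpha>)" "inner g h = inner (\<alpha>, \<beta>) (dhopf x h)"
proof -
  define r where "r = (norm x)\<^sup>2"
  have r: "r > 0" using x by (simp add: r_def)
  have c\<alpha>: "hopf_q x \<bullet> \<alpha> = r * f" using \<alpha> r by (simp add: hopf_def r_def field_simps)
  have c\<beta>: "hopf_q x \<bullet> \<beta> = 0" "hopf_p x \<bullet> \<beta> = f" using \<beta> r by (simp_all add: hopf_def r_def)
  interpret c: bounded_linear "cmul \<i>" by (rule bounded_linear_cmul)
  interpret p: bounded_linear "dhopf_p x" using hopf_has_derivative(1) by (rule has_derivative_bounded_linear)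
  interpret q: bounded_linear "dhopf_q x" using hopf_has_derivative(2) by (rule has_derivative_bounded_linear)
  note P = hopf_poisson[of x, folded r_def]
  have 1: "dhopf_p x (cmul \<i> (grad_p x \<beta>)) = - (4 * f / r) *\<^sub>R hopf_q x"
  proof -
    have "r *\<^sub>R dhopf_p x (cmul \<i> (grad_p x \<beta>)) = r *\<^sub>R (- (4 * f / r) *\<^sub>R hopf_q x)"
      unfolding P(1) c\<beta> using r by simp
    then show ?thesis using r by (simp only: scaleR_cancel_left) simp
  qed
  have 2: "dhopf_q x (cmul \<i> (grad_q x \<alpha>)) = (4 * f) *\<^sub>R hopf_p x - (4 * (hopf_p x \<bullet> \<alpha>) / r) *\<^sub>R hopf_q x"
  proof -
    have "r *\<^sub>R dhopf_q x (cmul \<i> (grad_q x \<alpha>)) = r *\<^sub>R ((4 * f) *\<^sub>R hopf_p x - (4 * (hopf_p x \<bullet> \<alpha>) / r) *\<^sub>R hopf_q x)"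
      unfolding P(2) c\<alpha> using r by (simp add: algebra_simps)
    then show ?thesis using r by (simp only: scaleR_cancel_left) simp
  qed
  have cg: "cmul \<i> g = (1 / r) *\<^sub>R cmul \<i> (grad_q x \<alpha>) - (2 * f / r) *\<^sub>R cmul \<i> x + cmul \<i> (grad_p x \<beta>)"
    unfolding g r_def[symmetric] by (simp only: c.add c.diff c.scaleR)
  have pp: "dhopf_p x (cmul \<i> g) = - 4 *\<^sub>R \<alpha>"
    unfolding cg p.add p.diff p.scaleR P(3,5) 1 using r by (simp add: algebra_simps)
  have qq: "dhopf_q x (cmul \<i> g) = - (4 * (hopf_p x \<bullet> \<alpha>) / r\<^sup>2) *\<^sub>R hopf_q x + (4 * r) *\<^sub>R \<beta>"
    unfolding cg q.add q.diff q.scaleR P(4,6) 2 using r by (simp add: algebra_simps power2_eq_square)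
  have ix: "inner x (cmul \<i> y) = - inner y (cmul \<i> x)" for y
    by (simp add: cmul_def inner_prod_def inner_complex_def)
  \<comment> \<open>The radial part of i g enters \<open>dhopf\<close> through the derivative of the
    normalising factor 1 / |x|^2.\<close>
  have xg: "inner x (cmul \<i> g) = - (2 / r) * (hopf_p x \<bullet> \<alpha>)"
  proof -
    have "inner g (cmul \<i> x) = (1 / r) * inner (grad_q x \<alpha>) (cmul \<i> x) - (2 * f / r) * inner x (cmul \<i> x) + inner (grad_p x \<beta>) (cmul \<i> x)"
      unfolding g r_def[symmetric] by (simp only: inner_add_left inner_diff_left inner_scaleR_left)
    also have "\<dots> = (1 / r) * (2 * (hopf_p x \<bullet> \<alpha>))"
      unfolding inner_grad P(5,6) inner_cmul_i_self using c\<beta> by (simp add: inner_commute)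
    finally show ?thesis unfolding ix[of g] by simp
  qed
  show "dhopf x (cmul \<i> g) = 4 *\<^sub>R (\<beta>, - \<alpha>)"
    unfolding dhopf_def r_def[symmetric] pp qq xg using r
    by (simp add: algebra_simps power2_eq_square)
  show "inner g h = inner (\<alpha>, \<beta>) (dhopf x h)"
    unfolding dhopf_def g r_def[symmetric] using r c\<alpha>
    by (simp add: inner_Pair inner_add_left inner_diff_left inner_diff_right inner_grad inner_commute[of \<alpha> "hopf_q x"] power2_eq_square)
qed

section \<open>The pulled-back Hamiltonian on C^2 and the projection of its orbits\<close>

context star_shaped
begin

definition F :: "c2 \<Rightarrow> real" where "F x = (if x = 0 then 0 else G (hopf x))"

definition gF :: "c2 \<Rightarrow> c2" where
  "gF x = (if x = 0 then 0 else (1 / (norm x)\<^sup>2) *\<^sub>R grad_q x (fst (gG (hopf x)))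
     - (2 * G (hopf x) / (norm x)\<^sup>2) *\<^sub>R x + grad_p x (snd (gG (hopf x))))"

lemma hopf_flow:
  assumes x: "x \<noteq> 0"
  shows "dhopf x (cmul \<i> (gF x)) = 4 *\<^sub>R reeb (hopf x)" "inner (gF x) h = inner (gG (hopf x)) (dhopf x h)"
proof -
  have D: "(fst (hopf x), snd (hopf x)) \<in> cot_nonzero" using hopf_in[OF x] by simp
  note id = gG_identities[OF D, unfolded prod.collapse]
  have g: "gF x = (1 / (norm x)\<^sup>2) *\<^sub>R grad_q x (fst (gG (hopf x)))
     - (2 * G (hopf x) / (norm x)\<^sup>2) *\<^sub>R x + grad_p x (snd (gG (hopf x)))"
    using x by (simp add: gF_def)
  note flow = hopf_gradient_flow[OF x id(2) id(3) id(1) g]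
  show "dhopf x (cmul \<i> (gF x)) = 4 *\<^sub>R reeb (hopf x)" unfolding reeb_def by (rule flow(1))
  show "inner (gF x) h = inner (gG (hopf x)) (dhopf x h)" using flow(2)[of h] by simp
qed

lemma F_deriv_nonzero:
  assumes x: "x \<noteq> 0" shows "(F has_derivative (\<lambda>h. inner (gF x) h)) (at x)"
proof -
  have "((\<lambda>x. G (hopf x)) has_derivative (\<lambda>h. inner (gG (hopf x)) (dhopf x h))) (at x)"
    by (rule has_derivative_compose[OF hopf_has_derivative'[OF x] G_deriv[OF hopf_in[OF x]]])
  then have "((\<lambda>x. G (hopf x)) has_derivative (\<lambda>h. inner (gF x) h)) (at x)"
    using hopf_flow(2)[OF x] by simp
  moreover have "open (- {0 :: c2})" by (simp add: open_Compl)
  ultimately show ?thesis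
    by (rule has_derivative_transform_within_open) (use x in \<open>auto simp: F_def\<close>)
qed

lemma F_homogeneous: "s > 0 \<Longrightarrow> F (s *\<^sub>R x) = s\<^sup>2 * F x"
proof (cases "x = 0")
  case False
  assume s: "s > 0"
  have "(fst (hopf x), snd (hopf x)) \<in> cot_nonzero" using hopf_in[OF False] by simp
  from G_scale[OF this, of 1 "s\<^sup>2" 0] show ?thesis using False s by (simp add: F_def hopf_scale)
qed (simp add: F_def)

lemma F_even: "F (- x) = F x"
  by (simp add: F_def hopf_minus)

text \<open>The point of M on the ray of \<open>hopf x\<close> has norm |x|^2 / F x, which is at
  most the maximal radius.\<close>

lemma F_lower_bound: "(norm x)\<^sup>2 \<le> max_radius M * F x"
proof (cases "x = 0")
  case False
  have D: "(fst (hopf x), snd (hopf x)) \<in> cot_nonzero" using hopf_in[OF False] by simp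
  have Gp: "G (hopf x) > 0" "(fst (hopf x), (1 / G (hopf x)) *\<^sub>R snd (hopf x)) \<in> M"
    using G_pos_M[OF D] by simp_all
  have "norm ((1 / G (hopf x)) *\<^sub>R snd (hopf x)) \<le> max_radius M"
    using max_radius_is_max(2)[OF star Gp(2)] by (simp add: dual_round_metric_def norm_eq_sqrt_inner)
  then have "(norm x)\<^sup>2 / G (hopf x) \<le> max_radius M" using Gp(1) by (simp add: hopf_def norm_hopf_p)
  then show ?thesis using Gp(1) False by (simp add: F_def pos_divide_le_eq)
qed (simp add: F_def)

lemma isCont_gF_nonzero:
  assumes x: "x \<noteq> 0" shows "isCont gF x"
proof -
  have h: "isCont hopf x" by (rule has_derivative_continuous[OF hopf_has_derivative'[OF x]])
  have g: "isCont (\<lambda>x. gG (hopf x)) x" by (rule isCont_o2[OF h gG_isCont[OF hopf_in[OF x]]])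
  have G: "isCont (\<lambda>x. G (hopf x)) x"
    by (rule isCont_o2[OF h has_derivative_continuous[OF G_deriv[OF hopf_in[OF x]]]])
  have C: "isCont (\<lambda>x. Complex (u x) (v x)) x" if "isCont u x" "isCont v x" for u v :: "c2 \<Rightarrow> real"
    using that unfolding Complex_eq by (intro continuous_intros)
  have n: "isCont (\<lambda>x. vec_nth (f x) i) x" if "isCont f x" for f :: "c2 \<Rightarrow> real ^ 3" and i
    using that by (intro continuous_intros)
  have c: "isCont (\<lambda>x. (1 / (norm x)\<^sup>2) *\<^sub>R grad_q x (fst (gG (hopf x)))
     - (2 * G (hopf x) / (norm x)\<^sup>2) *\<^sub>R x + grad_p x (snd (gG (hopf x)))) x"
    unfolding grad_q_def grad_p_def
    by (intro continuous_intros C n g G) (use x in auto)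
  have "\<forall>\<^sub>F y in nhds x. (1 / (norm y)\<^sup>2) *\<^sub>R grad_q y (fst (gG (hopf y)))
     - (2 * G (hopf y) / (norm y)\<^sup>2) *\<^sub>R y + grad_p y (snd (gG (hopf y))) = gF y"
    by (rule eventually_mono[OF eventually_nhds_in_open[of "- {0}" x]]) (use x in \<open>auto simp: gF_def open_Compl\<close>)
  from iffD1[OF isCont_cong[OF this] c] show ?thesis .
qed

lemma gF_homogeneous: "s > 0 \<Longrightarrow> gF (s *\<^sub>R x) = s *\<^sub>R gF x"
proof (cases "x = 0")
  case False
  moreover assume s: "s > 0"
  ultimately have d: "(F has_derivative inner (gF (s *\<^sub>R x))) (at (s *\<^sub>R x))" "(F has_derivative inner (gF x)) (at x)"
    by (intro F_deriv_nonzero; simp)+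
  show ?thesis by (rule homogeneous_gradient[where F = F and s = s and x = x, OF F_homogeneous s d])
qed (simp add: gF_def)

text \<open>Homogeneity reduces the bounds to the unit sphere. They yield differentiability of F and
  continuity of its gradient at the origin, where the covering map degenerates.\<close>

lemma homogeneous_bounds: "\<exists>C>0. \<forall>x. \<bar>F x\<bar> \<le> C * (norm x)\<^sup>2 \<and> norm (gF x) \<le> C * norm x"
proof -
  have "continuous_on (sphere 0 1) F"
    by (intro continuous_at_imp_continuous_on ballI has_derivative_continuous[OF F_deriv_nonzero]) auto
  moreover have "continuous_on (sphere 0 1) gF"
    by (intro continuous_at_imp_continuous_on ballI isCont_gF_nonzero) auto
  ultimately have "bounded (F ` sphere 0 1)" "bounded (gF ` sphere 0 1)"
    by (auto intro!: compact_imp_bounded compact_continuous_image)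
  then obtain C1 C2 where C1: "C1 > 0" "\<And>x. norm x = 1 \<Longrightarrow> \<bar>F x\<bar> \<le> C1" and C2: "C2 > 0" "\<And>x. norm x = 1 \<Longrightarrow> norm (gF x) \<le> C2"
    unfolding bounded_pos by auto
  have "\<bar>F x\<bar> \<le> max C1 C2 * (norm x)\<^sup>2 \<and> norm (gF x) \<le> max C1 C2 * norm x" for x
  proof (cases "x = 0")
    case False
    define u where "u = x /\<^sub>R norm x"
    have u: "norm u = 1" "x = norm x *\<^sub>R u" using False by (simp_all add: u_def)
    have n: "norm x > 0" using False by simp
    have "\<bar>F x\<bar> = (norm x)\<^sup>2 * \<bar>F u\<bar>" using F_homogeneous[OF n, of u] u(2) by (simp add: abs_mult)
    also have "\<dots> \<le> (norm x)\<^sup>2 * max C1 C2" using C1(2)[OF u(1)] by (intro mult_left_mono) auto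
    finally have 1: "\<bar>F x\<bar> \<le> max C1 C2 * (norm x)\<^sup>2" by (simp add: mult.commute)
    have "gF x = norm x *\<^sub>R gF u" using gF_homogeneous[OF n, of u] u(2) by simp
    then have "norm (gF x) = norm x * norm (gF u)" by simp
    also have "\<dots> \<le> norm x * max C1 C2" using C2(2)[OF u(1)] by (intro mult_left_mono) auto
    finally show ?thesis using 1 by (simp add: mult.commute)
  qed (simp add: F_def gF_def)
  moreover have "max C1 C2 > 0" using C1(1) by (simp add: less_max_iff_disj)
  ultimately show ?thesis by blast
qed

lemma F_deriv: "(F has_derivative (\<lambda>h. inner (gF x) h)) (at x)"
proof (cases "x = 0")
  case True
  obtain C where C: "C > 0" "\<And>x. \<bar>F x\<bar> \<le> C * (norm x)\<^sup>2" using homogeneous_bounds by blast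
  have "((\<lambda>h. norm (F (0 + h) - F 0 - 0) / norm h) \<longlongrightarrow> 0) (at 0)"
  proof (rule Lim_null_comparison)
    show "((\<lambda>h. C * norm h) \<longlongrightarrow> 0) (at (0::c2))" by (auto intro!: tendsto_eq_intros)
    show "\<forall>\<^sub>F h in at 0. norm (norm (F (0 + h) - F 0 - 0) / norm h) \<le> C * norm h"
    proof (intro always_eventually allI)
      fix h :: c2
      have "\<bar>F h\<bar> / norm h \<le> C * norm h"
        using C(2)[of h] by (cases "h = 0") (auto simp: pos_divide_le_eq power2_eq_square mult.assoc)
      then show "norm (norm (F (0 + h) - F 0 - 0) / norm h) \<le> C * norm h" by (simp add: F_def[of 0])
    qed
  qed
  then have "(F has_derivative (\<lambda>h. 0)) (at 0)" by (simp add: has_derivative_at)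
  then show ?thesis using True by (simp add: gF_def)
qed (rule F_deriv_nonzero)

lemma gF_continuous: "continuous_on UNIV gF"
proof (intro continuous_at_imp_continuous_on ballI)
  fix x :: c2
  show "isCont gF x"
  proof (cases "x = 0")
    case True
    obtain C where C: "\<And>x. norm (gF x) \<le> C * norm x" using homogeneous_bounds by blast
    have "(gF \<longlongrightarrow> 0) (at 0)"
    proof (rule Lim_null_comparison)
      show "((\<lambda>h. C * norm h) \<longlongrightarrow> 0) (at (0::c2))" by (auto intro!: tendsto_eq_intros)
    qed (use C in auto)
    then show ?thesis using True by (simp add: isCont_def gF_def)
  qed (rule isCont_gF_nonzero)
qed

lemma max_radius_pos: "max_radius M > 0"
proof -
  define x :: c2 where "x = (1, 0)"
  have x: "x \<noteq> 0" by (simp add: x_def zero_prod_def)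
  have D: "(fst (hopf x), snd (hopf x)) \<in> cot_nonzero" using hopf_in[OF x] by simp
  have "F x > 0" using G_pos_M(1)[OF D] x by (simp add: F_def)
  moreover have "0 < max_radius M * F x" using F_lower_bound[of x] x zero_less_power2[of "norm x"] norm_eq_zero[of x]
    by (metis less_le_trans)
  ultimately show ?thesis by (simp add: zero_less_mult_iff)
qed

sublocale homogeneous_hamiltonian F gF "max_radius M"
  by unfold_locales (rule F_deriv gF_continuous F_homogeneous F_even max_radius_pos F_lower_bound; assumption?)+

text \<open>In the time of \<open>z\<close> the projected loop moves with 4 \<mu> times the Reeb
  field, and it closes up after pi because x and - x have the same projection. Rescaling time gives
  the period 4 \<mu> pi.\<close>

lemma short_periodic_reeb_orbit:
  obtains \<gamma> T where "reeb_orbit \<gamma> T" "T \<le> 2 * pi * max_radius M"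
proof -
  obtain z \<mu> where \<mu>: "0 < \<mu>" "\<mu> \<le> max_radius M / 2" and za: "\<And>t. z (t + pi) = - z t" and Fz: "\<And>t. F (z t) = 1"
    and zd: "\<And>t. (z has_vector_derivative \<mu> *\<^sub>R cmul \<i> (gF (z t))) (at t)"
    by (rule periodic_orbit) (rule that; assumption)
  have z0: "z t \<noteq> 0" for t using Fz[of t] by (auto simp: F_def)
  define \<gamma> where "\<gamma> t = hopf (z (t / (4 * \<mu>)))" for t
  have M: "hopf (z t) \<in> M_nonzero" for t
    using M_iff_G[of "fst (hopf (z t))" "snd (hopf (z t))"] hopf_in[OF z0[of t]] Fz[of t] z0[of t]
    by (simp add: M_nonzero_def F_def)
  have hz: "((\<lambda>t. hopf (z t)) has_vector_derivative (4 * \<mu>) *\<^sub>R reeb (hopf (z t))) (at t)" for t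
  proof -
    interpret d: bounded_linear "dhopf (z t)" using hopf_has_derivative'[OF z0] by (rule has_derivative_bounded_linear)
    have "((\<lambda>t. hopf (z t)) has_derivative (\<lambda>h. dhopf (z t) (h *\<^sub>R (\<mu> *\<^sub>R cmul \<i> (gF (z t)))))) (at t)"
      by (rule has_derivative_compose[OF zd[unfolded has_vector_derivative_def] hopf_has_derivative'[OF z0]])
    then show ?thesis unfolding has_vector_derivative_def
      by (simp add: d.scaleR hopf_flow(1)[OF z0] mult_ac)
  qed
  have "reeb_orbit \<gamma> (4 * \<mu> * pi)"
    unfolding periodic_reeb_orbit_iff
  proof (intro conjI allI)
    show "\<gamma> (t + 4 * \<mu> * pi) = \<gamma> t" for t
      using \<mu>(1) za[of "t / (4 * \<mu>)"] by (simp add: \<gamma>_def add_divide_distrib hopf_minus)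
    show "(\<gamma> has_vector_derivative reeb (\<gamma> t)) (at t)" for t
    proof -
      have "((\<lambda>t. t / (4 * \<mu>)) has_vector_derivative 1 / (4 * \<mu>)) (at t)"
        using \<mu>(1) by (auto intro!: derivative_eq_intros simp flip: has_real_derivative_iff_has_vector_derivative)
      from vector_diff_chain_at[OF this hz] show ?thesis using \<mu>(1) by (simp add: o_def \<gamma>_def[abs_def])
    qed
  qed (use \<mu>(1) M in \<open>auto simp: \<gamma>_def\<close>)
  moreover have "4 * \<mu> * pi \<le> 2 * pi * max_radius M"
    using mult_right_mono[OF \<mu>(2), of "4 * pi"] by (simp add: mult_ac)
  ultimately show ?thesis using that by blast
qed

end

theorem theorem2p1:
  fixes M :: "((real ^ 3) \<times> (real ^ 3)) set"
  assumes "fiberwise_star_shaped M"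
  shows "has_min_action M tautological_form \<and>
         min_action M tautological_form \<le> 2 * pi * max_radius M"
proof -
  interpret star_shaped M by unfold_locales (rule assms)
  obtain \<gamma> T where \<gamma>: "reeb_orbit \<gamma> T" "T \<le> 2 * pi * max_radius M"
    by (rule short_periodic_reeb_orbit)
  have min: "has_min_action M tautological_form" by (rule has_min_action_if_orbit[OF \<gamma>(1)])
  then obtain a where a: "a \<in> reeb_actions M tautological_form" "\<And>b. b \<in> reeb_actions M tautological_form \<Longrightarrow> a \<le> b"
    unfolding has_min_action_def by blast
  have "min_action M tautological_form = a" unfolding min_action_def by (rule Least_equality) (use a in auto)
  moreover have "T \<in> reeb_actions M tautological_form" unfolding reeb_actions_eq using \<gamma>(1) by blast
  ultimately show ?thesis using min a(2)[of T] \<gamma>(2) by simp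
qed

end
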